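(* Let $H:[0,T]\times\mathbb{R}^n\times\mathbb{R}^n\to\mathbb{R}$ satisfy (H1)–(H4) and (HLC), with $c(\cdot)$, each $k_R(\cdot)$ and $t\mapsto H(t,0,0)$ integrable on $[0,T]$. Let $(\mathbb{R}^{n+1},f,l)$ be the Steiner representation of $H$, $g:\mathbb{R}^n\to\mathbb{R}$ locally Lipschitz, and $$V(t_0,x_0)=\inf_{(x,a)(\cdot)\in S_f(t_0,x_0)}\Big\{g(x(T))+\int_{t_0}^T l(t,x(t),a(t))\,dt\Big\}.$$ Then for every $M>0$ there exist an absolutely continuous $\alpha_M:[0,T]\to\mathbb{R}$ and $C_M>0$ such that $$|V(t,x)-V(s,y)|\le|\alpha_M(t)-\alpha_M(s)|+C_M|x-y|\quad\text{for all } t,s\in[0,T],\ x,y\in\bar B_M.$$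
   Context: Hypotheses: (H1) $H(\cdot,x,p)$ Lebesgue measurable; (H2) $H(t,\cdot,\cdot)$ continuous; (H3) $H(t,x,\cdot)$ convex; (H4) there is measurable $c\ge0$ with $|H(t,x,p)-H(t,x,q)|\le c(t)(1+|x|)|p-q|$; (HLC) for each $R>0$ there is measurable $k_R\ge0$ with $|H(t,x,p)-H(t,y,p)|\le k_R(t)(1+|p|)|x-y|$ for $x,y\in\bar B_R$ (closed ball radius $R$ about $0$), all $p$. $H^*(t,x,v)=\sup_p\{\langle v,p\rangle-H(t,x,p)\}$. $S_f(t_0,x_0)$: pairs $x(\cdot)$ absolutely continuous on $[t_0,T]$, $a(\cdot)\in L^1([t_0,T],\mathbb{R}^{n+1})$, $\dot x=f(t,x,a)$ a.e., $x(t_0)=x_0$. Steiner representation: $E(t,x)=\mathrm{epi}\,H^*(t,x,\cdot)\subset\mathbb{R}^{n+1}$; $\Phi(t,x,a)=E(t,x)\cap\bar B(a,2d(a,E(t,x)))$; Steiner point $s_m(K)=m\int_{S^{m-1}}p\max_{y\in K}\langle p,y\rangle\,\mu(dp)$ ($\mu$ normalized rotation-invariant measure on the unit sphere); $(f,l)(t,x,a)=s_{n+1}(\Phi(t,x,a))$ with $f\in\mathbb{R}^n$, $l\in\mathbb{R}$. *)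

theory Defs
  imports "HOL-Analysis.Analysis"
begin

definition abs_continuous_on :: "real set \<Rightarrow> (real \<Rightarrow> 'b::real_normed_vector) \<Rightarrow> bool" where
  "abs_continuous_on S u \<longleftrightarrow>
     (\<forall>e>0. \<exists>d>0. \<forall>(I::nat set) a b. finite I \<longrightarrow>
        (\<forall>i\<in>I. a i \<in> S \<and> b i \<in> S \<and> a i \<le> b i) \<longrightarrow>
        (\<forall>i\<in>I. \<forall>j\<in>I. i \<noteq> j \<longrightarrow> {a i<..<b i} \<inter> {a j<..<b j} = {}) \<longrightarrow>
        (\<Sum>i\<in>I. b i - a i) < d \<longrightarrow> (\<Sum>i\<in>I. norm (u (b i) - u (a i))) < e)"

text \<open>Normalized rotation-invariant measure on the unit sphere, realized as the image of the
  uniform probability measure on the unit ball under radial projection.\<close>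
definition sphere_measure :: "'a::euclidean_space measure" where
  "sphere_measure = distr (uniform_measure lborel (ball 0 1)) borel (\<lambda>x. x /\<^sub>R norm x)"

definition support_fun :: "'a::euclidean_space set \<Rightarrow> 'a \<Rightarrow> real" where
  "support_fun K p = (SUP y\<in>K. p \<bullet> y)"

definition steiner_point :: "'a::euclidean_space set \<Rightarrow> 'a" where
  "steiner_point K = real DIM('a) *\<^sub>R
     integral\<^sup>L sphere_measure (\<lambda>p. support_fun K p *\<^sub>R p)"

definition Hstar :: "(real \<Rightarrow> 'n::euclidean_space \<Rightarrow> 'n \<Rightarrow> real) \<Rightarrow> real \<Rightarrow> 'n \<Rightarrow> 'n \<Rightarrow> ereal" where
  "Hstar H t x v = (SUP p. ereal (v \<bullet> p - H t x p))"

definition epiH :: "(real \<Rightarrow> 'n::euclidean_space \<Rightarrow> 'n \<Rightarrow> real) \<Rightarrow> real \<Rightarrow> 'n \<Rightarrow> ('n \<times> real) set" where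
  "epiH H t x = {(v, r). Hstar H t x v \<le> ereal r}"

definition PhiH :: "(real \<Rightarrow> 'n::euclidean_space \<Rightarrow> 'n \<Rightarrow> real) \<Rightarrow> real \<Rightarrow> 'n \<Rightarrow> 'n \<times> real \<Rightarrow> ('n \<times> real) set" where
  "PhiH H t x a = epiH H t x \<inter> cball a (2 * infdist a (epiH H t x))"

definition steiner_f :: "(real \<Rightarrow> 'n::euclidean_space \<Rightarrow> 'n \<Rightarrow> real) \<Rightarrow> real \<Rightarrow> 'n \<Rightarrow> 'n \<times> real \<Rightarrow> 'n" where
  "steiner_f H t x a = fst (steiner_point (PhiH H t x a))"

definition steiner_l :: "(real \<Rightarrow> 'n::euclidean_space \<Rightarrow> 'n \<Rightarrow> real) \<Rightarrow> real \<Rightarrow> 'n \<Rightarrow> 'n \<times> real \<Rightarrow> real" where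
  "steiner_l H t x a = snd (steiner_point (PhiH H t x a))"

definition trajectories ::
  "(real \<Rightarrow> 'n::euclidean_space \<Rightarrow> 'c::euclidean_space \<Rightarrow> 'n) \<Rightarrow> real \<Rightarrow> real \<Rightarrow> 'n
     \<Rightarrow> ((real \<Rightarrow> 'n) \<times> (real \<Rightarrow> 'c)) set" where
  "trajectories f T t0 x0 = {(x, a).
      abs_continuous_on {t0..T} x \<and>
      a absolutely_integrable_on {t0..T} \<and>
      (AE t in lebesgue. t \<in> {t0..T} \<longrightarrow>
          (x has_vector_derivative f t (x t) (a t)) (at t within {t0..T})) \<and>
      x t0 = x0}"

definition run_cost :: "(real \<Rightarrow> 'n \<Rightarrow> 'c \<Rightarrow> real) \<Rightarrow> real \<Rightarrow> real \<Rightarrow> (real \<Rightarrow> 'n) \<Rightarrow> (real \<Rightarrow> 'c) \<Rightarrow> ereal" where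
  "run_cost l T t0 x a =
     (if (\<lambda>t. l t (x t) (a t)) integrable_on {t0..T}
         \<and> (\<lambda>t. l t (x t) (a t)) \<in> borel_measurable (restrict_space lebesgue {t0..T})
      then ereal (integral {t0..T} (\<lambda>t. l t (x t) (a t))) else \<infinity>)"

definition value_fun ::
  "(real \<Rightarrow> 'n::euclidean_space \<Rightarrow> 'c::euclidean_space \<Rightarrow> 'n) \<Rightarrow> (real \<Rightarrow> 'n \<Rightarrow> 'c \<Rightarrow> real)
     \<Rightarrow> ('n \<Rightarrow> real) \<Rightarrow> real \<Rightarrow> real \<Rightarrow> 'n \<Rightarrow> ereal" where
  "value_fun f l g T t0 x0 =
     (INF xa \<in> trajectories f T t0 x0. ereal (g (fst xa T)) + run_cost l T t0 (fst xa) (snd xa))"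

end

theory Submission
  imports Defs
begin

text \<open>
  Write \<open>E t x\<close> for the epigraph of \<open>Hstar H t x\<close>. The Steiner point of a compact convex set lies in
  the set, and \<open>PhiH H t x a = {a}\<close> whenever \<open>a \<in> E t x\<close>. Hence the value function is the infimum of
  \<open>g (x T) + \<integral> r\<close> over the absolutely continuous \<open>x\<close> and the integrable \<open>r\<close> with \<open>(x', r) \<in> E t x\<close>,
  and no regularity of the Steiner representation itself is needed.

  By duality the distance of \<open>(v, r)\<close> to \<open>E t x\<close> is the least \<open>\<rho> \<ge> 0\<close> with
  \<open>v \<bullet> p - r - H t x p \<le> \<rho> * norm (p, 1)\<close> for all \<open>p\<close>. Therefore \<open>E t x\<close> is Lipschitz in \<open>x\<close> on balls
  and nearest-point projections onto it are measurable in \<open>t\<close>. Filippov's iteration then transports a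
  trajectory issuing from \<open>(s, y)\<close> to one issuing from \<open>(t, x)\<close>, with errors controlled by
  \<open>norm (x - y)\<close> and by the integral between \<open>s\<close> and \<open>t\<close> of a function \<open>h\<close> that bounds both the
  speeds and the distance of \<open>0\<close> to \<open>E\<close>. If \<open>t < s\<close>, the trajectory is first prolonged backwards as
  a constant.
\<close>

section \<open>Absolutely continuous functions\<close>

text \<open>Two descriptions of a trajectory have to be matched. \<open>trajectories\<close> asks
  for epsilon-delta absolute continuity and a derivative almost everywhere, whereas every estimate
  is about integrals of velocities; almost-everywhere differentiation of indefinite integrals and
  the fundamental theorem for absolutely continuous functions translate in both directions.

  The Lipschitz hypothesis in x is only local. Speeds are at most \<open>c t * (1 + norm x)\<close>,
  so Gronwall confines all trajectories starting in the ball of radius M to the radius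
  \<open>R = 2 * (1 + M) * exp (2 * integral {0..T} c)\<close>, and only the function k belonging to
  this R enters.

  The factors 2 in the exponents come from one device: the integral of
  \<open>k * exp (2 * K)\<close> is at most half of \<open>exp (2 * K)\<close>. This absorbs the
  integral term in Gronwall's inequality and makes the Filippov iteration contract by 1/2.

  Membership of the Steiner point in its set is read off from the inequality between its inner
  product with a unit vector and the support function, a consequence of integrating the support
  function by parts over the unit ball.\<close>

lemma cball_midpoint_real:
  fixes x y :: real
  shows "cball ((x + y) / 2) (\<bar>y - x\<bar> / 2) = {min x y..max x y}"
  by (auto simp: cball_eq_atLeastAtMost abs_if min_def max_def field_simps)

lemma integral_increment:
  fixes f :: "real \<Rightarrow> 'b::euclidean_space"
  assumes "f integrable_on {a..b}" "a \<le> s" "s \<le> t" "t \<le> b"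
  shows "integral {a..t} f - integral {a..s} f = integral {s..t} f"
  using Henstock_Kurzweil_Integration.integral_combine[of a s t f] assms
      integrable_subinterval_real[OF assms(1), of a t] by (auto simp: algebra_simps)

lemma norm_integral_increment:
  fixes f :: "real \<Rightarrow> 'b::euclidean_space"
  assumes f: "f integrable_on {a..b}" and "x \<in> {a..b}" "y \<in> {a..b}"
  shows "norm (measure lborel {min x y..max x y} *\<^sub>R f x - integral {min x y..max x y} f) =
    norm (integral {a..y} f - integral {a..x} f - (y - x) *\<^sub>R f x)"
proof -
  note * = integral_increment[OF f]
  show ?thesis
  proof (cases "x \<le> y")
    case True
    then show ?thesis using *[of x y] assms by (simp add: norm_minus_commute)
  next
    case False
    then have "integral {a..y} f - integral {a..x} f - (y - x) *\<^sub>R f x = (x - y) *\<^sub>R f x - integral {y..x} f"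
      using *[of y x] assms by (simp add: algebra_simps)
    with False show ?thesis by simp
  qed
qed

text \<open>At a bad point arbitrarily short intervals violate the Henstock estimate by a fixed proportion
  of their length, so the total length of a Vitali family of such intervals is small.\<close>

lemma negligible_non_derivative_points:
  fixes f :: "real \<Rightarrow> 'b::euclidean_space"
  assumes f: "f integrable_on {a..b}" and "\<eta> > 0"
  defines "F \<equiv> \<lambda>u. integral {a..u} f"
  shows "negligible {x \<in> {a..b}. \<forall>d>0. \<exists>y\<in>{a..b}. \<bar>y - x\<bar> < d \<and>
            norm (F y - F x - (y - x) *\<^sub>R f x) > \<eta> * \<bar>y - x\<bar>}" (is "negligible ?B")
  unfolding negligible_outer_le
proof (intro allI impI)
  fix e :: real assume "e > 0"
  then have ee: "\<eta> * e > 0" using \<open>\<eta> > 0\<close> by simp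
  \<comment> \<open>The tolerance carries the factor \<open>\<eta>\<close> because each bad interval
    errs by at least \<open>\<eta>\<close> times its length; dividing it out leaves total length at
    most \<open>e\<close>.\<close>
  obtain \<gamma> where g: "gauge \<gamma>" and \<gamma>: "\<And>p. \<lbrakk>p tagged_partial_division_of (cbox a b); \<gamma> fine p\<rbrakk> \<Longrightarrow>
             sum (\<lambda>(x,k). norm(measure lborel k *\<^sub>R f x - integral k f)) p < \<eta> * e"
    using Henstock_lemma[of f a b "\<eta> * e"] f ee by auto
  \<comment> \<open>A pair codes the interval between a bad point \<open>x\<close>, which becomes
    the tag, and a witness \<open>y\<close> on either side of it, hence \<open>min\<close> and
    \<open>max\<close>. Intervals are presented as balls about their midpoints to suit Vitali's
    theorem; lying in \<open>\<gamma> x\<close> makes finite disjoint subfamilies fine.\<close>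
  define K where "K = {(x, y). x \<in> {a..b} \<and> y \<in> {a..b} \<and> {min x y..max x y} \<subseteq> \<gamma> x \<and>
            norm (F y - F x - (y - x) *\<^sub>R f x) > \<eta> * \<bar>y - x\<bar>}"
  define m where "m = (\<lambda>(x::real, y). (x + y) / 2)"
  define r where "r = (\<lambda>(x::real, y). \<bar>y - x\<bar> / 2)"
  have rpos: "0 < r i" if "i \<in> K" for i
    using that by (force simp: K_def r_def)
  have cb: "cball (m i) (r i) = {min (fst i) (snd i)..max (fst i) (snd i)}" for i
    using cball_midpoint_real[of "fst i" "snd i"] by (simp add: m_def r_def case_prod_beta)
  have cov: "\<exists>i. i \<in> K \<and> x \<in> cball (m i) (r i) \<and> r i < d" if "x \<in> ?B" "0 < d" for x d
  proof -
    obtain d' where d': "d' > 0" "ball x d' \<subseteq> \<gamma> x"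
      using g by (metis gauge_def open_contains_ball)
    obtain y where y: "y \<in> {a..b}" "\<bar>y - x\<bar> < min d d'" "norm (F y - F x - (y - x) *\<^sub>R f x) > \<eta> * \<bar>y - x\<bar>"
    proof -
      have "min d d' > 0" using \<open>0 < d\<close> d'(1) by simp
      then show ?thesis using \<open>x \<in> ?B\<close> that by blast
    qed
    have "{min x y..max x y} \<subseteq> ball x d'"
      using y(2) by (auto simp: dist_real_def)
    then have "(x, y) \<in> K"
      using y d' that by (auto simp: K_def)
    moreover have "x \<in> cball (m (x, y)) (r (x, y))" unfolding cb by simp
    moreover have "r (x, y) < d" using y(2) that(2) by (simp add: r_def)
    ultimately show ?thesis by blast
  qed
  obtain C where C: "countable C" "C \<subseteq> K"
     and dis: "pairwise (\<lambda>i j. disjnt (cball (m i) (r i)) (cball (m j) (r j))) C"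
     and neg: "negligible(?B - (\<Union>i \<in> C. cball (m i) (r i)))"
    by (rule Vitali_covering_theorem_cballs[of K r ?B m, OF rpos cov]) auto
  let ?D = "(\<lambda>i. cball (m i) (r i)) ` C"
  \<comment> \<open>A finite disjoint subfamily is a fine tagged partial division, so Henstock's
    lemma bounds its total error and thereby its total length. The bound is uniform in the subfamily
    and passes to the countable union.\<close>
  have fin: "measure lebesgue (\<Union>D') \<le> e" if D': "D' \<subseteq> ?D" "finite D'" for D'
  proof -
    obtain C' where C': "C' \<subseteq> C" "finite C'" "D' = (\<lambda>i. cball (m i) (r i)) ` C'"
      using finite_subset_image[OF D'(2,1)] by blast
    define p where "p = (\<lambda>i. (fst i, cball (m i) (r i))) ` C'"
    have inj: "inj_on (\<lambda>i. (fst i, cball (m i) (r i))) C'"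
    proof (rule inj_onI)
      fix i j assume ij: "i \<in> C'" "j \<in> C'" "(fst i, cball (m i) (r i)) = (fst j, cball (m j) (r j))"
      show "i = j"
      proof (rule ccontr)
        assume "i \<noteq> j"
        then have "disjnt (cball (m i) (r i)) (cball (m j) (r j))"
          using dis C'(1) ij by (meson pairwise_def subsetD)
        moreover have "fst i \<in> cball (m i) (r i)" by (simp add: cb)
        moreover have "cball (m i) (r i) = cball (m j) (r j)" using ij(3) by simp
        ultimately show False unfolding disjnt_def by (metis Int_absorb empty_iff)
      qed
    qed
    have tag: "p tagged_partial_division_of (cbox a b)"
      unfolding tagged_partial_division_of_def
    proof (intro conjI allI impI)
      show "finite p" using C' by (simp add: p_def)
      fix x k assume "(x, k) \<in> p"
      then obtain i where i: "i \<in> C'" "x = fst i" "k = cball (m i) (r i)" by (auto simp: p_def)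
      then have "i \<in> K" using C C' by blast
      then show "x \<in> k" "k \<subseteq> cbox a b" "\<exists>a b. k = cbox a b"
        using i by (auto simp: cb K_def case_prod_beta)
    next
      fix x k x' k' assume xk: "(x, k) \<in> p \<and> (x', k') \<in> p \<and> (x, k) \<noteq> (x', k')"
      then obtain i where i: "i \<in> C'" "x = fst i" "k = cball (m i) (r i)" by (auto simp: p_def)
      obtain j where j: "j \<in> C'" "x' = fst j" "k' = cball (m j) (r j)" using xk by (auto simp: p_def)
      have "i \<noteq> j" using xk i j by auto
      then have "disjnt k k'" using dis C'(1) i j by (meson pairwise_def subsetD)
      then show "interior k \<inter> interior k' = {}"
        using interior_subset[of k] interior_subset[of k'] unfolding disjnt_def by blast
    qed
    have "\<gamma> fine p"
    proof (rule fineI)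
      fix x k assume "(x, k) \<in> p"
      then obtain i where i: "i \<in> C'" "x = fst i" "k = cball (m i) (r i)" by (auto simp: p_def)
      then have "i \<in> K" using C C' by blast
      then show "k \<subseteq> \<gamma> x" using i by (simp add: cb K_def case_prod_beta)
    qed
    from \<gamma>[OF tag this] have 1: "(\<Sum>i\<in>C'. norm (measure lborel (cball (m i) (r i)) *\<^sub>R f (fst i) - integral (cball (m i) (r i)) f)) < \<eta> * e"
      unfolding p_def by (subst (asm) sum.reindex[OF inj]) (simp add: o_def)
    have 2: "\<eta> * measure lebesgue (cball (m i) (r i)) \<le>
        norm (measure lborel (cball (m i) (r i)) *\<^sub>R f (fst i) - integral (cball (m i) (r i)) f)" if "i \<in> C'" for i
    proof -
      have iK: "i \<in> K" using that C C' by blast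
      have "measure lebesgue (cball (m i) (r i)) = \<bar>snd i - fst i\<bar>"
        unfolding cb by (auto simp: min_def max_def)
      moreover have "norm (measure lborel (cball (m i) (r i)) *\<^sub>R f (fst i) - integral (cball (m i) (r i)) f)
         = norm (F (snd i) - F (fst i) - (snd i - fst i) *\<^sub>R f (fst i))"
        unfolding cb F_def using iK by (intro norm_integral_increment[OF f]) (auto simp: K_def case_prod_beta)
      ultimately show ?thesis using iK by (auto simp: K_def case_prod_beta)
    qed
    have "measure lebesgue (\<Union>D') \<le> (\<Sum>i\<in>C'. measure lebesgue (cball (m i) (r i)))"
      unfolding C'(3) by (rule measure_UNION_le) (use C' in auto)
    then have "\<eta> * measure lebesgue (\<Union>D') \<le> \<eta> * (\<Sum>i\<in>C'. measure lebesgue (cball (m i) (r i)))"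
      using \<open>\<eta> > 0\<close> by simp
    also have "\<dots> \<le> (\<Sum>i\<in>C'. norm (measure lborel (cball (m i) (r i)) *\<^sub>R f (fst i) - integral (cball (m i) (r i)) f))"
      unfolding sum_distrib_left by (intro sum_mono 2)
    also note less_imp_le[OF 1]
    finally show ?thesis using \<open>\<eta> > 0\<close> by simp
  qed
  have meas: "D \<in> lmeasurable" if "D \<in> ?D" for D using that by auto
  have cnt: "countable ?D" using C by simp
  have D: "\<Union>?D \<in> lmeasurable" "measure lebesgue (\<Union>?D) \<le> e"
    by (rule fmeasurable_Union_bound[OF cnt meas fin] measure_Union_bound[OF cnt meas fin]; assumption)+
  define Z where "Z = ?B - (\<Union>i \<in> C. cball (m i) (r i))"
  have Z: "negligible Z" using neg by (simp add: Z_def)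
  show "\<exists>T. ?B \<subseteq> T \<and> T \<in> lmeasurable \<and> measure lebesgue T \<le> e"
  proof (intro exI conjI)
    show "?B \<subseteq> \<Union>?D \<union> Z" by (auto simp: Z_def)
    show "\<Union>?D \<union> Z \<in> lmeasurable"
      by (rule fmeasurable.Un[OF D(1) negligible_imp_measurable[OF Z]])
    have "measure lebesgue (\<Union>?D \<union> Z) \<le> measure lebesgue (\<Union>?D) + measure lebesgue Z"
      by (rule measure_Un_le[OF fmeasurableD[OF D(1)] negligible_imp_sets[OF Z]])
    also have "\<dots> \<le> e" using D(2) Z by (simp only: negligible_imp_measure0)
    finally show "measure lebesgue (\<Union>?D \<union> Z) \<le> e" .
  qed
qed

text \<open>Where the derivative fails to be \<open>f x\<close>, the point is bad for some tolerance
  1/(n+1); the exceptional set is thus a countable union of null sets.\<close>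

theorem indefinite_integral_has_vector_derivative_ae:
  fixes f :: "real \<Rightarrow> 'b::euclidean_space"
  assumes f: "f integrable_on {a..b}"
  obtains N where "negligible N"
    "\<And>x. x \<in> {a..b} - N \<Longrightarrow> ((\<lambda>u. integral {a..u} f) has_vector_derivative f x) (at x within {a..b})"
proof
  define F where "F = (\<lambda>u. integral {a..u} f)"
  define B where "B = (\<lambda>n. {x \<in> {a..b}. \<forall>d>0. \<exists>y\<in>{a..b}. \<bar>y - x\<bar> < d \<and>
            norm (F y - F x - (y - x) *\<^sub>R f x) > inverse (real (Suc n)) * \<bar>y - x\<bar>})"
  show "negligible (\<Union>n. B n)"
    unfolding B_def F_def by (intro negligible_Union_nat negligible_non_derivative_points f) simp
  fix x assume x: "x \<in> {a..b} - (\<Union>n. B n)"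
  have "\<exists>d>0. \<forall>y\<in>{a..b}. norm (y - x) < d \<longrightarrow> norm (F y - F x - (y - x) *\<^sub>R f x) \<le> e * norm (y - x)"
    if e: "e > 0" for e
  proof -
    obtain n where n: "inverse (real (Suc n)) < e" using reals_Archimedean[OF e] by blast
    have "x \<notin> B n" using x by auto
    then obtain d where "d > 0" "\<forall>y\<in>{a..b}. \<bar>y - x\<bar> < d \<longrightarrow>
       norm (F y - F x - (y - x) *\<^sub>R f x) \<le> inverse (real (Suc n)) * \<bar>y - x\<bar>"
      using x unfolding B_def by force
    moreover have "inverse (real (Suc n)) * \<bar>y - x\<bar> \<le> e * \<bar>y - x\<bar>" for y
      using n by (intro mult_right_mono) auto
    ultimately show ?thesis by (intro exI[of _ d]) (auto intro: order_trans)
  qed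
  then show "((\<lambda>u. integral {a..u} f) has_vector_derivative f x) (at x within {a..b})"
    unfolding F_def[symmetric] has_vector_derivative_def has_derivative_within_alt
    by (auto simp: bounded_linear_scaleR_left)
qed

section \<open>Absolute continuity and the fundamental theorem of calculus\<close>

text \<open>Finite families can be renumbered by naturals, which frees the index type. The
  fundamental theorem below indexes its intervals by pairs of a tag and a set.\<close>

lemma abs_continuous_onE:
  assumes "abs_continuous_on S u" "e > 0"
  obtains d where "d > 0" "\<forall>(I::'i set) a b. finite I \<longrightarrow> (\<forall>i\<in>I. a i \<in> S \<and> b i \<in> S \<and> a i \<le> b i) \<longrightarrow>
        (\<forall>i\<in>I. \<forall>j\<in>I. i \<noteq> j \<longrightarrow> {a i<..<b i} \<inter> {a j<..<b j} = {}) \<longrightarrow>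
        (\<Sum>i\<in>I. b i - a i) < d \<longrightarrow> (\<Sum>i\<in>I. norm (u (b i) - u (a i))) < e"
proof -
  obtain d where d: "d > 0" and d': "\<forall>(I::nat set) a b. finite I \<longrightarrow>
        (\<forall>i\<in>I. a i \<in> S \<and> b i \<in> S \<and> a i \<le> b i) \<longrightarrow>
        (\<forall>i\<in>I. \<forall>j\<in>I. i \<noteq> j \<longrightarrow> {a i<..<b i} \<inter> {a j<..<b j} = {}) \<longrightarrow>
        (\<Sum>i\<in>I. b i - a i) < d \<longrightarrow> (\<Sum>i\<in>I. norm (u (b i) - u (a i))) < e"
    using assms unfolding abs_continuous_on_def by (elim allE[of _ e] impE exE conjE)
  have "(\<Sum>i\<in>I. norm (u (b i) - u (a i))) < e"
    if I: "finite I" "\<forall>i\<in>I. a i \<in> S \<and> b i \<in> S \<and> a i \<le> b i"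
      "\<forall>i\<in>I. \<forall>j\<in>I. i \<noteq> j \<longrightarrow> {a i<..<b i} \<inter> {a j<..<b j} = {}" "(\<Sum>i\<in>I. b i - a i) < d"
    for I :: "'i set" and a b
  proof -
    obtain h where h: "bij_betw h {0..<card I} I" using ex_bij_betw_nat_finite[OF I(1)] by blast
    have hI: "h i \<in> I" if "i \<in> {0..<card I}" for i using bij_betwE[OF h] that by blast
    have "(\<Sum>i\<in>{0..<card I}. norm (u (b (h i)) - u (a (h i)))) < e"
    proof (rule d'[rule_format, of "{0..<card I}" "\<lambda>i. a (h i)" "\<lambda>i. b (h i)"])
      fix i j assume ij: "i \<in> {0..<card I}" "j \<in> {0..<card I}" "i \<noteq> j"
      then have "h i \<noteq> h j" using h by (auto simp: bij_betw_def dest: inj_onD)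
      then show "{a (h i)<..<b (h i)} \<inter> {a (h j)<..<b (h j)} = {}"
        using hI[OF ij(1)] hI[OF ij(2)] I(3) by blast
    next
      show "(\<Sum>i\<in>{0..<card I}. b (h i) - a (h i)) < d"
        using I(4) sum.reindex_bij_betw[OF h, of "\<lambda>i. b i - a i"] by simp
    qed (use I(2) hI in auto)
    then show ?thesis
      using sum.reindex_bij_betw[OF h, of "\<lambda>i. norm (u (b i) - u (a i))"] by simp
  qed
  then show thesis by (intro that[OF d] allI impI)
qed

text \<open>Open intervals make the indicators sum to at most one everywhere, even where closed
  intervals would share an endpoint.\<close>

lemma sum_integral_disjoint_le:
  fixes g :: "real \<Rightarrow> real"
  assumes g: "g integrable_on {a..b}" and nn: "\<And>x. x \<in> {a..b} \<Longrightarrow> 0 \<le> g x" and "finite I"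
    and ab: "\<And>i. i \<in> I \<Longrightarrow> l i \<in> {a..b} \<and> u i \<in> {a..b}"
    and dis: "\<And>i j. i \<in> I \<Longrightarrow> j \<in> I \<Longrightarrow> i \<noteq> j \<Longrightarrow> {l i<..<u i} \<inter> {l j<..<u j} = {}"
  shows "(\<Sum>i\<in>I. integral {l i..u i} g) \<le> integral {a..b} g"
proof -
  let ?g = "\<lambda>i x. if x \<in> {l i<..<u i} then g x else 0"
  have int: "(?g i has_integral integral {l i..u i} g) {a..b}" if "i \<in> I" for i
  proof -
    have "(g has_integral integral {l i..u i} g) {l i<..<u i}"
      using integrable_subinterval_real[OF g, of "l i" "u i"] ab[OF that] has_integral_open_interval[of g _ "l i" "u i"]
      by (auto simp: integrable_integral)
    moreover have "{l i<..<u i} \<subseteq> {a..b}" using ab[OF that] by auto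
    ultimately show ?thesis using has_integral_restrict[of "{l i<..<u i}" "{a..b}" g] by simp
  qed
  have 1: "((\<lambda>x. \<Sum>i\<in>I. ?g i x) has_integral (\<Sum>i\<in>I. integral {l i..u i} g)) {a..b}"
    by (rule has_integral_sum[OF \<open>finite I\<close> int])
  show ?thesis
  proof (rule has_integral_le[OF 1 integrable_integral[OF g]])
    fix x assume x: "x \<in> {a..b}"
    show "(\<Sum>i\<in>I. ?g i x) \<le> g x"
    proof (cases "\<exists>i\<in>I. x \<in> {l i<..<u i}")
      case True
      then obtain i where i: "i \<in> I" "x \<in> {l i<..<u i}" by blast
      have "?g j x = 0" if "j \<in> I - {i}" for j
        using dis[of i j] i that by auto
      then have "(\<Sum>i\<in>I. ?g i x) = ?g i x"
        using i \<open>finite I\<close> by (simp add: sum.remove)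
      then show ?thesis using i by simp
    next
      case False
      then have "(\<Sum>i\<in>I. ?g i x) = 0" by (intro sum.neutral) auto
      then show ?thesis using nn[OF x] by simp
    qed
  qed
qed

text \<open>Splits an integrable function into a bounded part and a remainder of arbitrarily small
  integral, by dominated convergence.\<close>

lemma truncation_integral_tendsto:
  fixes h :: "real \<Rightarrow> real"
  assumes h: "h absolutely_integrable_on S" and S: "S \<in> sets lebesgue" and nn: "\<And>x. 0 \<le> h x"
  shows "(\<lambda>x. h x - min (h x) (real n)) integrable_on S"
    and "(\<lambda>n. integral S (\<lambda>x. h x - min (h x) (real n))) \<longlonglongrightarrow> 0"
proof -
  have hi: "h integrable_on S" using h by (simp add: absolutely_integrable_on_def)
  have m [measurable]: "h \<in> borel_measurable (lebesgue_on S)"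
    by (rule absolutely_integrable_imp_borel_measurable[OF h S])
  have bd: "norm (h x - min (h x) (real n)) \<le> h x" for x n using nn[of x] by (simp add: min_def)
  show int: "(\<lambda>x. h x - min (h x) (real n)) integrable_on S" for n
    by (rule measurable_bounded_by_integrable_imp_integrable[OF _ hi bd S]) measurable
  have "(\<lambda>n. integral S (\<lambda>x. h x - min (h x) (real n))) \<longlonglongrightarrow> integral S (\<lambda>x. 0)"
  proof (rule dominated_convergence[OF int hi bd])
    fix x
    have "eventually (\<lambda>n. h x - min (h x) (real n) = 0) sequentially"
      using eventually_ge_at_top[of "nat \<lceil>h x\<rceil>"]
    proof eventually_elim
      case (elim n)
      then have "h x \<le> real n" by linarith
      then show ?case by (simp add: min_def)
    qed
    then show "(\<lambda>n. h x - min (h x) (real n)) \<longlonglongrightarrow> 0" by (rule tendsto_eventually)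
  qed
  then show "(\<lambda>n. integral S (\<lambda>x. h x - min (h x) (real n))) \<longlonglongrightarrow> 0" by simp
qed

text \<open>The norm of \<open>f\<close> is at most \<open>n\<close> plus a remainder whose integral
  over the whole interval is below \<open>e / 2\<close>; the bounded part contributes at most
  \<open>n\<close> times the total length.\<close>

theorem abs_continuous_on_indefinite_integral:
  fixes f :: "real \<Rightarrow> 'b::euclidean_space"
  assumes f: "f absolutely_integrable_on {a..b}"
  shows "abs_continuous_on {a..b} (\<lambda>u. integral {a..u} f)"
  unfolding abs_continuous_on_def
proof (intro allI impI)
  fix e :: real assume e: "e > 0"
  let ?h = "\<lambda>x. norm (f x)"
  have h: "?h absolutely_integrable_on {a..b}" using f absolutely_integrable_norm[OF f] by (simp add: o_def)
  have fi: "f integrable_on {a..b}" and hi: "?h integrable_on {a..b}"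
    using f h by (auto simp: absolutely_integrable_on_def)
  define g where "g = (\<lambda>n x. ?h x - min (?h x) (real n))"
  have g: "g n integrable_on {a..b}" and glim: "(\<lambda>n. integral {a..b} (g n)) \<longlonglongrightarrow> 0" for n
    using truncation_integral_tendsto[OF h] by (auto simp: g_def)
  obtain n where n: "integral {a..b} (g n) < e / 2"
    using order_tendstoD(2)[OF glim, of "e/2"] e by (auto simp: eventually_sequentially)
  show "\<exists>d>0. \<forall>(I::nat set) l u. finite I \<longrightarrow> (\<forall>i\<in>I. l i \<in> {a..b} \<and> u i \<in> {a..b} \<and> l i \<le> u i) \<longrightarrow>
        (\<forall>i\<in>I. \<forall>j\<in>I. i \<noteq> j \<longrightarrow> {l i<..<u i} \<inter> {l j<..<u j} = {}) \<longrightarrow>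
        (\<Sum>i\<in>I. u i - l i) < d \<longrightarrow>
        (\<Sum>i\<in>I. norm (integral {a..u i} f - integral {a..l i} f)) < e"
  proof (intro exI conjI allI impI)
    \<comment> \<open>\<open>Suc n\<close> keeps the denominator positive when the truncation level
      is 0.\<close>
    show "e / (2 * real (Suc n)) > 0" using e by simp
    fix I :: "nat set" and l u
    assume I: "finite I" "\<forall>i\<in>I. l i \<in> {a..b} \<and> u i \<in> {a..b} \<and> l i \<le> u i"
      "\<forall>i\<in>I. \<forall>j\<in>I. i \<noteq> j \<longrightarrow> {l i<..<u i} \<inter> {l j<..<u j} = {}"
      "(\<Sum>i\<in>I. u i - l i) < e / (2 * real (Suc n))"
    have "norm (integral {a..u i} f - integral {a..l i} f) \<le> integral {l i..u i} (g n) + real n * (u i - l i)"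
      if "i \<in> I" for i
    proof -
      have i: "a \<le> l i" "l i \<le> u i" "u i \<le> b" using I(2) that by auto
      have sub: "w integrable_on {a..b} \<Longrightarrow> w integrable_on {l i..u i}" for w :: "real \<Rightarrow> 'c::euclidean_space"
        using i by (rule_tac integrable_subinterval_real) auto
      have gn: "(\<lambda>x. g n x + real n) integrable_on {l i..u i}"
        by (intro integrable_add sub g) auto
      have "norm (integral {a..u i} f - integral {a..l i} f) = norm (integral {l i..u i} f)"
        using integral_increment[OF fi] i by simp
      also have "\<dots> \<le> integral {l i..u i} (\<lambda>x. g n x + real n)"
        using sub[OF fi] gn by (intro integral_norm_bound_integral) (auto simp: g_def)
      also have "\<dots> = integral {l i..u i} (g n) + real n * (u i - l i)"
        using i sub[OF g] by (subst Henstock_Kurzweil_Integration.integral_add) auto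
      finally show ?thesis .
    qed
    then have "(\<Sum>i\<in>I. norm (integral {a..u i} f - integral {a..l i} f)) \<le>
       (\<Sum>i\<in>I. integral {l i..u i} (g n)) + real n * (\<Sum>i\<in>I. u i - l i)"
      by (simp add: sum_distrib_left flip: sum.distrib) (intro sum_mono, simp)
    also have "(\<Sum>i\<in>I. integral {l i..u i} (g n)) \<le> integral {a..b} (g n)"
      using I by (intro sum_integral_disjoint_le g) (auto simp: g_def)
    also have "real n * (\<Sum>i\<in>I. u i - l i) \<le> real (Suc n) * (\<Sum>i\<in>I. u i - l i)"
      using I by (intro mult_right_mono sum_nonneg) auto
    also have "\<dots> \<le> real (Suc n) * (e / (2 * real (Suc n)))"
      using I(4) by (intro mult_left_mono) auto
    also have "\<dots> = e / 2" by (simp del: of_nat_Suc)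
    finally show "(\<Sum>i\<in>I. norm (integral {a..u i} f - integral {a..l i} f)) < e"
      using n by simp
  qed
qed

text \<open>Tags are split by membership in \<open>N\<close>. Off \<open>N\<close> the derivative
  controls the error on each interval; the intervals tagged in \<open>N\<close> lie in an open set
  of small measure, where absolute continuity controls the sum of the increments of
  \<open>F\<close>.\<close>

theorem abs_continuous_on_has_integral_derivative:
  fixes F :: "real \<Rightarrow> 'b::euclidean_space"
  assumes ab: "a \<le> b" and F: "abs_continuous_on {a..b} F" and N: "negligible N"
    and D: "\<And>x. x \<in> {a..b} - N \<Longrightarrow> (F has_vector_derivative f x) (at x within {a..b})"
  shows "(f has_integral (F b - F a)) {a..b}"
proof -
  \<comment> \<open>With value 0 on \<open>N\<close>, a tag in \<open>N\<close> contributes nothing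
    but the increment of \<open>F\<close>.\<close>
  define f0 where "f0 = (\<lambda>x. if x \<in> N then 0 else f x)"
  have "(f0 has_integral (F b - F a)) {a..b}"
    unfolding has_integral_real
  proof (intro allI impI)
    fix e :: real assume e: "e > 0"
    \<comment> \<open>The summand 1 covers the degenerate interval \<open>a = b\<close>.\<close>
    define e' where "e' = e / (2 * (b - a + 1))"
    have e': "e' > 0" "e' * (b - a) < e / 2"
      using e ab by (auto simp: e'_def field_simps)
    obtain d where d: "d > 0" "\<forall>(I::(real \<times> real set) set) l u. finite I \<longrightarrow>
        (\<forall>i\<in>I. l i \<in> {a..b} \<and> u i \<in> {a..b} \<and> l i \<le> u i) \<longrightarrow>
        (\<forall>i\<in>I. \<forall>j\<in>I. i \<noteq> j \<longrightarrow> {l i<..<u i} \<inter> {l j<..<u j} = {}) \<longrightarrow>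
        (\<Sum>i\<in>I. u i - l i) < d \<longrightarrow> (\<Sum>i\<in>I. norm (F (u i) - F (l i))) < e / 2"
      by (rule abs_continuous_onE[OF F half_gt_zero[OF e]])
    obtain T where T: "open T" "N \<subseteq> T" "T - N \<in> lmeasurable" "emeasure lebesgue (T - N) < ennreal d"
      using sets_lebesgue_outer_open[of N d] N d(1) negligible_imp_sets by metis
    have Tm: "T \<in> lmeasurable" "measure lebesgue T < d"
    proof -
      have TN: "T = (T - N) \<union> N" using T(2) by auto
      have Nm: "N \<in> lmeasurable" using N by (rule negligible_imp_measurable)
      show "T \<in> lmeasurable" by (subst TN) (intro fmeasurable.Un T Nm)
      have "measure lebesgue T \<le> measure lebesgue (T - N) + measure lebesgue N"
        by (subst TN) (intro measure_Un_le fmeasurableD T Nm)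
      also have "\<dots> < d"
        using T(4) N fmeasurableD2[OF T(3)] d(1) by (simp add: negligible_imp_measure0 emeasure_eq_measure2[OF T(3)] ennreal_less_iff)
      finally show "measure lebesgue T < d" .
    qed
    have "\<exists>\<delta>>0. x \<in> {a..b} - N \<longrightarrow> (\<forall>y\<in>{a..b}. \<bar>y - x\<bar> < \<delta> \<longrightarrow> norm (F y - F x - (y - x) *\<^sub>R f x) \<le> e' * \<bar>y - x\<bar>)" for x
      using D[of x] e'(1) unfolding has_vector_derivative_def has_derivative_within_alt
      by (cases "x \<in> {a..b} - N") (auto intro: exI[of _ 1])
    then obtain \<delta> where \<delta>: "\<And>x. \<delta> x > 0" "\<And>x y. x \<in> {a..b} - N \<Longrightarrow> y \<in> {a..b} \<Longrightarrow> \<bar>y - x\<bar> < \<delta> x \<Longrightarrow>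
        norm (F y - F x - (y - x) *\<^sub>R f x) \<le> e' * \<bar>y - x\<bar>" by metis
    \<comment> \<open>This gauge forces intervals tagged in \<open>N\<close> into \<open>T\<close>,
      hence their total length below the \<open>d\<close> that absolute continuity assigns to
      \<open>e / 2\<close>.\<close>
    define \<gamma> where "\<gamma> = (\<lambda>x. if x \<in> N then T else ball x (\<delta> x))"
    show "\<exists>\<gamma>. gauge \<gamma> \<and> (\<forall>\<D>. \<D> tagged_division_of {a..b} \<and> \<gamma> fine \<D> \<longrightarrow>
           norm ((\<Sum>(x, k)\<in>\<D>. measure lborel k *\<^sub>R f0 x) - (F b - F a)) < e)"
    proof (intro exI conjI allI impI)
      show "gauge \<gamma>" using T \<delta> by (auto simp: gauge_def \<gamma>_def)
      fix p assume "p tagged_division_of {a..b} \<and> \<gamma> fine p"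
      then have p: "p tagged_division_of {a..b}" and fine: "\<gamma> fine p" by auto
      have fin: "finite p" using p by (rule tagged_division_of_finite)
      have pk: "\<exists>u v. k = {u..v} \<and> u \<le> x \<and> x \<le> v \<and> a \<le> u \<and> v \<le> b" if xk: "(x, k) \<in> p" for x k
      proof -
        obtain u v where k: "k = cbox u v" using tagged_division_ofD(4)[OF p xk] by blast
        moreover have "x \<in> k" "k \<subseteq> {a..b}" using tagged_division_ofD(2,3)[OF p xk] by auto
        ultimately show ?thesis by (intro exI[of _ u] exI[of _ v]) (auto)
      qed
      let ?G = "\<lambda>(x, k). F (Sup k) - F (Inf k)"
      let ?pN = "{i \<in> p. fst i \<in> N}" and ?pC = "{i \<in> p. fst i \<notin> N}"
      have pu: "p = ?pN \<union> ?pC" by auto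
      have Cb: "norm ((\<lambda>(x, k). measure lborel k *\<^sub>R f0 x) i - ?G i) \<le> e' * measure lborel (snd i)"
        if i: "i \<in> ?pC" for i
      proof -
        obtain x k where xk: "i = (x, k)" "(x, k) \<in> p" "x \<notin> N" using i by (cases i) auto
        obtain u v where k: "k = {u..v}" "u \<le> x" "x \<le> v" "a \<le> u" "v \<le> b" using pk[OF xk(2)] by blast
        have "k \<subseteq> ball x (\<delta> x)" using fineD[OF fine xk(2)] xk(3) by (simp add: \<gamma>_def)
        moreover have "u \<in> k" "v \<in> k" using k by auto
        ultimately have "u \<in> ball x (\<delta> x)" "v \<in> ball x (\<delta> x)" by (blast, blast)
        then have uv: "\<bar>u - x\<bar> < \<delta> x" "\<bar>v - x\<bar> < \<delta> x" by (auto simp: dist_real_def abs_minus_commute)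
        have x: "x \<in> {a..b} - N" using xk k by auto
        have "norm ((v - u) *\<^sub>R f x - (F v - F u)) =
           norm ((F u - F x - (u - x) *\<^sub>R f x) - (F v - F x - (v - x) *\<^sub>R f x))"
          by (simp add: algebra_simps)
        also have "\<dots> \<le> e' * \<bar>u - x\<bar> + e' * \<bar>v - x\<bar>"
          using uv k by (intro norm_triangle_le_diff add_mono \<delta>(2)[OF x]) auto
        also have "\<dots> = e' * (v - u)" using k by (simp add: algebra_simps)
        finally show ?thesis using xk k by (simp add: f0_def)
      qed
      have pk': "k = {Inf k..Sup k} \<and> a \<le> Inf k \<and> Inf k \<le> x \<and> x \<le> Sup k \<and> Sup k \<le> b" if xk: "(x, k) \<in> p" for x k
      proof -
        obtain u v where k: "k = {u..v}" "u \<le> x" "x \<le> v" "a \<le> u" "v \<le> b" using pk[OF xk] by blast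
        then have "Inf k = u" "Sup k = v" by auto
        with k show ?thesis by simp
      qed
      have disj: "{Inf k<..<Sup k} \<inter> {Inf k'<..<Sup k'} = {}"
        if xk: "(x, k) \<in> p" "(x', k') \<in> p" "(x, k) \<noteq> (x', k')" for x k x' k'
      proof -
        have "k = {Inf k..Sup k}" "Inf k \<le> Sup k" "k' = {Inf k'..Sup k'}" "Inf k' \<le> Sup k'"
          using pk'[OF xk(1)] pk'[OF xk(2)] by auto
        then show ?thesis using tagged_division_ofD(5)[OF p xk] by (metis interior_atLeastAtMost_real)
      qed
      have sumN: "(\<Sum>i\<in>?pN. norm (F (Sup (snd i)) - F (Inf (snd i)))) < e / 2"
      proof (rule d(2)[rule_format])
        show "finite ?pN" using fin by simp
        show "Inf (snd i) \<in> {a..b} \<and> Sup (snd i) \<in> {a..b} \<and> Inf (snd i) \<le> Sup (snd i)" if "i \<in> ?pN" for i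
          using pk'[of "fst i" "snd i"] that by auto
        show "{Inf (snd i)<..<Sup (snd i)} \<inter> {Inf (snd j)<..<Sup (snd j)} = {}"
          if "i \<in> ?pN" "j \<in> ?pN" "i \<noteq> j" for i j
          using disj[of "fst i" "snd i" "fst j" "snd j"] that by auto
        have "(\<Sum>i\<in>?pN. Sup (snd i) - Inf (snd i)) = (\<Sum>i\<in>?pN. measure lebesgue {Inf (snd i)<..<Sup (snd i)})"
        proof (intro sum.cong refl)
          fix i assume "i \<in> ?pN"
          then have "Inf (snd i) \<le> Sup (snd i)" using pk'[of "fst i" "snd i"] by auto
          then show "Sup (snd i) - Inf (snd i) = measure lebesgue {Inf (snd i)<..<Sup (snd i)}" by simp
        qed
        also have "\<dots> = measure lebesgue (\<Union>i\<in>?pN. {Inf (snd i)<..<Sup (snd i)})"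
        proof (rule measure_finite_Union[symmetric])
          show "disjoint_family_on (\<lambda>i. {Inf (snd i)<..<Sup (snd i)}) ?pN"
            unfolding disjoint_family_on_def
            using disj by (metis (no_types, lifting) mem_Collect_eq prod.collapse)
          show "emeasure lebesgue {Inf (snd i)<..<Sup (snd i)} \<noteq> \<infinity>" if "i \<in> ?pN" for i
            using fmeasurableD2[OF lmeasurable_box[of "Inf (snd i)" "Sup (snd i)"]] by simp
        qed (use fin in auto)
        also have "\<dots> \<le> measure lebesgue T"
        proof (rule measure_mono_fmeasurable)
          show "(\<Union>i\<in>?pN. {Inf (snd i)<..<Sup (snd i)}) \<subseteq> T"
          proof safe
            fix x k y assume xk: "(x, k) \<in> p" "fst (x, k) \<in> N" "y \<in> {Inf (snd (x, k))<..<Sup (snd (x, k))}"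
            then have "y \<in> k" using pk'[OF xk(1)] by (metis atLeastAtMost_iff greaterThanLessThan_iff less_imp_le snd_conv)
            moreover have "k \<subseteq> T" using fineD[OF fine xk(1)] xk(2) by (simp add: \<gamma>_def)
            ultimately show "y \<in> T" by blast
          qed
        qed (use fin Tm in auto)
        finally show "(\<Sum>i\<in>?pN. Sup (snd i) - Inf (snd i)) < d" using Tm by simp
      qed
      let ?h = "\<lambda>i. (\<lambda>(x, k). measure lborel k *\<^sub>R f0 x) i - ?G i"
      have sumC: "(\<Sum>i\<in>?pC. norm (?h i)) \<le> e' * (b - a)"
      proof -
        have "(\<Sum>i\<in>?pC. norm (?h i)) \<le> (\<Sum>i\<in>?pC. e' * measure lborel (snd i))"
          by (intro sum_mono Cb)
        also have "\<dots> \<le> (\<Sum>i\<in>p. e' * measure lborel (snd i))"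
          using e' fin by (intro sum_mono2) auto
        also have "\<dots> = e' * (b - a)"
          using additive_content_tagged_division[of p a b] p ab
          by (simp add: case_prod_beta flip: sum_distrib_left)
        finally show ?thesis .
      qed
      have e1: "(\<Sum>i\<in>?pN. norm (?h i)) = (\<Sum>i\<in>?pN. norm (F (Sup (snd i)) - F (Inf (snd i))))"
        by (intro sum.cong refl) (auto simp: f0_def case_prod_beta norm_minus_commute)
      have e2: "(\<Sum>i\<in>p. norm (?h i)) = (\<Sum>i\<in>?pN. norm (?h i)) + (\<Sum>i\<in>?pC. norm (?h i))"
        by (rule trans[OF arg_cong[where f="sum _", OF pu] sum.union_disjoint]) (use fin in auto)
      have "norm ((\<Sum>(x, k)\<in>p. measure lborel k *\<^sub>R f0 x) - (F b - F a)) = norm (\<Sum>i\<in>p. ?h i)"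
        by (simp only: sum_subtractf additive_tagged_division_1[OF ab p, of F, symmetric])
      also have "\<dots> \<le> (\<Sum>i\<in>p. norm (?h i))"
        by (rule norm_sum)
      also have "\<dots> < e" using e1 e2 sumN sumC e'(2) by linarith
      finally show "norm ((\<Sum>(x, k)\<in>p. measure lborel k *\<^sub>R f0 x) - (F b - F a)) < e" .
    qed
  qed
  then show ?thesis
    by (rule has_integral_spike[OF N, rotated]) (auto simp: f0_def)
qed

text \<open>The Lipschitz bound is required only between values taken by \<open>u\<close>, so that
  functions such as the exponential qualify when \<open>u\<close> is bounded.\<close>

lemma abs_continuous_on_lipschitz_compose:
  fixes u :: "real \<Rightarrow> 'b::real_normed_vector" and \<phi> :: "'b \<Rightarrow> 'c::real_normed_vector"
  assumes u: "abs_continuous_on S u" and L: "\<And>x y. x \<in> S \<Longrightarrow> y \<in> S \<Longrightarrow> norm (\<phi> (u x) - \<phi> (u y)) \<le> L * norm (u x - u y)"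
  shows "abs_continuous_on S (\<lambda>x. \<phi> (u x))"
  unfolding abs_continuous_on_def
proof (intro allI impI)
  fix e :: real assume e: "e > 0"
  define L' where "L' = \<bar>L\<bar> + 1"
  have L': "L' > 0" "L \<le> L'" by (auto simp: L'_def)
  obtain d where d: "d > 0" "\<forall>(I::nat set) a b. finite I \<longrightarrow> (\<forall>i\<in>I. a i \<in> S \<and> b i \<in> S \<and> a i \<le> b i) \<longrightarrow>
        (\<forall>i\<in>I. \<forall>j\<in>I. i \<noteq> j \<longrightarrow> {a i<..<b i} \<inter> {a j<..<b j} = {}) \<longrightarrow>
        (\<Sum>i\<in>I. b i - a i) < d \<longrightarrow> (\<Sum>i\<in>I. norm (u (b i) - u (a i))) < e / L'"
    by (rule abs_continuous_onE[OF u divide_pos_pos[OF e L'(1)]])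
  show "\<exists>d>0. \<forall>(I::nat set) a b. finite I \<longrightarrow> (\<forall>i\<in>I. a i \<in> S \<and> b i \<in> S \<and> a i \<le> b i) \<longrightarrow>
        (\<forall>i\<in>I. \<forall>j\<in>I. i \<noteq> j \<longrightarrow> {a i<..<b i} \<inter> {a j<..<b j} = {}) \<longrightarrow>
        (\<Sum>i\<in>I. b i - a i) < d \<longrightarrow> (\<Sum>i\<in>I. norm (\<phi> (u (b i)) - \<phi> (u (a i)))) < e"
  proof (intro exI[of _ d] conjI allI impI d(1))
    fix I :: "nat set" and a b
    assume I: "finite I" "\<forall>i\<in>I. a i \<in> S \<and> b i \<in> S \<and> a i \<le> b i"
        "\<forall>i\<in>I. \<forall>j\<in>I. i \<noteq> j \<longrightarrow> {a i<..<b i} \<inter> {a j<..<b j} = {}" "(\<Sum>i\<in>I. b i - a i) < d"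
    have "norm (\<phi> (u (b i)) - \<phi> (u (a i))) \<le> L' * norm (u (b i) - u (a i))" if "i \<in> I" for i
      using L[of "b i" "a i"] I(2) that mult_right_mono[OF L'(2), of "norm (u (b i) - u (a i))"] by force
    then have "(\<Sum>i\<in>I. norm (\<phi> (u (b i)) - \<phi> (u (a i)))) \<le> L' * (\<Sum>i\<in>I. norm (u (b i) - u (a i)))"
      unfolding sum_distrib_left by (rule sum_mono)
    also have "\<dots> < L' * (e / L')"
      using L'(1) I by (intro mult_strict_left_mono d(2)[rule_format]) auto
    finally show "(\<Sum>i\<in>I. norm (\<phi> (u (b i)) - \<phi> (u (a i)))) < e" using L'(1) by simp
  qed
qed

lemma abs_continuous_on_subset:
  assumes "abs_continuous_on S u" "S' \<subseteq> S"
  shows "abs_continuous_on S' u"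
proof -
  have "\<exists>d>0. \<forall>(I::nat set) a b. finite I \<longrightarrow> (\<forall>i\<in>I. a i \<in> S' \<and> b i \<in> S' \<and> a i \<le> b i) \<longrightarrow>
        (\<forall>i\<in>I. \<forall>j\<in>I. i \<noteq> j \<longrightarrow> {a i<..<b i} \<inter> {a j<..<b j} = {}) \<longrightarrow>
        (\<Sum>i\<in>I. b i - a i) < d \<longrightarrow> (\<Sum>i\<in>I. norm (u (b i) - u (a i))) < e" if e: "e > 0" for e
  proof -
    obtain d where "d > 0" and d: "\<forall>(I::nat set) a b. finite I \<longrightarrow> (\<forall>i\<in>I. a i \<in> S \<and> b i \<in> S \<and> a i \<le> b i) \<longrightarrow>
        (\<forall>i\<in>I. \<forall>j\<in>I. i \<noteq> j \<longrightarrow> {a i<..<b i} \<inter> {a j<..<b j} = {}) \<longrightarrow>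
        (\<Sum>i\<in>I. b i - a i) < d \<longrightarrow> (\<Sum>i\<in>I. norm (u (b i) - u (a i))) < e"
      by (rule abs_continuous_onE[OF assms(1) e])
    show ?thesis
      using assms(2) by (intro exI[of _ d] conjI allI impI \<open>d > 0\<close> d[rule_format]) auto
  qed
  then show ?thesis unfolding abs_continuous_on_def by blast
qed

lemma abs_continuous_on_imp_continuous_on:
  fixes u :: "real \<Rightarrow> 'b::real_normed_vector"
  assumes "abs_continuous_on {a..b} u"
  shows "continuous_on {a..b} u"
  unfolding continuous_on_iff
proof (intro ballI allI impI)
  fix x e :: real assume x: "x \<in> {a..b}" and e: "e > 0"
  obtain d where d: "d > 0" "\<forall>(I::nat set) l r. finite I \<longrightarrow> (\<forall>i\<in>I. l i \<in> {a..b} \<and> r i \<in> {a..b} \<and> l i \<le> r i) \<longrightarrow>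
        (\<forall>i\<in>I. \<forall>j\<in>I. i \<noteq> j \<longrightarrow> {l i<..<r i} \<inter> {l j<..<r j} = {}) \<longrightarrow>
        (\<Sum>i\<in>I. r i - l i) < d \<longrightarrow> (\<Sum>i\<in>I. norm (u (r i) - u (l i))) < e"
    by (rule abs_continuous_onE[OF assms e])
  show "\<exists>d>0. \<forall>y\<in>{a..b}. dist y x < d \<longrightarrow> dist (u y) (u x) < e"
  proof (intro exI[of _ d] conjI ballI impI d(1))
    fix y assume y: "y \<in> {a..b}" "dist y x < d"
    have "norm (u (max x y) - u (min x y)) < e"
      using d(2)[rule_format, of "{0}" "\<lambda>_. min x y" "\<lambda>_. max x y"] x y by (auto simp: dist_real_def min_def max_def)
    then show "dist (u y) (u x) < e" by (auto simp: dist_norm min_def max_def norm_minus_commute split: if_splits)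
  qed
qed

section \<open>Exponential weights and Gronwall's inequality\<close>

text \<open>The integrand is almost everywhere the derivative of \<open>exp (2 * K x) / 2\<close>,
  which is absolutely continuous because the exponential is Lipschitz on the bounded range of
  \<open>K\<close>. The division by 2 is what later provides absorption and contraction.\<close>

lemma has_integral_mult_exp_integral:
  fixes k :: "real \<Rightarrow> real"
  assumes k: "k absolutely_integrable_on {0..T}" and nn: "\<And>x. x \<in> {0..T} \<Longrightarrow> 0 \<le> k x"
    and st: "0 \<le> s" "s \<le> t" "t \<le> T"
  defines "K \<equiv> \<lambda>x. integral {0..x} k"
  shows "((\<lambda>x. k x * exp (2 * K x)) has_integral ((exp (2 * K t) - exp (2 * K s)) / 2)) {s..t}"
proof -
  have ki: "k integrable_on {0..T}" using k by (simp add: absolutely_integrable_on_def)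
  obtain N where N: "negligible N" "\<And>x. x \<in> {0..T} - N \<Longrightarrow> (K has_vector_derivative k x) (at x within {0..T})"
    using indefinite_integral_has_vector_derivative_ae[OF ki] unfolding K_def by blast
  have sub: "{s..t} \<subseteq> {0..T}" using st by auto
  have AC: "abs_continuous_on {s..t} K"
    unfolding K_def by (rule abs_continuous_on_subset[OF abs_continuous_on_indefinite_integral[OF k] sub])
  have "bounded (K ` {s..t})"
    by (intro compact_imp_bounded compact_continuous_image abs_continuous_on_imp_continuous_on[OF AC]) simp
  then obtain B where B: "\<And>x. x \<in> {s..t} \<Longrightarrow> \<bar>K x\<bar> \<le> B"
    unfolding bounded_iff by (metis imageI real_norm_def)
  have AC2: "abs_continuous_on {s..t} (\<lambda>x. exp (2 * K x) / 2)"
  proof (rule abs_continuous_on_lipschitz_compose[OF AC, where L = "exp (2 * B)" and \<phi> = "\<lambda>z. exp (2 * z) / 2"])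
    have *: "exp (2 * z) / 2 - exp (2 * w) / 2 \<le> exp (2 * B) * \<bar>z - w\<bar>" if "z \<le> B" "w \<le> z" for z w :: real
    proof -
      have "exp (2 * z) * (1 + (2 * w - 2 * z)) \<le> exp (2 * z) * exp (2 * w - 2 * z)"
        by (intro mult_left_mono exp_ge_add_one_self) auto
      also have "\<dots> = exp (2 * w)" by (simp flip: exp_add)
      finally have "exp (2 * z) / 2 - exp (2 * w) / 2 \<le> exp (2 * z) * (z - w)" by (simp add: algebra_simps)
      also have "\<dots> \<le> exp (2 * B) * (z - w)" using that by (intro mult_right_mono) auto
      finally show ?thesis using that by simp
    qed
    fix x y assume "x \<in> {s..t}" "y \<in> {s..t}"
    then have "K x \<le> B" "K y \<le> B" using B[of x] B[of y] by auto
    then show "norm (exp (2 * K x) / 2 - exp (2 * K y) / 2) \<le> exp (2 * B) * norm (K x - K y)"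
      using *[of "K x" "K y"] *[of "K y" "K x"] by (cases "K y \<le> K x") (auto simp: abs_if)
  qed
  have "((\<lambda>x. k x * exp (2 * K x)) has_integral (exp (2 * K t) / 2 - exp (2 * K s) / 2)) {s..t}"
  proof (rule abs_continuous_on_has_integral_derivative[OF st(2) AC2 N(1)])
    fix x assume x: "x \<in> {s..t} - N"
    have "(K has_vector_derivative k x) (at x within {s..t})"
      using N(2)[of x] x sub by (meson Diff_iff has_vector_derivative_within_subset subsetD)
    then have "(K has_real_derivative k x) (at x within {s..t})"
      by (simp add: has_real_derivative_iff_has_vector_derivative)
    then have "((\<lambda>x. exp (2 * K x) / 2) has_real_derivative k x * exp (2 * K x)) (at x within {s..t})"
      by (auto intro!: derivative_eq_intros)
    then show "((\<lambda>x. exp (2 * K x) / 2) has_vector_derivative k x * exp (2 * K x)) (at x within {s..t})"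
      by (simp add: has_real_derivative_iff_has_vector_derivative)
  qed
  then show ?thesis by (simp add: diff_divide_distrib)
qed

lemma absolutely_integrable_mult_continuous:
  fixes k u :: "real \<Rightarrow> real"
  assumes k: "k absolutely_integrable_on {a..b}" and u: "continuous_on {a..b} u"
  shows "(\<lambda>x. k x * u x) absolutely_integrable_on {a..b}"
proof -
  have "(\<lambda>x. u x * k x) absolutely_integrable_on {a..b}"
  proof (rule absolutely_integrable_bounded_measurable_product_real[OF _ _ _ k])
    show "u \<in> borel_measurable (lebesgue_on {a..b})"
      using u by (rule continuous_imp_measurable_on_sets_lebesgue) auto
    show "bounded (u ` {a..b})"
      by (intro compact_imp_bounded compact_continuous_image u) simp
  qed auto
  then show ?thesis by (simp add: mult.commute)
qed

text \<open>Let \<open>Q\<close> be the maximum of \<open>u\<close> times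
  \<open>exp (- (2 * K))\<close>, attained at \<open>m\<close>. Inserting
  \<open>u \<le> Q * exp (2 * K)\<close> under the integral at time \<open>m\<close> gives at most
  half of \<open>Q * exp (2 * K m)\<close>, which the left side absorbs; this yields
  \<open>Q \<le> 2 * A\<close> for positive \<open>Q\<close>.\<close>

lemma integral_gronwall:
  fixes k u :: "real \<Rightarrow> real"
  assumes k: "k absolutely_integrable_on {0..T}" and nn: "\<And>x. x \<in> {0..T} \<Longrightarrow> 0 \<le> k x"
    and s: "0 \<le> s" "s \<le> T" and "A \<ge> 0" and u: "continuous_on {s..T} u"
    and le: "\<And>t. t \<in> {s..T} \<Longrightarrow> u t \<le> A + integral {s..t} (\<lambda>x. k x * u x)"
    and t: "t \<in> {s..T}"
  shows "u t \<le> 2 * A * exp (2 * integral {0..t} k)"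
proof -
  define K where "K = (\<lambda>x. integral {0..x} k)"
  have ki: "k integrable_on {0..T}" using k by (simp add: absolutely_integrable_on_def)
  have sub: "{s..x} \<subseteq> {0..T}" if "x \<le> T" for x using s that by auto
  have Kc: "continuous_on {s..T} K"
    unfolding K_def by (rule continuous_on_subset[OF indefinite_integral_continuous_1[OF ki]]) (use s in auto)
  have K0: "K x \<ge> 0" if "x \<in> {s..T}" for x
    unfolding K_def using that s ki by (intro integral_nonneg nn integrable_subinterval_real[OF ki]) auto
  obtain m where m: "m \<in> {s..T}" "\<And>x. x \<in> {s..T} \<Longrightarrow> u x * exp (- (2 * K x)) \<le> u m * exp (- (2 * K m))"
    using continuous_attains_sup[of "{s..T}" "\<lambda>x. u x * exp (- (2 * K x))"] s
    by (force intro!: continuous_intros u Kc)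
  define Q where "Q = u m * exp (- (2 * K m))"
  have uQ: "u x \<le> Q * exp (2 * K x)" if "x \<in> {s..T}" for x
  proof -
    have "u x = (u x * exp (- (2 * K x))) * exp (2 * K x)" by (simp add: exp_minus)
    also have "\<dots> \<le> Q * exp (2 * K x)" unfolding Q_def by (intro mult_right_mono m that) auto
    finally show ?thesis .
  qed
  have um: "u m = Q * exp (2 * K m)" by (simp add: Q_def exp_minus)
  have "Q \<le> 2 * A"
  proof (cases "Q \<le> 0")
    case True then show ?thesis using \<open>A \<ge> 0\<close> by simp
  next
    case False
    have I: "((\<lambda>x. Q * (k x * exp (2 * K x))) has_integral Q * ((exp (2 * K m) - exp (2 * K s)) / 2)) {s..m}"
      unfolding K_def using m(1) s by (intro has_integral_mult_right has_integral_mult_exp_integral[OF k nn]) auto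
    have ku: "(\<lambda>x. k x * u x) integrable_on {s..m}"
    proof -
      have "k absolutely_integrable_on {s..T}"
        using absolutely_integrable_on_subinterval[OF k] sub[of T] by auto
      then have "(\<lambda>x. k x * u x) integrable_on {s..T}"
        using absolutely_integrable_mult_continuous[OF _ u] by (simp add: absolutely_integrable_on_def)
      then show ?thesis using m(1) by (rule_tac integrable_subinterval_real) auto
    qed
    have "integral {s..m} (\<lambda>x. k x * u x) \<le> Q * ((exp (2 * K m) - exp (2 * K s)) / 2)"
    proof (rule has_integral_le[OF integrable_integral[OF ku] I])
      fix x assume x: "x \<in> {s..m}"
      then have "k x * u x \<le> k x * (Q * exp (2 * K x))"
        using m(1) s by (intro mult_left_mono uQ nn) auto
      then show "k x * u x \<le> Q * (k x * exp (2 * K x))" by (simp add: mult_ac)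
    qed
    then have "Q * exp (2 * K m) \<le> A + Q * ((exp (2 * K m) - exp (2 * K s)) / 2)"
      using le[OF m(1)] um by linarith
    also have "\<dots> \<le> A + Q * (exp (2 * K m) / 2)"
      using False by (intro add_left_mono mult_left_mono) auto
    finally have "Q * exp (2 * K m) \<le> 2 * A" by simp
    moreover have "Q * 1 \<le> Q * exp (2 * K m)" using False K0[OF m(1)] by (intro mult_left_mono) auto
    ultimately show ?thesis by simp
  qed
  then have "Q * exp (2 * K t) \<le> 2 * A * exp (2 * K t)" by (intro mult_right_mono) auto
  from order_trans[OF uQ[OF t] this] show ?thesis by (simp only: K_def)
qed

section \<open>Steiner points\<close>

lemma support_fun_attained:
  fixes K :: "'a::euclidean_space set"
  assumes "compact K" "K \<noteq> {}"
  obtains y where "y \<in> K" "support_fun K p = p \<bullet> y" "\<And>z. z \<in> K \<Longrightarrow> p \<bullet> z \<le> p \<bullet> y"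
proof -
  obtain y where y: "y \<in> K" "\<And>z. z \<in> K \<Longrightarrow> p \<bullet> z \<le> p \<bullet> y"
  proof -
    have "continuous_on K (\<lambda>y. p \<bullet> y)" by (intro continuous_intros)
    from continuous_attains_sup[OF assms this] that show ?thesis by blast
  qed
  then have "support_fun K p = p \<bullet> y"
    unfolding support_fun_def by (intro cSup_eq_maximum) auto
  with y show thesis by (intro that)
qed

lemma support_fun_upper:
  fixes K :: "'a::euclidean_space set"
  assumes "compact K" "z \<in> K"
  shows "p \<bullet> z \<le> support_fun K p"
  using support_fun_attained[of K p] assms by (metis empty_iff)

lemma support_fun_le:
  fixes K :: "'a::euclidean_space set"
  assumes "compact K" "K \<noteq> {}" "\<And>z. z \<in> K \<Longrightarrow> p \<bullet> z \<le> b"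
  shows "support_fun K p \<le> b"
  using support_fun_attained[OF assms(1,2), of p] assms(3) by metis

text \<open>Subadditivity in incremental form: a maximizer for \<open>p\<close> is tested in the
  directions \<open>q\<close> and \<open>p - q\<close>. Both the Lipschitz continuity and the
  discrete integration by parts use increments.\<close>

lemma support_fun_diff_le:
  fixes K :: "'a::euclidean_space set"
  assumes K: "compact K" "K \<noteq> {}"
  shows "support_fun K p - support_fun K q \<le> support_fun K (p - q)"
proof -
  obtain y where "y \<in> K" "support_fun K p = p \<bullet> y"
    using support_fun_attained[OF K] by blast
  then show ?thesis
    using support_fun_upper[OF K(1), of y q] support_fun_upper[OF K(1), of y "p - q"]
    by (simp add: inner_diff_left)
qed

lemma support_fun_scaleR:
  fixes K :: "'a::euclidean_space set"
  assumes K: "compact K" "K \<noteq> {}" and c: "c \<ge> 0"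
  shows "support_fun K (c *\<^sub>R p) = c * support_fun K p"
proof (rule antisym)
  obtain y where y: "y \<in> K" "support_fun K p = p \<bullet> y" "\<And>z. z \<in> K \<Longrightarrow> p \<bullet> z \<le> p \<bullet> y"
    using support_fun_attained[OF K, of p] by blast
  show "support_fun K (c *\<^sub>R p) \<le> c * support_fun K p"
    using y c by (intro support_fun_le K) (auto intro: mult_left_mono)
  show "c * support_fun K p \<le> support_fun K (c *\<^sub>R p)"
    using support_fun_upper[OF K(1) y(1), of "c *\<^sub>R p"] y(2) by simp
qed

lemma support_fun_bound:
  fixes K :: "'a::euclidean_space set"
  assumes K: "compact K" "K \<noteq> {}"
  obtains B where "B > 0" "\<And>p. \<bar>support_fun K p\<bar> \<le> B * norm p"
proof -
  obtain B where B: "B > 0" "\<And>z. z \<in> K \<Longrightarrow> norm z \<le> B"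
    using compact_imp_bounded[OF K(1)] by (auto simp: bounded_pos)
  have "\<bar>support_fun K p\<bar> \<le> B * norm p" for p
  proof -
    obtain y where "y \<in> K" "support_fun K p = p \<bullet> y"
      using support_fun_attained[OF K] by blast
    then show ?thesis
      using Cauchy_Schwarz_ineq2[of p y] mult_left_mono[OF B(2), of y "norm p"] by (simp add: mult.commute)
  qed
  with B show thesis by (intro that)
qed

lemma continuous_support_fun:
  fixes K :: "'a::euclidean_space set"
  assumes K: "compact K" "K \<noteq> {}"
  shows "continuous_on UNIV (support_fun K)"
proof -
  obtain B where B: "B > 0" "\<And>p. \<bar>support_fun K p\<bar> \<le> B * norm p"
    using support_fun_bound[OF K] by blast
  have "\<bar>support_fun K p - support_fun K q\<bar> \<le> B * norm (p - q)" for p q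
    using support_fun_diff_le[OF K, of p q] support_fun_diff_le[OF K, of q p] B(2)[of "p - q"] B(2)[of "q - p"]
    by (simp add: norm_minus_commute)
  then have "B-lipschitz_on UNIV (support_fun K)"
    using B(1) by (intro lipschitz_onI) (auto simp: dist_real_def dist_norm)
  then show ?thesis by (rule lipschitz_on_continuous_on)
qed

lemma borel_measurable_support_fun:
  fixes K :: "'a::euclidean_space set"
  assumes "compact K" "K \<noteq> {}"
  shows "support_fun K \<in> borel_measurable borel"
  by (rule borel_measurable_continuous_onI[OF continuous_support_fun[OF assms]])

section \<open>Integrals over the unit ball\<close>

lemma integrable_lborel_bounded_support:
  fixes f :: "'a::euclidean_space \<Rightarrow> real"
  assumes "f \<in> borel_measurable borel" "\<And>x. \<bar>f x\<bar> \<le> C" "\<And>x. norm x > R \<Longrightarrow> f x = 0"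
  shows "integrable lborel f"
  by (rule integrableI_bounded_set[where A = "cball 0 R" and B = C])
     (use assms emeasure_bounded_finite[of "cball 0 R :: 'a set"] in auto)

lemma lborel_integral_scaleR:
  fixes f :: "'a::euclidean_space \<Rightarrow> real"
  assumes c: "c > 0" and f: "f \<in> borel_measurable borel"
  shows "(\<integral>x. f x \<partial>lborel) = c ^ DIM('a) * (\<integral>x. f (c *\<^sub>R x) \<partial>lborel)"
proof -
  have "(\<integral>x. f x \<partial>lborel) = (\<integral>x. f x \<partial>density (distr lborel borel (\<lambda>x. 0 + c *\<^sub>R x)) (\<lambda>_. ennreal (\<bar>c\<bar> ^ DIM('a))))"
    using lborel_affine[of c "0::'a"] c by (simp add: ennreal_power)
  also have "\<dots> = (\<integral>x. \<bar>c\<bar> ^ DIM('a) *\<^sub>R f x \<partial>distr lborel borel (\<lambda>x. 0 + c *\<^sub>R x))"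
    using f by (intro integral_density) auto
  also have "\<dots> = (\<integral>x. \<bar>c\<bar> ^ DIM('a) *\<^sub>R f (0 + c *\<^sub>R x) \<partial>lborel)"
    using f by (intro integral_distr) auto
  finally show ?thesis using c by simp
qed

lemma lborel_integral_translate:
  fixes f :: "'a::euclidean_space \<Rightarrow> real"
  assumes f: "f \<in> borel_measurable borel"
  shows "(\<integral>x. f (c + x) \<partial>lborel) = (\<integral>x. f x \<partial>lborel)"
  using integral_distr[of "(+) c" lborel borel f] f by (simp add: lborel_distr_plus)

text \<open>Fubini for \<open>1 - (norm x)\<^sup>2 = \<integral> 2 r dr\<close> over \<open>norm x < r < 1\<close>: homogeneity turns the inner
  integral over \<open>ball 0 r\<close> into a multiple of the one over the unit ball.\<close>

lemma integral_ball_norm_sq_homogeneous: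
  fixes G :: "'a::euclidean_space \<Rightarrow> real"
  assumes [measurable]: "G \<in> borel_measurable borel" and bd: "\<And>x. \<bar>G x\<bar> \<le> C"
    and hom: "\<And>c x. c > 0 \<Longrightarrow> G (c *\<^sub>R x) = G x"
  shows "(\<integral>x. indicator (ball 0 1) x * ((norm x)\<^sup>2 * G x) \<partial>lborel) =
    DIM('a) / (DIM('a) + 2) * (\<integral>x. indicator (ball 0 1) x * G x \<partial>lborel)"
proof -
  let ?m = "DIM('a)"
  define I where "I = (\<integral>x. indicator (ball 0 1) x * G x \<partial>lborel)"
  \<comment> \<open>For fixed \<open>x\<close> the integral over \<open>r\<close> runs from
    \<open>norm x\<close> to 1 and produces the factor \<open>1 - (norm x)\<^sup>2\<close>.\<close>
  define F where "F = (\<lambda>(x::'a) (r::real). if norm x < r \<and> r < 1 then 2 * r * G x else 0)"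
  have C: "C \<ge> 0" using bd[of 0] by linarith
  have Fm [measurable]: "case_prod F \<in> borel_measurable (borel \<Otimes>\<^sub>M borel)"
    unfolding F_def case_prod_beta by measurable
  have Fint: "integrable (lborel \<Otimes>\<^sub>M lborel) (\<lambda>(x, r). F x r)"
  proof (rule integrableI_bounded_set[where A = "cball 0 1 \<times> {0..1}" and B = "2 * C"])
    show "cball 0 1 \<times> {0..1} \<in> sets (lborel \<Otimes>\<^sub>M (lborel::real measure))" by measurable
    show "(\<lambda>(x, r). F x r) \<in> borel_measurable (lborel \<Otimes>\<^sub>M lborel)" by measurable
    have "bounded ((cball 0 1 :: 'a set) \<times> {0..1::real})" by (intro bounded_Times) auto
    then show "emeasure (lborel \<Otimes>\<^sub>M lborel) ((cball 0 1 :: 'a set) \<times> {0..1::real}) < \<infinity>"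
      unfolding lborel_prod by (rule emeasure_bounded_finite)
    have "norm (F x r) \<le> 2 * C" for x r
    proof (cases "norm x < r \<and> r < 1")
      case True
      then have "0 < r" by (meson le_less_trans norm_ge_zero)
      then have "\<bar>r\<bar> * \<bar>G x\<bar> \<le> 1 * C" using True bd[of x] by (intro mult_mono) auto
      then show ?thesis using True by (simp add: F_def abs_mult)
    next
      case False then show ?thesis using C unfolding F_def by (subst if_not_P) auto
    qed
    then show "AE x in lborel \<Otimes>\<^sub>M lborel. x \<in> cball 0 1 \<times> {0..1} \<longrightarrow> norm (case x of (x, r) \<Rightarrow> F x r) \<le> 2 * C"
      by auto
    have "F x r = 0" if "(x, r) \<notin> cball 0 1 \<times> {0..1}" for x r
      using that norm_ge_zero[of x] unfolding F_def by (intro if_not_P) (auto simp del: norm_ge_zero)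
    then show "AE x in lborel \<Otimes>\<^sub>M lborel. x \<notin> cball 0 1 \<times> {0..1} \<longrightarrow> (case x of (x, r) \<Rightarrow> F x r) = 0"
      by (intro AE_I2 impI) (metis case_prod_conv surj_pair)
  qed
  have inner_r: "(\<integral>r. F x r \<partial>lborel) = indicator (ball 0 1) x * ((1 - (norm x)\<^sup>2) * G x)" for x
  proof (cases "norm x < 1")
    case True
    have "(\<integral>r. F x r \<partial>lborel) = (\<integral>r. indicator {norm x..1} r *\<^sub>R (2 * r * G x) \<partial>lborel)"
    proof (rule integral_cong_AE)
      have "AE r in lborel. r \<noteq> norm x" "AE r in lborel. r \<noteq> (1::real)" by (rule AE_lborel_singleton)+
      then show "AE r in lborel. F x r = indicator {norm x..1} r *\<^sub>R (2 * r * G x)"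
        by eventually_elim (auto simp: F_def indicator_def)
    qed (auto simp: F_def)
    also have "\<dots> = (\<lambda>r. r\<^sup>2 * G x) 1 - (\<lambda>r. r\<^sup>2 * G x) (norm x)"
      using True by (intro integral_FTC_atLeastAtMost)
        (auto intro!: derivative_eq_intros continuous_intros simp flip: has_real_derivative_iff_has_vector_derivative)
    finally show ?thesis using True by (simp add: algebra_simps)
  next
    case False
    then have "F x = (\<lambda>r. 0)" by (auto simp: F_def)
    then show ?thesis using False by simp
  qed
  \<comment> \<open>Substituting \<open>r *\<^sub>R x\<close> contributes the power
    \<open>r ^ ?m\<close> and leaves \<open>G\<close> unchanged; with the factor
    \<open>2 * r\<close> the exponent is \<open>?m + 1\<close>, whose integral 2/(m+2) determines
    the final constant m/(m+2). The value \<open>r = 1\<close> is excluded since \<open>F\<close>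
    vanishes there while the right side need not.\<close>
  have inner_x: "(\<integral>x. F x r \<partial>lborel) = indicator {0..1} r *\<^sub>R (2 * r ^ (?m + 1) * I)" if "r \<noteq> 1" for r
  proof (cases "0 < r \<and> r < 1")
    case True
    have "(\<integral>x. F x r \<partial>lborel) = r ^ ?m * (\<integral>x. F (r *\<^sub>R x) r \<partial>lborel)"
      using True by (intro lborel_integral_scaleR) (auto simp: F_def)
    also have "(\<lambda>x. F (r *\<^sub>R x) r) = (\<lambda>x. (2 * r) * (indicator (ball 0 1) x * G x))"
      using True by (auto simp: F_def hom indicator_def fun_eq_iff)
    also have "(\<integral>x. (2 * r) * (indicator (ball 0 1) x * G x) \<partial>lborel) = 2 * r * I"
      unfolding I_def by (rule integral_mult_right_zero)
    finally show ?thesis using True by simp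
  next
    case False
    have "F x r = 0" for x
      using False norm_ge_zero[of x] unfolding F_def by (intro if_not_P) (auto simp del: norm_ge_zero)
    then show ?thesis using False that by (cases "r = 0") (auto simp: indicator_def)
  qed
  have "(\<integral>x. (\<integral>r. F x r \<partial>lborel) \<partial>lborel) = (\<integral>r. (\<integral>x. F x r \<partial>lborel) \<partial>lborel)"
    using lborel_pair.Fubini_integral[OF Fint] by simp
  also have "\<dots> = (\<integral>r. indicator {0..1} r *\<^sub>R (2 * r ^ (?m + 1) * I) \<partial>lborel)"
  proof (rule integral_cong_AE)
    show "AE r in lborel. (\<integral>x. F x r \<partial>lborel) = indicator {0..1} r *\<^sub>R (2 * r ^ (?m + 1) * I)"
      using AE_lborel_singleton[of "1::real"] by eventually_elim (rule inner_x)
  qed (auto simp: F_def)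
  also have "\<dots> = (\<lambda>r. (2 * I / (?m + 2)) * r ^ (?m + 2)) 1 - (\<lambda>r. (2 * I / (?m + 2)) * r ^ (?m + 2)) 0"
  proof (rule integral_FTC_atLeastAtMost)
    fix r :: real
    have "((\<lambda>r. (2 * I / (?m + 2)) * r ^ (?m + 2)) has_real_derivative
        (2 * I / (?m + 2)) * (real (?m + 2) * r ^ (?m + 2 - Suc 0))) (at r within {0..1})"
      by (intro DERIV_cmult DERIV_pow)
    moreover have "(2 * I / (?m + 2)) * (real (?m + 2) * r ^ (?m + 2 - Suc 0)) = 2 * r ^ (?m + 1) * I"
      by (simp add: field_simps)
    ultimately show "((\<lambda>r. (2 * I / (?m + 2)) * r ^ (?m + 2)) has_vector_derivative 2 * r ^ (?m + 1) * I) (at r within {0..1})"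
      unfolding has_real_derivative_iff_has_vector_derivative by (simp only:)
  qed (auto intro!: continuous_intros)
  finally have 1: "(\<integral>x. indicator (ball 0 1) x * ((1 - (norm x)\<^sup>2) * G x) \<partial>lborel) = 2 * I / (?m + 2)"
    by (simp add: inner_r)
  have i1: "integrable lborel (\<lambda>x. indicator (ball 0 1) x * G x)"
    using C bd by (intro integrable_lborel_bounded_support[where C = C and R = 1]) (auto simp: indicator_def)
  have i2: "integrable lborel (\<lambda>x. indicator (ball 0 1) x * ((norm x)\<^sup>2 * G x))"
  proof (rule integrable_lborel_bounded_support[where C = C and R = 1])
    fix x show "\<bar>indicator (ball 0 1) x * ((norm x)\<^sup>2 * G x)\<bar> \<le> C"
      using C bd[of x] mult_mono[of "(norm x)\<^sup>2" 1 "\<bar>G x\<bar>" C] by (auto simp: indicator_def abs_mult power_le_one)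
    have [measurable]: "ball (0::'a) 1 \<in> sets borel" by simp
    show "(\<lambda>x. indicator (ball 0 1) x * ((norm x)\<^sup>2 * G x)) \<in> borel_measurable borel" by measurable
  qed auto
  have "(\<integral>x. indicator (ball 0 1) x * ((1 - (norm x)\<^sup>2) * G x) \<partial>lborel) =
     I - (\<integral>x. indicator (ball 0 1) x * ((norm x)\<^sup>2 * G x) \<partial>lborel)"
    unfolding I_def by (subst Bochner_Integration.integral_diff[OF i1 i2, symmetric]) (simp add: algebra_simps)
  with 1 have "(\<integral>x. indicator (ball 0 1) x * ((norm x)\<^sup>2 * G x) \<partial>lborel) = I - 2 * I / (?m + 2)" by linarith
  also have "\<dots> = ?m / (?m + 2) * I" by (simp add: field_simps)
  finally show ?thesis unfolding I_def .
qed

text \<open>A discrete integration by parts against a radial tent function: translating the tent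
  instead of \<open>h\<close> replaces the gradient of \<open>h\<close> by sublinear increments.\<close>

lemma integral_ball_support_fun_le:
  fixes K :: "'a::euclidean_space set"
  assumes K: "compact K" "K \<noteq> {}" and u: "norm u = 1"
  shows "(\<integral>x. indicator (ball 0 1) x * (support_fun K x * (x \<bullet> u)) \<partial>lborel) \<le>
    support_fun K u * (\<integral>x. indicator (ball (0::'a) 1) x * ((1 - (norm x)\<^sup>2) / 2) \<partial>lborel)"
proof -
  define h where "h = support_fun K"
  \<comment> \<open>Inside the ball the gradient of this function is \<open>- x\<close>, and it
    vanishes on the sphere and beyond. Hence \<open>x \<bullet> u\<close> is a limit of its
    difference quotients, and there is no boundary term.\<close>
  define \<phi> where "\<phi> = (\<lambda>x::'a. max 0 ((1 - (norm x)\<^sup>2) / 2))"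
  define \<epsilon> where "\<epsilon> = (\<lambda>n. 1 / real (Suc n))"
  have [measurable]: "h \<in> borel_measurable borel"
    unfolding h_def by (rule borel_measurable_support_fun[OF K])
  have [measurable]: "\<phi> \<in> borel_measurable borel" unfolding \<phi>_def by measurable
  have \<epsilon>: "0 < \<epsilon> n" "\<epsilon> n \<le> 1" for n by (auto simp: \<epsilon>_def)
  have \<phi>01: "0 \<le> \<phi> x" "\<phi> x \<le> 1" for x
  proof -
    have "0 \<le> (norm x)\<^sup>2" by simp
    then have "- 1 \<le> (norm x)\<^sup>2" by linarith
    then show "0 \<le> \<phi> x" "\<phi> x \<le> 1" by (auto simp: \<phi>_def)
  qed
  have \<phi>0: "\<phi> x = 0" if "norm x \<ge> 1" for x
    unfolding \<phi>_def by (rule max_absorb1) (use that in simp)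
  have \<phi>1: "\<phi> x = (1 - (norm x)\<^sup>2) / 2" if "norm x < 1" for x
    unfolding \<phi>_def by (rule max_absorb2) (use that power_le_one[of "norm x" 2] in simp)
  have \<phi>eq: "\<phi> x = indicator (ball 0 1) x * ((1 - (norm x)\<^sup>2) / 2)" for x
    using \<phi>0[of x] \<phi>1[of x] by (auto simp: indicator_def)
  obtain B where B: "B > 0" "\<And>p. \<bar>h p\<bar> \<le> B * norm p"
    unfolding h_def using support_fun_bound[OF K] by blast
  have int\<phi>: "integrable lborel \<phi>"
    using \<phi>0 \<phi>01 by (intro integrable_lborel_bounded_support[where C = 1 and R = 1]) auto
  have inth: "integrable lborel (\<lambda>x. \<phi> (x + c) * h (x + d))" if cd: "norm c \<le> 1" "norm d \<le> 1" for c d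
  proof (rule integrable_lborel_bounded_support[where C = "3 * B" and R = 2])
    have far: "\<phi> (x + c) = 0" if "norm x \<ge> 2" for x
      using that cd norm_diff_ineq[of x c] by (intro \<phi>0) auto
    then show "\<phi> (x + c) * h (x + d) = 0" if "norm x > 2" for x using that by simp
    fix x
    show "\<bar>\<phi> (x + c) * h (x + d)\<bar> \<le> 3 * B"
    proof (cases "norm x \<ge> 2")
      case True then show ?thesis using far[of x] B(1) by simp
    next
      case False
      have "\<bar>h (x + d)\<bar> \<le> B * 3"
        using False cd norm_triangle_ineq[of x d] B(1) by (intro order_trans[OF B(2)] mult_left_mono) auto
      then have "\<bar>\<phi> (x + c)\<bar> * \<bar>h (x + d)\<bar> \<le> 1 * (B * 3)"
        using \<phi>01[of "x + c"] by (intro mult_mono) auto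
      then show ?thesis by (simp add: abs_mult)
    qed
  qed (unfold \<phi>_def, measurable)
  \<comment> \<open>Translation moves the difference quotient onto \<open>h\<close>, where
    subadditivity and homogeneity bound the increment along \<open>\<epsilon> n *\<^sub>R u\<close>
    by \<open>\<epsilon> n * h u\<close>, uniformly in \<open>x\<close>.\<close>
  have le: "(\<integral>x. ((\<phi> x - \<phi> (x + \<epsilon> n *\<^sub>R u)) / \<epsilon> n) * h x \<partial>lborel) \<le> h u * (\<integral>x. \<phi> x \<partial>lborel)" for n
  proof -
    let ?c = "\<epsilon> n *\<^sub>R u"
    have c: "norm ?c \<le> 1" using \<epsilon>[of n] u by simp
    have "(\<integral>x. \<phi> (x + ?c) * h x \<partial>lborel) = (\<integral>x. \<phi> x * h (x - ?c) \<partial>lborel)"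
      using lborel_integral_translate[of "\<lambda>x. \<phi> x * h (x - ?c)" ?c] by (simp add: add.commute)
    moreover have "(\<integral>x. \<phi> x * h x \<partial>lborel) - (\<integral>x. \<phi> x * h (x - ?c) \<partial>lborel) =
        (\<integral>x. \<phi> x * (h x - h (x - ?c)) \<partial>lborel)"
      using inth[of 0 0] inth[of 0 "- ?c"] c
      by (subst Bochner_Integration.integral_diff[symmetric]) (auto simp: right_diff_distrib)
    moreover have "(\<integral>x. \<phi> x * (h x - h (x - ?c)) \<partial>lborel) \<le> (\<integral>x. \<epsilon> n * h u * \<phi> x \<partial>lborel)"
    proof (rule integral_mono)
      show "integrable lborel (\<lambda>x. \<phi> x * (h x - h (x - ?c)))"
        using inth[of 0 0] inth[of 0 "- ?c"] c by (simp add: right_diff_distrib)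
      fix x
      have "h x - h (x - ?c) \<le> h ?c"
        using support_fun_diff_le[OF K, of x "x - ?c"] by (simp add: h_def)
      also have "h ?c = \<epsilon> n * h u"
        unfolding h_def using \<epsilon>[of n] by (intro support_fun_scaleR K) auto
      finally have "(h x - h (x - ?c)) * \<phi> x \<le> \<epsilon> n * h u * \<phi> x"
        by (rule mult_right_mono[OF _ \<phi>01(1)])
      then show "\<phi> x * (h x - h (x - ?c)) \<le> \<epsilon> n * h u * \<phi> x"
        by (simp only: mult.commute[of "\<phi> x"])
    qed (use int\<phi> in auto)
    ultimately have "(\<integral>x. \<phi> x * h x \<partial>lborel) - (\<integral>x. \<phi> (x + ?c) * h x \<partial>lborel) \<le> \<epsilon> n * (h u * (\<integral>x. \<phi> x \<partial>lborel))"
      by (simp add: mult_ac)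
    moreover have "(\<integral>x. ((\<phi> x - \<phi> (x + ?c)) / \<epsilon> n) * h x \<partial>lborel) =
        ((\<integral>x. \<phi> x * h x \<partial>lborel) - (\<integral>x. \<phi> (x + ?c) * h x \<partial>lborel)) / \<epsilon> n"
    proof -
      have "(\<integral>x. \<phi> x * h x \<partial>lborel) - (\<integral>x. \<phi> (x + ?c) * h x \<partial>lborel) = (\<integral>x. \<phi> x * h x - \<phi> (x + ?c) * h x \<partial>lborel)"
        using inth[of 0 0] inth[of ?c 0] c by (subst Bochner_Integration.integral_diff) auto
      then show ?thesis
        by (simp add: left_diff_distrib diff_divide_distrib flip: integral_divide_zero)
    qed
    ultimately show ?thesis using \<epsilon>[of n] by (simp add: field_simps)
  qed
  have \<phi>lip: "\<bar>\<phi> x - \<phi> y\<bar> \<le> 3 * norm (x - y)" if "norm x \<le> 3" "norm y \<le> 3" for x y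
  proof -
    have "\<bar>\<phi> x - \<phi> y\<bar> \<le> \<bar>(norm x)\<^sup>2 - (norm y)\<^sup>2\<bar> / 2"
    proof -
      have "\<bar>max 0 ((1 - X) / 2) - max 0 ((1 - Y) / 2)\<bar> \<le> \<bar>X - Y\<bar> / 2" for X Y :: real
        by (auto simp: max_def abs_if field_simps)
      then show ?thesis unfolding \<phi>_def .
    qed
    also have "\<dots> = (norm x + norm y) * \<bar>norm x - norm y\<bar> / 2"
      by (simp add: power2_eq_square square_diff_square_factored abs_mult)
    also have "\<dots> \<le> 6 * norm (x - y) / 2"
      using that norm_triangle_ineq3[of x y] by (intro divide_right_mono mult_mono) auto
    finally show ?thesis by simp
  qed
  have [measurable]: "ball (0::'a) 1 \<in> sets borel" by simp
  have "(\<lambda>n. \<integral>x. ((\<phi> x - \<phi> (x + \<epsilon> n *\<^sub>R u)) / \<epsilon> n) * h x \<partial>lborel) \<longlonglongrightarrow>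
      (\<integral>x. indicator (ball 0 1) x * (h x * (x \<bullet> u)) \<partial>lborel)"
  \<comment> \<open>Since \<open>\<epsilon> n \<le> 1\<close>, the quotient vanishes when
    \<open>norm x\<close> exceeds 2. Elsewhere it is at most 3 in absolute value, by the Lipschitz
    bound on the ball of radius 3, while \<open>h\<close> is at most \<open>2 * B\<close>.\<close>
  proof (rule integral_dominated_convergence[where w = "\<lambda>x. indicator (cball 0 2) x * (6 * B)"])
    show "integrable lborel (\<lambda>x::'a. indicator (cball 0 2) x * (6 * B))"
      using B(1) by (intro integrable_lborel_bounded_support[where C = "6 * B" and R = 2]) (auto simp: indicator_def)
    have bd: "norm (((\<phi> x - \<phi> (x + \<epsilon> n *\<^sub>R u)) / \<epsilon> n) * h x) \<le> indicator (cball 0 2) x * (6 * B)" for n x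
    proof (cases "norm x \<le> 2")
      case True
      have "norm (x + \<epsilon> n *\<^sub>R u) \<le> 3"
        using True \<epsilon>[of n] u norm_triangle_ineq[of x "\<epsilon> n *\<^sub>R u"] by simp
      then have "\<bar>\<phi> x - \<phi> (x + \<epsilon> n *\<^sub>R u)\<bar> \<le> 3 * \<epsilon> n"
        using \<phi>lip[of x "x + \<epsilon> n *\<^sub>R u"] True \<epsilon>[of n] u by simp
      then have "\<bar>(\<phi> x - \<phi> (x + \<epsilon> n *\<^sub>R u)) / \<epsilon> n\<bar> \<le> 3"
        using \<epsilon>[of n] by (simp add: field_simps)
      moreover have "\<bar>h x\<bar> \<le> 2 * B"
        using order_trans[OF B(2)[of x] mult_left_mono[OF True, of B]] B(1) by (simp add: mult.commute)
      ultimately have "\<bar>(\<phi> x - \<phi> (x + \<epsilon> n *\<^sub>R u)) / \<epsilon> n\<bar> * \<bar>h x\<bar> \<le> 3 * (2 * B)"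
        by (intro mult_mono) auto
      then show ?thesis using True by (simp add: abs_mult)
    next
      case False
      have "norm (x + \<epsilon> n *\<^sub>R u) \<ge> 1"
        using False \<epsilon>[of n] u norm_diff_ineq[of x "\<epsilon> n *\<^sub>R u"] by simp
      then show ?thesis using False \<phi>0[of x] \<phi>0[of "x + \<epsilon> n *\<^sub>R u"] by simp
    qed
    then show "AE x in lborel. norm (((\<phi> x - \<phi> (x + \<epsilon> n *\<^sub>R u)) / \<epsilon> n) * h x) \<le> indicator (cball 0 2) x * (6 * B)" for n
      by simp
    \<comment> \<open>\<open>\<phi>\<close> has a kink on the sphere, so pointwise convergence is
      claimed only off this null set.\<close>
    have "sphere 0 1 \<in> null_sets (lborel :: 'a measure)"
      using negligible_sphere[of "0::'a" 1] by (simp add: negligible_iff_null_sets null_sets_completion_iff)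
    then have "AE x in lborel. (x::'a) \<notin> sphere 0 1" by (rule AE_not_in)
    then show "AE x in lborel. (\<lambda>n. ((\<phi> x - \<phi> (x + \<epsilon> n *\<^sub>R u)) / \<epsilon> n) * h x) \<longlonglongrightarrow> indicator (ball 0 1) x * (h x * (x \<bullet> u))"
    proof eventually_elim
      fix x :: 'a assume x: "x \<notin> sphere 0 1"
      have \<epsilon>0: "\<epsilon> \<longlonglongrightarrow> 0" unfolding \<epsilon>_def using LIMSEQ_inverse_real_of_nat by (simp add: inverse_eq_divide)
      have "(\<lambda>n. norm (x + \<epsilon> n *\<^sub>R u)) \<longlonglongrightarrow> norm (x + 0 *\<^sub>R u)"
        by (intro tendsto_intros \<epsilon>0)
      then have lim: "(\<lambda>n. norm (x + \<epsilon> n *\<^sub>R u)) \<longlonglongrightarrow> norm x" by simp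
      have "(\<lambda>n. (\<phi> x - \<phi> (x + \<epsilon> n *\<^sub>R u)) / \<epsilon> n) \<longlonglongrightarrow> indicator (ball 0 1) x * (x \<bullet> u)"
      proof (cases "norm x < 1")
        case True
        \<comment> \<open>\<open>\<phi>\<close> is quadratic inside the ball, so the quotient equals
          this expression exactly once the shifted point is inside too.\<close>
        have "(\<lambda>n. x \<bullet> u + \<epsilon> n / 2) \<longlonglongrightarrow> x \<bullet> u + 0 / 2"
          by (intro tendsto_intros \<epsilon>0) auto
        moreover have "\<forall>\<^sub>F n in sequentially. x \<bullet> u + \<epsilon> n / 2 = (\<phi> x - \<phi> (x + \<epsilon> n *\<^sub>R u)) / \<epsilon> n"
          using order_tendstoD(2)[OF lim True]
        proof eventually_elim
          case (elim n)
          have "(norm (x + \<epsilon> n *\<^sub>R u))\<^sup>2 = (norm x)\<^sup>2 + 2 * (\<epsilon> n * (x \<bullet> u)) + (\<epsilon> n)\<^sup>2"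
            using u \<epsilon>(1)[of n] dot_norm[of x "\<epsilon> n *\<^sub>R u"] by simp
          then show ?case
            using \<epsilon>(1)[of n] by (simp add: \<phi>1[OF True] \<phi>1[OF elim] field_simps power2_eq_square)
        qed
        ultimately show ?thesis using True by (simp add: Lim_transform_eventually)
      next
        case False
        then have x1: "norm x > 1" using x by simp
        have "\<forall>\<^sub>F n in sequentially. (\<phi> x - \<phi> (x + \<epsilon> n *\<^sub>R u)) / \<epsilon> n = 0"
          using order_tendstoD(1)[OF lim x1] by eventually_elim (use x1 \<phi>0 in simp)
        then show ?thesis using False by (simp add: tendsto_eventually)
      qed
      then have "(\<lambda>n. (\<phi> x - \<phi> (x + \<epsilon> n *\<^sub>R u)) / \<epsilon> n * h x) \<longlonglongrightarrow> indicator (ball 0 1) x * (x \<bullet> u) * h x"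
        by (intro tendsto_intros)
      then show "(\<lambda>n. (\<phi> x - \<phi> (x + \<epsilon> n *\<^sub>R u)) / \<epsilon> n * h x) \<longlonglongrightarrow> indicator (ball 0 1) x * (h x * (x \<bullet> u))"
        by (simp add: mult_ac)
    qed
  qed measurable
  then have "(\<integral>x. indicator (ball 0 1) x * (h x * (x \<bullet> u)) \<partial>lborel) \<le> h u * (\<integral>x. \<phi> x \<partial>lborel)"
    by (rule LIMSEQ_le_const2) (use le in auto)
  then show ?thesis unfolding h_def \<phi>eq .
qed

section \<open>Membership of the Steiner point in its set\<close>

text \<open>The spherical mean becomes a mean over the ball of a function homogeneous of degree 0.
  Inserting the weight \<open>(norm x)\<^sup>2\<close> costs the factor (m+2)/m and turns the
  integrand into \<open>support_fun K x * (x \<bullet> u)\<close>, to which the integration by parts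
  applies. The remaining integral is v/(m+2), with v the volume of the ball, and all constants
  cancel.\<close>

lemma steiner_point_inner_le:
  fixes K :: "'a::euclidean_space set"
  assumes K: "compact K" "K \<noteq> {}" and u: "norm u = 1"
  shows "steiner_point K \<bullet> u \<le> support_fun K u"
proof -
  let ?m = "DIM('a)" and ?h = "support_fun K"
  define v where "v = measure lborel (ball (0::'a) 1)"
  have v: "v > 0" unfolding v_def by (simp add: content_ball_pos)
  have ev: "emeasure lborel (ball (0::'a) 1) = ennreal v"
    using emeasure_bounded_finite[of "ball (0::'a) 1"] unfolding v_def
    by (intro emeasure_eq_ennreal_measure) auto
  \<comment> \<open>The spherical integrand in direction \<open>u\<close>, extended radially as a
    function homogeneous of degree 0.\<close>
  define G where "G = (\<lambda>x. ?h (x /\<^sub>R norm x) * ((x /\<^sub>R norm x) \<bullet> u))"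
  obtain B where B: "B > 0" "\<And>p. \<bar>?h p\<bar> \<le> B * norm p"
    using support_fun_bound[OF K] by blast
  have [measurable]: "?h \<in> borel_measurable borel" by (rule borel_measurable_support_fun[OF K])
  have Gm: "G \<in> borel_measurable borel" unfolding G_def by measurable
  have n1: "norm (x /\<^sub>R norm x) \<le> 1" for x :: 'a by (cases "x = 0") auto
  have hB: "\<bar>?h (x /\<^sub>R norm x)\<bar> \<le> B" for x
    using B(2)[of "x /\<^sub>R norm x"] mult_left_mono[OF n1[of x], of B] B(1) by linarith
  have Gb: "\<bar>G x\<bar> \<le> B" for x
  proof -
    have "\<bar>(x /\<^sub>R norm x) \<bullet> u\<bar> \<le> 1"
      using Cauchy_Schwarz_ineq2[of "x /\<^sub>R norm x" u] n1[of x] u by simp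
    then have "\<bar>?h (x /\<^sub>R norm x)\<bar> * \<bar>(x /\<^sub>R norm x) \<bullet> u\<bar> \<le> B * 1"
      using hB[of x] B(1) by (intro mult_mono) auto
    then show ?thesis by (simp add: G_def abs_mult)
  qed
  have Gh: "G (c *\<^sub>R x) = G x" if "c > 0" for c x
  proof -
    have "inverse (c * norm x) * c = inverse (norm x)"
      using that by (cases "norm x = 0") (auto simp: field_simps)
    then have "(c *\<^sub>R x) /\<^sub>R norm (c *\<^sub>R x) = x /\<^sub>R norm x"
      using that by (simp only: norm_scaleR abs_of_pos scaleR_scaleR)
    then show ?thesis unfolding G_def by (simp only:)
  qed
  have Gsq: "(norm x)\<^sup>2 * G x = ?h x * (x \<bullet> u)" for x
  proof (cases "x = 0")
    case False
    have "?h x = norm x * ?h (x /\<^sub>R norm x)"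
      using support_fun_scaleR[OF K, of "norm x" "x /\<^sub>R norm x"] False by simp
    then show ?thesis using False by (simp add: G_def power2_eq_square)
  qed (simp add: G_def)
  have um: "uniform_measure lborel (ball (0::'a) 1) = density lborel (\<lambda>x. ennreal (indicator (ball 0 1) x / v))"
    unfolding uniform_measure_def ev using v
    by (intro density_cong) (auto simp: divide_ennreal indicator_def ennreal_1[symmetric] simp del: ennreal_1)
  have "integral\<^sup>L sphere_measure (\<lambda>p. ?h p *\<^sub>R p) =
     (\<integral>x. (?h (x /\<^sub>R norm x) *\<^sub>R (x /\<^sub>R norm x)) \<partial>uniform_measure lborel (ball 0 1))"
    unfolding sphere_measure_def by (intro integral_distr) auto
  also have "\<dots> = (\<integral>x. (indicator (ball 0 1) x / v) *\<^sub>R (?h (x /\<^sub>R norm x) *\<^sub>R (x /\<^sub>R norm x)) \<partial>lborel)"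
    unfolding um
  proof (rule integral_density)
    have [measurable]: "ball (0::'a) 1 \<in> sets borel" by simp
    show "(\<lambda>x. indicator (ball (0::'a) 1) x / v) \<in> borel_measurable lborel" by measurable
  qed (use v in auto)
  finally have s: "steiner_point K = ?m *\<^sub>R (\<integral>x. (indicator (ball 0 1) x / v) *\<^sub>R (?h (x /\<^sub>R norm x) *\<^sub>R (x /\<^sub>R norm x)) \<partial>lborel)"
    by (simp add: steiner_point_def)
  have int: "integrable lborel (\<lambda>x. (indicator (ball 0 1) x / v) *\<^sub>R (?h (x /\<^sub>R norm x) *\<^sub>R (x /\<^sub>R norm x)))"
  proof (rule integrableI_bounded_set[where A = "ball 0 1" and B = "B / v"])
    have *: "norm ((indicator (ball 0 1) x / v) *\<^sub>R z) \<le> B / v" if "x \<in> ball 0 1" "norm z \<le> B * 1" for x z :: 'a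
      using that v by (simp add: divide_right_mono)
    have "norm (?h (x /\<^sub>R norm x) *\<^sub>R (x /\<^sub>R norm x)) \<le> B * 1" for x
      unfolding norm_scaleR real_norm_def using hB[of x] n1[of x] B(1) by (intro mult_mono) auto
    then show "AE x in lborel. x \<in> ball 0 1 \<longrightarrow> norm ((indicator (ball 0 1) x / v) *\<^sub>R (?h (x /\<^sub>R norm x) *\<^sub>R (x /\<^sub>R norm x))) \<le> B / v"
      by (intro AE_I2 impI *) auto
    have [measurable]: "ball (0::'a) 1 \<in> sets borel" by simp
    show "(\<lambda>x. (indicator (ball 0 1) x / v) *\<^sub>R (?h (x /\<^sub>R norm x) *\<^sub>R (x /\<^sub>R norm x))) \<in> borel_measurable lborel"
      by measurable
  qed (use emeasure_bounded_finite[of "ball (0::'a) 1"] in auto)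
  have "steiner_point K \<bullet> u = ?m * (\<integral>x. (indicator (ball 0 1) x / v) * G x \<partial>lborel)"
    unfolding s inner_scaleR_left integral_inner_left[OF int, symmetric] by (simp add: G_def mult_ac)
  also have "\<dots> = (?m / v) * (\<integral>x. indicator (ball 0 1) x * G x \<partial>lborel)"
    by (simp add: divide_inverse mult_ac flip: integral_mult_right_zero)
  also have "\<dots> = ((?m + 2) / v) * (\<integral>x. indicator (ball 0 1) x * ((norm x)\<^sup>2 * G x) \<partial>lborel)"
    using integral_ball_norm_sq_homogeneous[OF Gm Gb Gh] by (simp add: field_simps)
  also have "\<dots> \<le> ((?m + 2) / v) * (?h u * (\<integral>x. indicator (ball (0::'a) 1) x * ((1 - (norm x)\<^sup>2) / 2) \<partial>lborel))"
    unfolding Gsq using v by (intro mult_left_mono integral_ball_support_fun_le[OF K u]) auto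
  also have "(\<integral>x. indicator (ball (0::'a) 1) x * ((1 - (norm x)\<^sup>2) / 2) \<partial>lborel) = v / (?m + 2)"
  proof -
    have int1: "integrable lborel (\<lambda>x::'a. indicator (ball 0 1) x :: real)"
      by (intro integrable_lborel_bounded_support[where C = 1 and R = 1]) (auto simp: indicator_def)
    have int2: "integrable lborel (\<lambda>x::'a. indicator (ball 0 1) x * (norm x)\<^sup>2)"
      by (intro integrable_lborel_bounded_support[where C = 1 and R = 1]) (auto simp: indicator_def power_le_one)
    have i1: "(\<integral>x. indicator (ball (0::'a) 1) x \<partial>lborel) = v" by (simp add: v_def)
    have i2: "(\<integral>x. indicator (ball (0::'a) 1) x * (norm x)\<^sup>2 \<partial>lborel) = ?m / (?m + 2) * v"
      using integral_ball_norm_sq_homogeneous[of "\<lambda>x::'a. 1" 1] i1 by simp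
    have "(\<integral>x. indicator (ball (0::'a) 1) x * ((1 - (norm x)\<^sup>2) / 2) \<partial>lborel) =
       (\<integral>x. (indicator (ball (0::'a) 1) x - indicator (ball (0::'a) 1) x * (norm x)\<^sup>2) / 2 \<partial>lborel)"
      by (intro Bochner_Integration.integral_cong) (auto simp: algebra_simps)
    also have "\<dots> = (v - ?m / (?m + 2) * v) / 2"
      unfolding integral_divide_zero Bochner_Integration.integral_diff[OF int1 int2] i1 i2 ..
    also have "\<dots> = v / (?m + 2)" by (simp add: field_simps)
    finally show ?thesis .
  qed
  finally show ?thesis using v by simp
qed

text \<open>A compact convex set is the intersection of its supporting half-spaces, so a point
  outside would violate the support function bound in some unit direction.\<close>

theorem steiner_point_in:
  fixes K :: "'a::euclidean_space set"
  assumes K: "compact K" "convex K" "K \<noteq> {}"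
  shows "steiner_point K \<in> K"
proof (rule ccontr)
  assume "steiner_point K \<notin> K"
  then obtain a b where ab: "a \<bullet> steiner_point K < b" "\<And>x. x \<in> K \<Longrightarrow> b < a \<bullet> x"
    using separating_hyperplane_closed_point[OF K(2) compact_imp_closed[OF K(1)]] by blast
  then have "a \<noteq> 0" using K(3) by force
  \<comment> \<open>The separating vector \<open>a\<close> has the set on its positive side, so the
    outer normal facing the Steiner point is its negative.\<close>
  define u where "u = - (a /\<^sub>R norm a)"
  have u: "norm u = 1" using \<open>a \<noteq> 0\<close> by (simp add: u_def)
  obtain y where y: "y \<in> K" "support_fun K u = u \<bullet> y"
    using support_fun_attained[OF K(1,3)] by blast
  have "norm a * (steiner_point K \<bullet> u) \<le> norm a * (u \<bullet> y)"
    using steiner_point_inner_le[OF K(1,3) u] y(2) by (intro mult_left_mono) auto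
  then have "- (a \<bullet> steiner_point K) \<le> - (a \<bullet> y)"
    using \<open>a \<noteq> 0\<close> by (simp add: u_def inner_commute)
  then show False using ab(1) ab(2)[OF y(1)] by linarith
qed

lemma steiner_point_singleton: "steiner_point {a} = (a::'a::euclidean_space)"
  using steiner_point_in[of "{a}"] by simp

section \<open>Epigraphs of conjugate functions\<close>

lemma mem_epiH_iff: "z \<in> epiH H t x \<longleftrightarrow> (\<forall>p. fst z \<bullet> p - H t x p \<le> snd z)"
  by (auto simp: epiH_def Hstar_def SUP_le_iff case_prod_beta)

text \<open>The epigraph of the Fenchel conjugate of \<open>h\<close>, with the supremum unfolded
  into affine inequalities. No extended reals remain, and the set is visibly an intersection of
  closed half-spaces.\<close>

definition conj_epi :: "('n::euclidean_space \<Rightarrow> real) \<Rightarrow> ('n \<times> real) set" where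
  "conj_epi h = {z. \<forall>p. fst z \<bullet> p - h p \<le> snd z}"

lemma epiH_eq_conj_epi: "epiH H t x = conj_epi (H t x)"
  by (auto simp: mem_epiH_iff conj_epi_def)

lemma conj_epiD: "z \<in> conj_epi h \<Longrightarrow> fst z \<bullet> p - h p \<le> snd z"
  by (simp add: conj_epi_def)

lemma closed_conj_epi: "closed (conj_epi h)"
proof -
  have "conj_epi h = (\<Inter>p. {z. fst z \<bullet> p - h p \<le> snd z})" by (auto simp: conj_epi_def)
  also have "closed \<dots>" by (intro closed_INT ballI closed_Collect_le continuous_intros)
  finally show ?thesis .
qed

lemma convex_conj_epi: "convex (conj_epi h)"
proof (rule convexI)
  fix x y :: "'a \<times> real" and u v :: real
  assume xy: "x \<in> conj_epi h" "y \<in> conj_epi h" and uv: "0 \<le> u" "0 \<le> v" "u + v = 1"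
  have "fst (u *\<^sub>R x + v *\<^sub>R y) \<bullet> p - h p \<le> snd (u *\<^sub>R x + v *\<^sub>R y)" for p
  proof -
    have "fst (u *\<^sub>R x + v *\<^sub>R y) \<bullet> p - h p = fst (u *\<^sub>R x + v *\<^sub>R y) \<bullet> p - (u + v) * h p"
      using uv by simp
    also have "\<dots> = u * (fst x \<bullet> p - h p) + v * (fst y \<bullet> p - h p)"
      by (simp add: inner_add_left algebra_simps)
    also have "\<dots> \<le> u * snd x + v * snd y"
      using uv xy by (intro add_mono mult_left_mono conj_epiD)
    finally show ?thesis by simp
  qed
  then show "u *\<^sub>R x + v *\<^sub>R y \<in> conj_epi h" unfolding conj_epi_def by blast
qed

text \<open>The point lying \<open>e\<close> below the graph of \<open>h\<close> at \<open>p\<close>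
  is strictly separated from the epigraph of \<open>h\<close>; the slope of the hyperplane is an
  e-subgradient at \<open>p\<close>. Thus the supremum that recovers \<open>h p\<close> from its
  conjugate is attained up to \<open>e\<close>.\<close>

lemma conj_epi_approx_subgradient:
  fixes h :: "'n::euclidean_space \<Rightarrow> real"
  assumes h: "convex_on UNIV h" and e: "e > 0"
  obtains v where "(v, v \<bullet> p - h p + e) \<in> conj_epi h"
proof -
  let ?S = "{z::'n \<times> real. h (fst z) \<le> snd z}"
  have hc: "continuous_on UNIV h" by (rule convex_on_continuous[OF open_UNIV h])
  have S1: "closed ?S"
    by (intro closed_Collect_le continuous_intros continuous_on_compose2[OF hc]) auto
  have S2: "convex ?S"
    using convex_epigraph[of UNIV h] h by (simp add: epigraph_def)
  have S3: "(p, h p - e) \<notin> ?S" using e by simp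
  obtain a b where ab: "a \<bullet> (p, h p - e) < b" "\<And>x. x \<in> ?S \<Longrightarrow> b < a \<bullet> x"
    using separating_hyperplane_closed_point[OF S2 S1 S3] by blast
  define w where "w = fst a" define c where "c = snd a"
  have a1: "w \<bullet> p + c * (h p - e) < b"
    using ab(1) by (simp add: w_def c_def inner_prod_def)
  have a2: "b < w \<bullet> q + c * h q" for q
    using ab(2)[of "(q, h q)"] by (simp add: w_def c_def inner_prod_def)
  \<comment> \<open>The hyperplane is not vertical: it separates two points that differ only in the
    last coordinate.\<close>
  have "c * e > 0" using a1 a2[of p] by (simp add: right_diff_distrib)
  then have c: "c > 0" using e by (simp add: zero_less_mult_iff)
  define v where "v = - (w /\<^sub>R c)"
  have cv: "c * (v \<bullet> q) = - (w \<bullet> q)" for q using c by (simp add: v_def)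
  have "v \<bullet> q - h q \<le> v \<bullet> p - h p + e" for q
  proof -
    have "c * (v \<bullet> q - h q) = - (w \<bullet> q + c * h q)" by (simp add: right_diff_distrib cv)
    also have "\<dots> \<le> - (w \<bullet> p + c * (h p - e))" using a1 a2[of q] by simp
    also have "\<dots> = c * (v \<bullet> p - h p + e)" by (simp add: right_diff_distrib distrib_left cv)
    finally show ?thesis using c by simp
  qed
  then have "(v, v \<bullet> p - h p + e) \<in> conj_epi h" by (simp add: conj_epi_def)
  then show thesis by (rule that)
qed

lemma conj_epi_nonempty:
  assumes "convex_on UNIV h"
  shows "conj_epi h \<noteq> {}"
  using conj_epi_approx_subgradient[OF assms zero_less_one] by blast

text \<open>The support function of \<open>conj_epi h\<close> in direction \<open>(p, -1)\<close> is \<open>h p\<close>, so this is the dual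
  description of the distance to \<open>conj_epi h\<close>.\<close>

lemma infdist_conj_epi_le:
  fixes h :: "'n::euclidean_space \<Rightarrow> real"
  assumes h: "convex_on UNIV h" and "\<rho> \<ge> 0"
    and le: "\<And>p. fst a \<bullet> p - snd a - h p \<le> \<rho> * norm (p, 1::real)"
  shows "infdist a (conj_epi h) \<le> \<rho>"
proof -
  let ?E = "conj_epi h"
  have E: "closed ?E" "convex ?E" "?E \<noteq> {}"
    by (rule closed_conj_epi convex_conj_epi conj_epi_nonempty[OF h])+
  define z where "z = closest_point ?E a"
  have z: "z \<in> ?E" unfolding z_def by (rule closest_point_in_set[OF E(1,3)])
  \<comment> \<open>An outer normal of the epigraph at the nearest point. If its last coordinate is
    negative it is a positive multiple of some \<open>(p, - 1)\<close>, a direction in which the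
    hypothesis speaks.\<close>
  define w where "w = a - z"
  define s where "s = - snd w"
  have dot: "w \<bullet> y \<le> w \<bullet> z" if "y \<in> ?E" for y
    using closest_point_dot[OF E(2,1) that, of a] by (simp add: w_def z_def inner_diff_right)
  \<comment> \<open>The epigraph is closed under raising the last coordinate, so no outer normal
    points upwards.\<close>
  have "(fst z, snd z + 1) \<in> ?E" using z by (auto simp: conj_epi_def intro: order_trans)
  from dot[OF this] have s: "s \<ge> 0" by (simp add: s_def inner_prod_def algebra_simps)
  \<comment> \<open>A horizontal normal, with \<open>s = 0\<close>, cannot be scaled to
    \<open>(p, - 1)\<close>. Replacing \<open>s\<close> by \<open>s + \<eta>\<close> covers both
    cases; an approximate subgradient at the resulting \<open>p\<close> plays the role of a
    maximizer, and all errors vanish as \<open>\<eta>\<close> tends to 0.\<close>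
  have key: "(norm w)\<^sup>2 \<le> \<rho> * (norm w + \<eta>) + \<eta> * snd a + (s + \<eta>) * \<eta> + \<eta> * h 0" if \<eta>: "\<eta> > 0" for \<eta>
  proof -
    define p where "p = fst w /\<^sub>R (s + \<eta>)"
    have w1: "fst w = (s + \<eta>) *\<^sub>R p" using s \<eta> by (simp add: p_def)
    obtain v where v: "(v, v \<bullet> p - h p + \<eta>) \<in> ?E"
      using conj_epi_approx_subgradient[OF h \<eta>] by blast
    have "w \<bullet> (v, v \<bullet> p - h p + \<eta>) = \<eta> * (v \<bullet> p) + s * h p - s * \<eta>"
      by (simp add: inner_prod_def w1 inner_commute[of p v] algebra_simps) (simp add: s_def algebra_simps)
    then have "\<eta> * (v \<bullet> p) + s * h p - s * \<eta> \<le> w \<bullet> z" using dot[OF v] by simp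
    moreover have "\<eta> * (h p - h 0 - \<eta>) \<le> \<eta> * (v \<bullet> p)"
      using conj_epiD[OF v, of 0] \<eta> by (intro mult_left_mono) auto
    ultimately have 1: "(s + \<eta>) * h p \<le> w \<bullet> z + (s + \<eta>) * \<eta> + \<eta> * h 0"
      by (simp add: algebra_simps)
    have "(s + \<eta>) * (fst a \<bullet> p - snd a - h p) \<le> (s + \<eta>) * (\<rho> * norm (p, 1::real))"
      using s \<eta> by (intro mult_left_mono le) auto
    also have "\<dots> = \<rho> * norm ((s + \<eta>) *\<^sub>R (p, 1::real))"
      using s \<eta> unfolding norm_scaleR by simp
    also have "\<dots> \<le> \<rho> * (norm w + \<eta>)"
    proof (rule mult_left_mono[OF _ \<open>\<rho> \<ge> 0\<close>])
      have "norm ((s + \<eta>) *\<^sub>R (p, 1::real)) = norm ((fst w, - snd w) + (0, \<eta>))"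
        by (simp add: w1 s_def)
      also have "\<dots> \<le> norm (fst w, - snd w) + norm (0::'n, \<eta>)" by (rule norm_triangle_ineq)
      also have "\<dots> = norm w + \<eta>" using \<eta> by (simp add: norm_prod_def)
      finally show "norm ((s + \<eta>) *\<^sub>R (p, 1::real)) \<le> norm w + \<eta>" .
    qed
    also have "(s + \<eta>) * (fst a \<bullet> p - snd a - h p) = w \<bullet> a - \<eta> * snd a - (s + \<eta>) * h p"
      by (simp add: inner_prod_def w1 inner_commute[of p] algebra_simps) (simp add: s_def algebra_simps)
    finally have "w \<bullet> a - w \<bullet> z \<le> \<rho> * (norm w + \<eta>) + \<eta> * snd a + (s + \<eta>) * \<eta> + \<eta> * h 0"
      using 1 by linarith
    moreover have "w \<bullet> a - w \<bullet> z = (norm w)\<^sup>2" by (simp add: w_def power2_norm_eq_inner inner_diff_right)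
    ultimately show ?thesis by simp
  qed
  have "(norm w)\<^sup>2 \<le> \<rho> * norm w"
  proof (rule tendsto_lowerbound)
    show "((\<lambda>\<eta>. \<rho> * (norm w + \<eta>) + \<eta> * snd a + (s + \<eta>) * \<eta> + \<eta> * h 0) \<longlongrightarrow> \<rho> * norm w) (at_right 0)"
      by (auto intro!: tendsto_eq_intros)
    show "\<forall>\<^sub>F \<eta> in at_right 0. (norm w)\<^sup>2 \<le> \<rho> * (norm w + \<eta>) + \<eta> * snd a + (s + \<eta>) * \<eta> + \<eta> * h 0"
      using key eventually_at_right_less by (rule eventually_mono[rotated])
  qed simp
  then have "norm w \<le> \<rho>"
    using \<open>\<rho> \<ge> 0\<close> by (cases "norm w = 0") (simp_all add: power2_eq_square)
  then show ?thesis
    using infdist_le[OF z, of a] by (simp add: w_def dist_norm)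
qed

lemma infdist_eq_dist_closest_point:
  fixes E :: "'a::euclidean_space set"
  assumes "closed E" "E \<noteq> {}"
  shows "infdist a E = dist a (closest_point E a)"
  using setdist_closest_point[OF assms] by (simp add: infdist_eq_setdist)

text \<open>The direction from distance to inequalities is Cauchy-Schwarz against
  \<open>(p, - 1)\<close>. The equivalence describes sublevel sets of the distance by inequalities
  pointwise in \<open>p\<close>, as needed for measurability.\<close>

lemma infdist_conj_epi_le_iff:
  fixes h :: "'n::euclidean_space \<Rightarrow> real"
  assumes h: "convex_on UNIV h" and "\<rho> \<ge> 0"
  shows "infdist a (conj_epi h) \<le> \<rho> \<longleftrightarrow> (\<forall>p. fst a \<bullet> p - snd a - h p \<le> \<rho> * norm (p, 1::real))"
proof
  assume le: "infdist a (conj_epi h) \<le> \<rho>"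
  let ?z = "closest_point (conj_epi h) a"
  have z: "?z \<in> conj_epi h" by (rule closest_point_in_set[OF closed_conj_epi conj_epi_nonempty[OF h]])
  show "\<forall>p. fst a \<bullet> p - snd a - h p \<le> \<rho> * norm (p, 1::real)"
  proof
    fix p
    have "fst a \<bullet> p - snd a - h p \<le> fst a \<bullet> p - snd a - (fst ?z \<bullet> p - snd ?z)"
      using conj_epiD[OF z, of p] by linarith
    also have "\<dots> = (a - ?z) \<bullet> (p, - 1)" by (simp add: inner_prod_def algebra_simps)
    also have "\<dots> \<le> norm (a - ?z) * norm (p, - 1::real)" by (rule norm_cauchy_schwarz)
    also have "\<dots> \<le> \<rho> * norm (p, - 1::real)"
      using le infdist_eq_dist_closest_point[OF closed_conj_epi conj_epi_nonempty[OF h], of a]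
      by (intro mult_right_mono) (auto simp: dist_norm)
    finally show "fst a \<bullet> p - snd a - h p \<le> \<rho> * norm (p, 1::real)" by (simp add: norm_prod_def)
  qed
next
  assume "\<forall>p. fst a \<bullet> p - snd a - h p \<le> \<rho> * norm (p, 1::real)"
  then show "infdist a (conj_epi h) \<le> \<rho>"
    by (intro infdist_conj_epi_le[OF assms]) (rule spec)
qed

lemma one_plus_norm_le: "1 + norm p \<le> 2 * norm (p, 1::real)"
  using norm_fst_le[of p "1::real"] norm_snd_le[of "1::real" p] by simp

text \<open>In the dual description, replacing \<open>h\<close> by \<open>h'\<close> raises the left
  side by at most \<open>k * (1 + norm p)\<close>; comparing this weight with
  \<open>norm (p, 1)\<close> costs the factor 2.\<close>

lemma infdist_conj_epi_lipschitz:
  fixes h h' :: "'n::euclidean_space \<Rightarrow> real"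
  assumes "convex_on UNIV h'" and z: "z \<in> conj_epi h" and "k \<ge> 0"
    and le: "\<And>p. \<bar>h p - h' p\<bar> \<le> k * (1 + norm p)"
  shows "infdist z (conj_epi h') \<le> 2 * k"
proof (rule infdist_conj_epi_le)
  fix p
  have "fst z \<bullet> p - snd z - h' p \<le> k * (1 + norm p)"
    using conj_epiD[OF z, of p] le[of p] by linarith
  also have "\<dots> \<le> k * (2 * norm (p, 1::real))"
    by (intro mult_left_mono one_plus_norm_le \<open>k \<ge> 0\<close>)
  finally show "fst z \<bullet> p - snd z - h' p \<le> 2 * k * norm (p, 1::real)" by simp
qed (use assms in auto)

lemma infdist_zero_conj_epi_le:
  fixes h :: "'n::euclidean_space \<Rightarrow> real"
  assumes "convex_on UNIV h" and "L \<ge> 0" and le: "\<And>p q. \<bar>h p - h q\<bar> \<le> L * norm (p - q)"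
  shows "infdist 0 (conj_epi h) \<le> \<bar>h 0\<bar> + L"
proof (rule infdist_conj_epi_le)
  fix p
  have "fst (0::'n \<times> real) \<bullet> p - snd (0::'n \<times> real) - h p \<le> \<bar>h 0\<bar> * 1 + L * norm p"
    using le[of p 0] by simp
  also have "\<dots> \<le> \<bar>h 0\<bar> * norm (p, 1::real) + L * norm (p, 1::real)"
    using norm_fst_le[of p "1::real"] norm_snd_le[of "1::real" p] \<open>L \<ge> 0\<close>
    by (intro add_mono mult_left_mono) auto
  finally show "fst (0::'n \<times> real) \<bullet> p - snd (0::'n \<times> real) - h p \<le> (\<bar>h 0\<bar> + L) * norm (p, 1::real)"
    by (simp add: algebra_simps)
qed (use assms in auto)

text \<open>A function with Lipschitz constant L has its conjugate finite only in the ball of radius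
  L: testing with large multiples of \<open>fst z\<close> would otherwise exceed any finite
  height.\<close>

lemma norm_fst_conj_epi_le:
  fixes h :: "'n::euclidean_space \<Rightarrow> real"
  assumes z: "z \<in> conj_epi h" and le: "\<And>p q. \<bar>h p - h q\<bar> \<le> L * norm (p - q)"
  shows "norm (fst z) \<le> L"
proof (rule ccontr)
  let ?v = "fst z"
  assume "\<not> norm ?v \<le> L"
  moreover have "L \<ge> 0"
  proof -
    obtain b :: 'n where "b \<in> Basis" using nonempty_Basis by blast
    then show ?thesis using le[of b 0] by simp
  qed
  ultimately have pos: "norm ?v * (norm ?v - L) > 0" by (intro mult_pos_pos) linarith+
  obtain n where n: "snd z + h 0 < real n * (norm ?v * (norm ?v - L))"
    using reals_Archimedean3[OF pos] by blast
  have "h (real n *\<^sub>R ?v) \<le> h 0 + L * (real n * norm ?v)"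
    using le[of "real n *\<^sub>R ?v" 0] by simp
  then have "real n * (norm ?v * norm ?v) - (h 0 + L * (real n * norm ?v)) \<le> snd z"
    using conj_epiD[OF z, of "real n *\<^sub>R ?v"] by (simp add: dot_square_norm power2_eq_square)
  then show False using n by (simp add: algebra_simps)
qed

section \<open>Measurable dependence on time\<close>

text \<open>The dual inequalities are continuous in \<open>p\<close>, since a finite convex function
  is continuous, so they need checking only on a countable dense set.\<close>

lemma infdist_conj_epi_measurable:
  fixes h :: "'t \<Rightarrow> 'n::euclidean_space \<Rightarrow> real"
  assumes hm [measurable]: "\<And>p. (\<lambda>t. h t p) \<in> borel_measurable M"
    and conv: "\<And>t. t \<in> space M \<Longrightarrow> convex_on UNIV (h t)"
    and a: "a \<in> borel_measurable M"
  shows "(\<lambda>t. infdist (a t) (conj_epi (h t))) \<in> borel_measurable M"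
  unfolding borel_measurable_iff_le
proof
  fix \<rho> :: real
  have [measurable]: "(\<lambda>t. fst (a t)) \<in> borel_measurable M" "(\<lambda>t. snd (a t)) \<in> borel_measurable M"
    using measurable_compose[OF a borel_measurable_continuous_onI[OF continuous_on_fst[OF continuous_on_id]]]
      measurable_compose[OF a borel_measurable_continuous_onI[OF continuous_on_snd[OF continuous_on_id]]] by auto
  obtain D :: "'n set" where D: "countable D" "\<And>X. open X \<Longrightarrow> X \<noteq> {} \<Longrightarrow> \<exists>d\<in>D. d \<in> X"
    using countable_dense_setE by blast
  have "D \<noteq> {}" using D(2)[OF open_UNIV] by blast
  then obtain e :: "nat \<Rightarrow> 'n" where e: "range e = D"
    using range_from_nat_into[OF _ D(1)] by blast
  show "{t \<in> space M. infdist (a t) (conj_epi (h t)) \<le> \<rho>} \<in> sets M"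
  proof (cases "\<rho> \<ge> 0")
    case False
    then have "\<not> infdist (a t) (conj_epi (h t)) \<le> \<rho>" for t
      using infdist_nonneg order_trans by blast
    then have "{t \<in> space M. infdist (a t) (conj_epi (h t)) \<le> \<rho>} = {}" by blast
    then show ?thesis by (simp only: sets.empty_sets)
  next
    case True
    have "{t \<in> space M. infdist (a t) (conj_epi (h t)) \<le> \<rho>} =
      {t \<in> space M. \<forall>p\<in>D. fst (a t) \<bullet> p - snd (a t) - h t p \<le> \<rho> * norm (p, 1::real)}"
    proof (intro Collect_cong conj_cong refl)
      fix t assume t: "t \<in> space M"
      let ?P = "\<lambda>p. fst (a t) \<bullet> p - snd (a t) - h t p \<le> \<rho> * norm (p, 1::real)"
      have hc: "continuous_on UNIV (h t)" by (rule convex_on_continuous[OF open_UNIV conv[OF t]])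
      have "open {p. \<not> ?P p}"
        unfolding not_le by (intro open_Collect_less continuous_intros hc)
      then have "(\<forall>p\<in>D. ?P p) \<longleftrightarrow> (\<forall>p. ?P p)"
        using D(2)[of "{p. \<not> ?P p}"] by blast
      then show "infdist (a t) (conj_epi (h t)) \<le> \<rho> \<longleftrightarrow> (\<forall>p\<in>D. ?P p)"
        using infdist_conj_epi_le_iff[OF conv[OF t] True] by blast
    qed
    moreover have "{t \<in> space M. \<forall>p\<in>D. fst (a t) \<bullet> p - snd (a t) - h t p \<le> \<rho> * norm (p, 1::real)} =
       {t \<in> space M. \<forall>n. fst (a t) \<bullet> e n - snd (a t) - h t (e n) \<le> \<rho> * norm (e n, 1::real)}"
      by (simp flip: e)
    moreover have "\<dots> \<in> sets M" by measurable
    ultimately show ?thesis by simp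
  qed
qed

text \<open>The gradient of the squared distance is twice \<open>a - closest_point E a\<close>.
  Testing each distance with the nearest point of the other argument gives both bounds, and
  nonexpansiveness of the projection controls the mismatch of the base points.\<close>

lemma infdist_sq_derivative_bound:
  fixes E :: "'a::euclidean_space set"
  assumes E: "closed E" "convex E" "E \<noteq> {}"
  shows "\<bar>(infdist (a + h) E)\<^sup>2 - (infdist a E)\<^sup>2 - 2 * (h \<bullet> (a - closest_point E a))\<bar> \<le> (norm h)\<^sup>2"
proof -
  let ?P = "closest_point E"
  have d: "infdist x E = norm (x - ?P x)" for x
    using infdist_eq_dist_closest_point[OF E(1,3)] by (simp add: dist_norm)
  have le: "(infdist x E)\<^sup>2 \<le> (norm (x - ?P y))\<^sup>2" for x y
    unfolding d using closest_point_le[OF E(1) closest_point_in_set[OF E(1,3)], of x y]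
    by (intro power_mono) (auto simp: dist_norm)
  have "(infdist (a + h) E)\<^sup>2 \<le> (infdist a E)\<^sup>2 + 2 * (h \<bullet> (a - ?P a)) + (norm h)\<^sup>2"
    using le[of "a + h" a] unfolding d[of a]
    by (simp add: power2_norm_eq_inner algebra_simps inner_commute)
  moreover have "(infdist a E)\<^sup>2 \<le> (infdist (a + h) E)\<^sup>2 - 2 * (h \<bullet> (a + h - ?P (a + h))) + (norm h)\<^sup>2"
    using le[of a "a + h"] unfolding d[of "a + h"]
    by (simp add: power2_norm_eq_inner algebra_simps inner_commute)
  moreover have "h \<bullet> (?P (a + h) - ?P a) \<le> (norm h)\<^sup>2"
  proof -
    have "h \<bullet> (?P (a + h) - ?P a) \<le> norm h * norm (?P (a + h) - ?P a)" by (rule norm_cauchy_schwarz)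
    also have "\<dots> \<le> norm h * norm h"
      using closest_point_lipschitz[OF E(2,1,3), of "a + h" a]
      by (intro mult_left_mono) (auto simp: dist_norm)
    finally show ?thesis by (simp add: power2_eq_square)
  qed
  ultimately show ?thesis
    by (simp add: abs_le_iff algebra_simps power2_norm_eq_inner)
qed

text \<open>The nearest point of a closed convex set is recovered from the gradient of the squared distance.\<close>

lemma closest_point_measurable:
  fixes E :: "'t \<Rightarrow> 'a::euclidean_space set"
  assumes E: "\<And>t. t \<in> space M \<Longrightarrow> closed (E t) \<and> convex (E t) \<and> E t \<noteq> {}"
    and d: "\<And>a. a \<in> borel_measurable M \<Longrightarrow> (\<lambda>t. infdist (a t) (E t)) \<in> borel_measurable M"
    and a [measurable]: "a \<in> borel_measurable M"
  shows "(\<lambda>t. closest_point (E t) (a t)) \<in> borel_measurable M"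
  unfolding borel_measurable_euclidean_space[where f="\<lambda>t. closest_point (E t) (a t)"]
proof
  fix b :: 'a assume b: "b \<in> Basis"
  \<comment> \<open>Minus half the difference quotient of the squared distance along
    \<open>b\<close>, with step 1/(n+1), corrected by the coordinate of \<open>a t\<close>.\<close>
  define q where "q = (\<lambda>n t. a t \<bullet> b - real (Suc n) / 2 *
     ((infdist (a t + (1 / real (Suc n)) *\<^sub>R b) (E t))\<^sup>2 - (infdist (a t) (E t))\<^sup>2))"
  show "(\<lambda>t. closest_point (E t) (a t) \<bullet> b) \<in> borel_measurable M"
  proof (rule borel_measurable_LIMSEQ_real)
    show "q n \<in> borel_measurable M" for n
    proof -
      have "(\<lambda>t. a t + (1 / real (Suc n)) *\<^sub>R b) \<in> borel_measurable M" by measurable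
      from d[OF this] d[OF a]
      have [measurable]: "(\<lambda>t. infdist (a t + (1 / real (Suc n)) *\<^sub>R b) (E t)) \<in> borel_measurable M"
        "(\<lambda>t. infdist (a t) (E t)) \<in> borel_measurable M" by simp_all
      show ?thesis unfolding q_def by measurable
    qed
    fix t assume t: "t \<in> space M"
    have "\<bar>q n t - closest_point (E t) (a t) \<bullet> b\<bar> \<le> 1 / real (Suc n)" for n
    proof -
      let ?c = "real (Suc n)" and ?P = "closest_point (E t) (a t)"
      let ?D = "(infdist (a t + (1 / ?c) *\<^sub>R b) (E t))\<^sup>2 - (infdist (a t) (E t))\<^sup>2"
      have "\<bar>?D - 2 * (((1 / ?c) *\<^sub>R b) \<bullet> (a t - ?P))\<bar> \<le> (norm ((1 / ?c) *\<^sub>R b))\<^sup>2"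
        using E[OF t] by (intro infdist_sq_derivative_bound) auto
      then have "\<bar>?D - 2 / ?c * (b \<bullet> (a t - ?P))\<bar> \<le> (1 / ?c)\<^sup>2"
        using b by simp
      then have "?c / 2 * \<bar>?D - 2 / ?c * (b \<bullet> (a t - ?P))\<bar> \<le> ?c / 2 * (1 / ?c)\<^sup>2"
        by (intro mult_left_mono) auto
      moreover have "?c / 2 * (1 / ?c)\<^sup>2 \<le> 1 / ?c" by (simp add: power2_eq_square frac_le)
      moreover have "\<bar>q n t - ?P \<bullet> b\<bar> = ?c / 2 * \<bar>?D - 2 / ?c * (b \<bullet> (a t - ?P))\<bar>"
      proof -
        have "?c / 2 * (?D - 2 / ?c * (b \<bullet> (a t - ?P))) = ?P \<bullet> b - q n t"
          by (simp add: q_def right_diff_distrib inner_diff_right inner_commute[of b])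
        then have "\<bar>?P \<bullet> b - q n t\<bar> = \<bar>?c / 2\<bar> * \<bar>?D - 2 / ?c * (b \<bullet> (a t - ?P))\<bar>"
          by (metis abs_mult)
        then show ?thesis by (simp add: abs_minus_commute)
      qed
      ultimately show ?thesis by linarith
    qed
    then have "\<forall>\<^sub>F n in sequentially. norm (q n t - closest_point (E t) (a t) \<bullet> b) \<le> inverse (real (Suc n))"
      by (simp add: inverse_eq_divide)
    from Lim_null_comparison[OF this LIMSEQ_inverse_real_of_nat]
    show "(\<lambda>n. q n t) \<longlonglongrightarrow> closest_point (E t) (a t) \<bullet> b" by (rule LIM_zero_cancel)
  qed
qed

text \<open>For a simple function in place of \<open>x\<close> the composition is measurable
  piecewise; continuity of \<open>F t\<close> passes this to the limit.\<close>

lemma caratheodory_compose_measurable: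
  fixes F :: "'t \<Rightarrow> 'a::euclidean_space \<Rightarrow> real"
  assumes F: "\<And>x. (\<lambda>t. F t x) \<in> borel_measurable M"
    and cont: "\<And>t. t \<in> space M \<Longrightarrow> continuous_on UNIV (F t)"
    and x: "x \<in> borel_measurable M"
  shows "(\<lambda>t. F t (x t)) \<in> borel_measurable M"
proof -
  obtain s where s: "\<And>i. simple_function M (s i)" "\<And>t. t \<in> space M \<Longrightarrow> (\<lambda>i. s i t) \<longlonglongrightarrow> x t"
    using borel_measurable_implies_sequence_metric[OF x, of 0] by blast
  show ?thesis
  proof (rule borel_measurable_LIMSEQ_real)
    show "(\<lambda>t. F t (s i t)) \<in> borel_measurable M" for i
    proof (rule measurable_compose_countable'[where I = "s i ` space M"])
      show "s i \<in> M \<rightarrow>\<^sub>M count_space (s i ` space M)"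
        using simple_functionD[OF s(1)[of i]]
        by (subst measurable_count_space_eq_countable) (auto intro: countable_finite)
    qed (use F s(1)[of i] in \<open>auto dest: simple_functionD(1) intro: countable_finite\<close>)
    fix t assume t: "t \<in> space M"
    show "(\<lambda>i. F t (s i t)) \<longlonglongrightarrow> F t (x t)"
      using continuous_on_tendsto_compose[OF cont[OF t] s(2)[OF t]] by simp
  qed
qed

section \<open>Filippov approximation\<close>

lemma geometric_increments_convergent:
  fixes u :: "nat \<Rightarrow> 'b::banach"
  assumes u: "\<And>n. norm (u (Suc n) - u n) \<le> C * (1/2) ^ n"
  shows "convergent u" and "norm (u n - u 0) \<le> 2 * C"
proof -
  have C: "C \<ge> 0" using u[of 0] order_trans[OF norm_ge_zero] by auto
  have "summable (\<lambda>n. u (Suc n) - u n)"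
    by (rule summable_comparison_test'[where g = "\<lambda>n. C * (1/2) ^ n" and N = 0])
       (use u in \<open>auto intro: summable_mult summable_geometric\<close>)
  then have "convergent (\<lambda>n. \<Sum>i<n. u (Suc i) - u i)"
    by (simp add: summable_iff_convergent)
  then have "convergent (\<lambda>n. u n - u 0)" by (simp add: sum_lessThan_telescope)
  then obtain l where "(\<lambda>n. u n - u 0) \<longlonglongrightarrow> l" by (auto simp: convergent_def)
  then have "(\<lambda>n. (u n - u 0) + u 0) \<longlonglongrightarrow> l + u 0" by (intro tendsto_intros)
  then show "convergent u" by (auto simp: convergent_def)
  have "norm (u n - u 0) \<le> 2 * C * (1 - (1/2) ^ n)"
  proof (induction n)
    case (Suc n)
    have "norm (u (Suc n) - u 0) \<le> norm (u (Suc n) - u n) + norm (u n - u 0)"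
      using norm_triangle_ineq[of "u (Suc n) - u n" "u n - u 0"] by simp
    also have "\<dots> \<le> C * (1/2) ^ n + 2 * C * (1 - (1/2) ^ n)" by (intro add_mono u Suc)
    also have "\<dots> = 2 * C * (1 - (1/2) ^ Suc n)" by (simp add: algebra_simps)
    finally show ?case .
  qed simp
  also have "\<dots> \<le> 2 * C * 1" using C by (intro mult_left_mono) auto
  finally show "norm (u n - u 0) \<le> 2 * C" by simp
qed

lemma absolutely_integrable_perturbation:
  fixes f f' :: "real \<Rightarrow> 'b::euclidean_space"
  assumes f: "f absolutely_integrable_on {a..b}" and f': "f' \<in> borel_measurable (lebesgue_on {a..b})"
    and g: "g integrable_on {a..b}" and le: "\<And>t. t \<in> {a..b} \<Longrightarrow> norm (f' t - f t) \<le> g t"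
  shows "f' absolutely_integrable_on {a..b}"
proof (rule measurable_bounded_by_integrable_imp_absolutely_integrable[OF f'])
  show "(\<lambda>t. norm (f t) + g t) integrable_on {a..b}"
    using absolutely_integrable_norm[OF f] g by (intro integrable_add) (auto simp: absolutely_integrable_on_def o_def)
  fix t assume "t \<in> {a..b}"
  then show "norm (f' t) \<le> norm (f t) + g t"
    using le[of t] norm_triangle_sub[of "f' t" "f t"] by linarith
qed simp

lemma absolutely_integrable_fst:
  fixes f :: "real \<Rightarrow> 'b::euclidean_space \<times> 'c::euclidean_space"
  assumes "f absolutely_integrable_on S"
  shows "(\<lambda>t. fst (f t)) absolutely_integrable_on S"
  using absolutely_integrable_linear[OF assms bounded_linear_fst] by (simp add: o_def)

lemma absolutely_integrable_snd:
  fixes f :: "real \<Rightarrow> 'b::euclidean_space \<times> 'c::euclidean_space"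
  assumes "f absolutely_integrable_on S"
  shows "(\<lambda>t. snd (f t)) absolutely_integrable_on S"
  using absolutely_integrable_linear[OF assms bounded_linear_snd] by (simp add: o_def)

lemma norm_fst_le_norm: "norm (fst z) \<le> norm z"
  by (metis norm_fst_le prod.collapse)

lemma norm_integral_fst_diff_le:
  fixes f f' :: "real \<Rightarrow> 'b::euclidean_space \<times> 'c::euclidean_space"
  assumes f: "f absolutely_integrable_on {a..b}" and f': "f' absolutely_integrable_on {a..b}"
    and g: "(g has_integral I) {a..t}" and le: "\<And>s. s \<in> {a..t} \<Longrightarrow> norm (f' s - f s) \<le> g s" and t: "t \<in> {a..b}"
  shows "norm (integral {a..t} (\<lambda>s. fst (f' s)) - integral {a..t} (\<lambda>s. fst (f s))) \<le> I"
proof -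
  have i: "(\<lambda>s. fst (w s)) integrable_on {a..t}" if "w absolutely_integrable_on {a..b}" for w :: "real \<Rightarrow> 'b \<times> 'c"
  proof -
    have "(\<lambda>s. fst (w s)) integrable_on {a..b}"
      using absolutely_integrable_fst[OF that] by (simp add: absolutely_integrable_on_def)
    then show ?thesis by (rule integrable_subinterval_real) (use t in auto)
  qed
  have "norm (integral {a..t} (\<lambda>s. fst (f' s)) - integral {a..t} (\<lambda>s. fst (f s))) =
      norm (integral {a..t} (\<lambda>s. fst (f' s) - fst (f s)))"
    by (simp add: Henstock_Kurzweil_Integration.integral_diff[OF i[OF f'] i[OF f]])
  also have "\<dots> \<le> integral {a..t} g"
  proof (rule integral_norm_bound_integral)
    show "(\<lambda>s. fst (f' s) - fst (f s)) integrable_on {a..t}" by (intro integrable_diff i f f')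
    show "norm (fst (f' s) - fst (f s)) \<le> g s" if "s \<in> {a..t}" for s
      using order_trans[OF norm_fst_le_norm le[OF that]] by simp
  qed (use g in blast)
  also have "\<dots> = I" using g by (rule integral_unique)
  finally show ?thesis .
qed

text \<open>The velocities are corrected by successive nearest-point
  projections; measured against the weight \<open>exp (2 * K t)\<close> each correction is half the previous one.\<close>

theorem filippov:
  fixes E :: "real \<Rightarrow> 'n::euclidean_space \<Rightarrow> ('n \<times> real) set"
    and w :: "real \<Rightarrow> 'n \<times> real" and x0 :: 'n
  assumes a: "0 \<le> a" "a \<le> T"
    and k: "k absolutely_integrable_on {0..T}" and knn: "\<And>t. t \<in> {0..T} \<Longrightarrow> 0 \<le> k t"
    and E: "\<And>t x. t \<in> {a..T} \<Longrightarrow> closed (E t x)" "\<And>t x. t \<in> {a..T} \<Longrightarrow> E t x \<noteq> {}"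
    and lip: "\<And>t x y z. t \<in> {a..T} \<Longrightarrow> z \<in> E t x \<Longrightarrow> infdist z (E t y) \<le> k t * norm (x - y)"
    and meas: "\<And>x w. continuous_on {a..T} x \<Longrightarrow> w \<in> borel_measurable (lebesgue_on {a..T}) \<Longrightarrow>
        (\<lambda>t. closest_point (E t (x t)) (w t)) \<in> borel_measurable (lebesgue_on {a..T})"
    and w: "w absolutely_integrable_on {a..T}"
    and y: "\<And>t. t \<in> {a..T} \<Longrightarrow> y t = y a + integral {a..t} (\<lambda>s. fst (w s))"
    and \<gamma>: "\<gamma> integrable_on {a..T}" and w\<gamma>: "\<And>t. t \<in> {a..T} \<Longrightarrow> infdist (w t) (E t (y t)) \<le> \<gamma> t"
  defines "K \<equiv> \<lambda>t. integral {0..t} k"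
  defines "A \<equiv> norm (x0 - y a) + integral {a..T} \<gamma>"
  shows "\<exists>x z. z absolutely_integrable_on {a..T} \<and>
    (\<forall>t\<in>{a..T}. z t \<in> E t (x t) \<and> x t = x0 + integral {a..t} (\<lambda>s. fst (z s)) \<and>
      norm (x t - y t) \<le> 2 * (A * exp (2 * K t)) \<and>
      norm (z t - w t) \<le> \<gamma> t + 2 * (A * (k t * exp (2 * K t))))"
proof -
  have sub: "{a..T} \<subseteq> {0..T}" using a by auto
  have ki: "k integrable_on {0..T}" using k by (simp add: absolutely_integrable_on_def)
  have \<gamma>nn: "0 \<le> \<gamma> t" if "t \<in> {a..T}" for t
    using w\<gamma>[OF that] infdist_nonneg order_trans by blast
  have A: "A \<ge> 0" unfolding A_def using \<gamma>nn \<gamma> by (intro add_nonneg_nonneg integral_nonneg) auto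
  have Kc: "continuous_on {a..T} K"
    unfolding K_def by (rule continuous_on_subset[OF indefinite_integral_continuous_1[OF ki] sub])
  have K0: "K t \<ge> 0" if "t \<in> {a..T}" for t
    unfolding K_def using that a by (intro integral_nonneg knn integrable_subinterval_real[OF ki]) auto
  \<comment> \<open>The majorant for the second correction; each later correction is bounded by half
    the majorant of the one before.\<close>
  define \<beta> where "\<beta> = (\<lambda>t. A * (k t * exp (2 * K t)))"
  have \<beta>I: "(\<beta> has_integral A * ((exp (2 * K t) - exp (2 * K a)) / 2)) {a..t}" if "t \<in> {a..T}" for t
    unfolding \<beta>_def K_def using that a by (intro has_integral_mult_right has_integral_mult_exp_integral[OF k knn]) auto
  have \<beta>i: "\<beta> integrable_on {a..T}" using \<beta>I[of T] a by auto
  have \<beta>nn: "0 \<le> \<beta> t" if "t \<in> {a..T}" for t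
    using A knn[of t] that sub by (auto simp: \<beta>_def)

  \<comment> \<open>The pair holds a curve and a section. The new section projects the old one onto
    the epigraph along the old curve, and the new curve integrates the new section; each section
    thus belongs to the preceding curve, and its defect along its own curve is controlled by the
    distance of the two curves.\<close>
  define S where "S = rec_nat (y, w) (\<lambda>_ p. (\<lambda>t. x0 + integral {a..t} (\<lambda>s. fst (closest_point (E s (fst p s)) (snd p s))),
     \<lambda>t. closest_point (E t (fst p t)) (snd p t)))"
  define X where "X = (\<lambda>n. fst (S n))"
  define Z where "Z = (\<lambda>n. snd (S n))"
  have X0: "X 0 = y" and Z0: "Z 0 = w" by (simp_all add: X_def Z_def S_def)
  have ZS: "Z (Suc n) t = closest_point (E t (X n t)) (Z n t)" for n t
    by (simp add: X_def Z_def S_def)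
  have XS: "X (Suc n) t = x0 + integral {a..t} (\<lambda>s. fst (Z (Suc n) s))" for n t
    by (simp add: X_def Z_def S_def)
  have ZE: "Z (Suc n) t \<in> E t (X n t)" if "t \<in> {a..T}" for n t
    unfolding ZS using E that by (intro closest_point_in_set) auto
  have Zd: "norm (Z (Suc n) t - Z n t) = infdist (Z n t) (E t (X n t))" if "t \<in> {a..T}" for n t
    unfolding ZS using E that by (subst infdist_eq_dist_closest_point) (auto simp: dist_norm norm_minus_commute)
  have Z1: "norm (Z (Suc 0) t - Z 0 t) \<le> \<gamma> t" if "t \<in> {a..T}" for t
    using Zd[OF that, of 0] w\<gamma>[OF that] by (simp add: X0 Z0)
  have Zk: "norm (Z (Suc (Suc n)) t - Z (Suc n) t) \<le> k t * norm (X (Suc n) t - X n t)" if "t \<in> {a..T}" for n t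
    using Zd[OF that, of "Suc n"] lip[OF that ZE[OF that], of n "X (Suc n) t"] by (simp add: norm_minus_commute)
  have XScont: "continuous_on {a..T} (X (Suc n))" if "Z (Suc n) absolutely_integrable_on {a..T}" for n
  proof -
    have "(\<lambda>s. fst (Z (Suc n) s)) integrable_on {a..T}"
      using absolutely_integrable_fst[OF that] by (simp add: absolutely_integrable_on_def)
    then show ?thesis unfolding XS by (intro continuous_intros indefinite_integral_continuous_1)
  qed
  have Zm: "Z (Suc n) \<in> borel_measurable (lebesgue_on {a..T})"
    if "continuous_on {a..T} (X n)" "Z n absolutely_integrable_on {a..T}" for n
    using meas[OF that(1) absolutely_integrable_imp_borel_measurable[OF that(2)]] by (simp add: ZS[abs_def])
  have y0: "continuous_on {a..T} y"
  proof -
    have "(\<lambda>s. fst (w s)) integrable_on {a..T}"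
      using absolutely_integrable_fst[OF w] by (simp add: absolutely_integrable_on_def)
    then have "continuous_on {a..T} (\<lambda>t. y a + integral {a..t} (\<lambda>s. fst (w s)))"
      by (intro continuous_intros indefinite_integral_continuous_1)
    then show ?thesis by (rule continuous_on_eq) (rule y[symmetric])
  qed
  have main: "Z n absolutely_integrable_on {a..T} \<and> Z (Suc n) absolutely_integrable_on {a..T} \<and>
      continuous_on {a..T} (X n) \<and>
      (\<forall>t\<in>{a..T}. norm (X (Suc n) t - X n t) \<le> A * exp (2 * K t) * (1/2) ^ n)" for n
  proof (induction n)
    case 0
    have Zi: "Z 0 absolutely_integrable_on {a..T}" using w by (simp add: Z0)
    have Xc: "continuous_on {a..T} (X 0)" using y0 by (simp add: X0)
    have Zi': "Z (Suc 0) absolutely_integrable_on {a..T}"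
      by (rule absolutely_integrable_perturbation[OF Zi Zm[OF Xc Zi] \<gamma> Z1])
    have "norm (X (Suc 0) t - X 0 t) \<le> A * exp (2 * K t)" if t: "t \<in> {a..T}" for t
    proof -
      have \<gamma>t: "\<gamma> integrable_on {a..t}" using t by (intro integrable_subinterval_real[OF \<gamma>]) auto
      have "norm (integral {a..t} (\<lambda>s. fst (Z (Suc 0) s)) - integral {a..t} (\<lambda>s. fst (Z 0 s))) \<le> integral {a..t} \<gamma>"
        using t by (intro norm_integral_fst_diff_le[OF Zi Zi' integrable_integral[OF \<gamma>t] Z1]) auto
      moreover have "integral {a..t} \<gamma> \<le> integral {a..T} \<gamma>"
        using t by (intro integral_subset_le \<gamma> \<gamma>t) (auto intro!: \<gamma>nn)
      moreover have "X (Suc 0) t - X 0 t = (x0 - y a) +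
          (integral {a..t} (\<lambda>s. fst (Z (Suc 0) s)) - integral {a..t} (\<lambda>s. fst (Z 0 s)))"
        using y[OF t] unfolding XS X0 Z0 by simp
      ultimately have "norm (X (Suc 0) t - X 0 t) \<le> A * 1"
        unfolding A_def using norm_triangle_ineq[of "x0 - y a" "integral {a..t} (\<lambda>s. fst (Z (Suc 0) s)) - integral {a..t} (\<lambda>s. fst (Z 0 s))"]
        by simp
      \<comment> \<open>The first correction is measured by \<open>\<gamma>\<close>, without the
        exponential weight; the weight is at least 1, so inserting it only enlarges the
        bound.\<close>
      also have "\<dots> \<le> A * exp (2 * K t)" using A K0[OF t] by (intro mult_left_mono) auto
      finally show ?thesis .
    qed
    then show ?case using Zi Zi' Xc by simp
  next
    case (Suc n)
    then have Zi: "Z (Suc n) absolutely_integrable_on {a..T}"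
      and Xd: "\<And>t. t \<in> {a..T} \<Longrightarrow> norm (X (Suc n) t - X n t) \<le> A * exp (2 * K t) * (1/2) ^ n" by auto
    have Xc: "continuous_on {a..T} (X (Suc n))" by (rule XScont[OF Zi])
    have Zb: "norm (Z (Suc (Suc n)) t - Z (Suc n) t) \<le> (1/2) ^ n * \<beta> t" if t: "t \<in> {a..T}" for t
    proof -
      have "k t * norm (X (Suc n) t - X n t) \<le> k t * (A * exp (2 * K t) * (1/2) ^ n)"
        using t sub by (intro mult_left_mono Xd knn) auto
      also have "\<dots> = (1/2) ^ n * \<beta> t" by (simp add: \<beta>_def)
      finally show ?thesis using Zk[OF t, of n] by linarith
    qed
    have "(\<lambda>t. (1/2) ^ n * \<beta> t) integrable_on {a..T}" by (rule integrable_on_mult_right[OF \<beta>i])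
    then have Zi': "Z (Suc (Suc n)) absolutely_integrable_on {a..T}"
      by (rule absolutely_integrable_perturbation[OF Zi Zm[OF Xc Zi] _ Zb])
    have "norm (X (Suc (Suc n)) t - X (Suc n) t) \<le> A * exp (2 * K t) * (1/2) ^ Suc n" if t: "t \<in> {a..T}" for t
    proof -
      have "norm (X (Suc (Suc n)) t - X (Suc n) t) =
         norm (integral {a..t} (\<lambda>s. fst (Z (Suc (Suc n)) s)) - integral {a..t} (\<lambda>s. fst (Z (Suc n) s)))"
        unfolding XS by simp
      \<comment> \<open>The factor 1/2 of the contraction arises here, from integrating the weighted
        majorant.\<close>
      also have "\<dots> \<le> (1/2) ^ n * (A * ((exp (2 * K t) - exp (2 * K a)) / 2))"
        using t by (intro norm_integral_fst_diff_le[OF Zi Zi' has_integral_mult_right[OF \<beta>I[OF t]] Zb]) auto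
      also have "\<dots> \<le> (1/2) ^ n * (A * (exp (2 * K t) / 2))"
        using A by (intro mult_left_mono divide_right_mono) auto
      finally show ?thesis by (simp add: mult_ac)
    qed
    then show ?case using Zi Zi' Xc by simp
  qed
  have Zint: "Z n absolutely_integrable_on {a..T}" for n using main by blast
  have Xd: "norm (X (Suc n) t - X n t) \<le> A * exp (2 * K t) * (1/2) ^ n" if "t \<in> {a..T}" for n t
    using main that by blast
  have Zb: "norm (Z (Suc (Suc n)) t - Z (Suc n) t) \<le> \<beta> t * (1/2) ^ n" if t: "t \<in> {a..T}" for n t
  proof -
    have "k t * norm (X (Suc n) t - X n t) \<le> k t * (A * exp (2 * K t) * (1/2) ^ n)"
      using t sub by (intro mult_left_mono Xd knn) auto
    also have "\<dots> = \<beta> t * (1/2) ^ n" by (simp add: \<beta>_def)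
    finally show ?thesis using Zk[OF t, of n] by linarith
  qed
  define x where "x = (\<lambda>t. lim (\<lambda>n. X n t))"
  define z where "z = (\<lambda>t. lim (\<lambda>n. Z n t))"
  have xlim: "(\<lambda>n. X n t) \<longlonglongrightarrow> x t" if "t \<in> {a..T}" for t
    unfolding x_def using geometric_increments_convergent(1)[of "\<lambda>n. X n t", OF Xd[OF that]]
    by (simp add: convergent_LIMSEQ_iff)
  have zlim: "(\<lambda>n. Z n t) \<longlonglongrightarrow> z t" if "t \<in> {a..T}" for t
  proof -
    have "convergent (\<lambda>n. Z (Suc n) t)"
      by (rule geometric_increments_convergent(1)[OF Zb[OF that]])
    then have "convergent (\<lambda>n. Z n t)" by (simp add: convergent_Suc_iff[of "\<lambda>n. Z n t"])
    then show ?thesis by (simp add: z_def convergent_LIMSEQ_iff)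
  qed
  have Xb: "norm (X n t - y t) \<le> 2 * (A * exp (2 * K t))" if "t \<in> {a..T}" for n t
    using geometric_increments_convergent(2)[of "\<lambda>n. X n t", OF Xd[OF that], of n] by (simp add: X0)
  \<comment> \<open>The first correction costs \<open>\<gamma>\<close>; the later ones form a
    geometric series with sum \<open>2 * \<beta> t\<close>.\<close>
  have Zwb: "norm (Z n t - w t) \<le> \<gamma> t + 2 * \<beta> t" if t: "t \<in> {a..T}" for n t
  proof (cases n)
    case 0
    then show ?thesis using \<gamma>nn[OF t] \<beta>nn[OF t] by (simp add: Z0)
  next
    case (Suc m)
    have "norm (Z (Suc m) t - Z (Suc 0) t) \<le> 2 * \<beta> t"
      by (rule geometric_increments_convergent(2)[OF Zb[OF t]])
    then show ?thesis
      using Z1[OF t] norm_triangle_ineq[of "Z (Suc m) t - Z (Suc 0) t" "Z (Suc 0) t - w t"] by (simp add: Z0 Suc)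
  qed
  let ?D = "\<lambda>t. norm (w t) + (\<gamma> t + 2 * \<beta> t)"
  have Di: "?D integrable_on {a..T}"
    using absolutely_integrable_norm[OF w]
    by (intro integrable_add \<gamma> integrable_on_mult_right \<beta>i) (auto simp: absolutely_integrable_on_def o_def)
  have ZD: "norm (Z n t) \<le> ?D t" if "t \<in> {a..T}" for n t
    using Zwb[OF that, of n] norm_triangle_sub[of "Z n t" "w t"] by linarith
  have zint: "z absolutely_integrable_on {a..T}"
  proof (rule dominated_convergence_absolutely_integrable[OF Zint Di _ zlim])
    fix t assume t: "t \<in> {a..T}"
    show "norm (z t) \<le> ?D t"
      by (rule LIMSEQ_le_const2[OF tendsto_norm[OF zlim[OF t]]]) (use ZD[OF t] in auto)
  qed
  show ?thesis
  proof (intro exI[of _ x] exI[of _ z] conjI ballI zint)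
    fix t assume t: "t \<in> {a..T}"
    show "z t \<in> E t (x t)"
    proof -
      \<comment> \<open>\<open>Z (Suc n) t\<close> lies in the set at \<open>X n t\<close>, so its
        distance to the set at \<open>x t\<close> is controlled by
        \<open>norm (X n t - x t)\<close>; closedness then turns distance 0 into membership.\<close>
      have "infdist (z t) (E t (x t)) \<le> 0"
      proof (rule LIMSEQ_le_const)
        have "(\<lambda>n. k t * norm (X n t - x t) + dist (z t) (Z (Suc n) t)) \<longlonglongrightarrow> k t * norm (x t - x t) + dist (z t) (z t)"
          by (intro tendsto_intros xlim[OF t] LIMSEQ_Suc[OF zlim[OF t]])
        then show "(\<lambda>n. k t * norm (X n t - x t) + dist (z t) (Z (Suc n) t)) \<longlonglongrightarrow> 0" by simp
        show "\<exists>N. \<forall>n\<ge>N. infdist (z t) (E t (x t)) \<le> k t * norm (X n t - x t) + dist (z t) (Z (Suc n) t)"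
          using infdist_triangle[of "z t" "E t (x t)"] lip[OF t ZE[OF t], of _ "x t"]
          by (meson add_mono_thms_linordered_semiring(3) order_trans)
      qed
      then have "infdist (z t) (E t (x t)) = 0" using infdist_nonneg[of "z t" "E t (x t)"] by linarith
      then show ?thesis using in_closed_iff_infdist_zero[OF E(1)[OF t] E(2)[OF t]] by blast
    qed
    have "(\<lambda>n. integral {a..t} (\<lambda>s. fst (Z n s))) \<longlonglongrightarrow> integral {a..t} (\<lambda>s. fst (z s))"
    proof (rule dominated_convergence(2))
      show "(\<lambda>s. fst (Z n s)) integrable_on {a..t}" for n
      proof -
        have "(\<lambda>s. fst (Z n s)) integrable_on {a..T}"
          using absolutely_integrable_fst[OF Zint] by (simp add: absolutely_integrable_on_def)
        then show ?thesis by (rule integrable_subinterval_real) (use t in auto)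
      qed
      show "?D integrable_on {a..t}"
        using t by (intro integrable_subinterval_real[OF Di]) auto
      fix s assume s: "s \<in> {a..t}"
      then have s': "s \<in> {a..T}" using t by auto
      show "norm (fst (Z n s)) \<le> ?D s" for n
        by (rule order_trans[OF norm_fst_le_norm ZD[OF s']])
      show "(\<lambda>n. fst (Z n s)) \<longlonglongrightarrow> fst (z s)" by (intro tendsto_fst zlim[OF s'])
    qed
    then have "(\<lambda>n. x0 + integral {a..t} (\<lambda>s. fst (Z (Suc n) s))) \<longlonglongrightarrow> x0 + integral {a..t} (\<lambda>s. fst (z s))"
      by (intro tendsto_intros LIMSEQ_Suc)
    then have "(\<lambda>n. X (Suc n) t) \<longlonglongrightarrow> x0 + integral {a..t} (\<lambda>s. fst (z s))" by (simp add: XS)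
    then show "x t = x0 + integral {a..t} (\<lambda>s. fst (z s))"
      using LIMSEQ_Suc[OF xlim[OF t]] LIMSEQ_unique by blast
    have "(\<lambda>n. norm (X n t - y t)) \<longlonglongrightarrow> norm (x t - y t)" by (intro tendsto_intros xlim t)
    then show "norm (x t - y t) \<le> 2 * (A * exp (2 * K t))"
      by (rule LIMSEQ_le_const2) (use Xb[OF t] in auto)
    have "(\<lambda>n. norm (Z n t - w t)) \<longlonglongrightarrow> norm (z t - w t)" by (intro tendsto_intros zlim t)
    then show "norm (z t - w t) \<le> \<gamma> t + 2 * (A * (k t * exp (2 * K t)))"
      by (rule LIMSEQ_le_const2) (use Zwb[OF t, unfolded \<beta>_def] in auto)
  qed
qed

section \<open>Trajectories and the value function\<close>

text \<open>The radius of twice the distance keeps the nearest point inside the truncation, which is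
  therefore nonempty as well as compact and convex.\<close>

lemma steiner_point_PhiH_in_epiH:
  assumes E: "closed (epiH H t x)" "convex (epiH H t x)" "epiH H t x \<noteq> {}"
  shows "steiner_point (PhiH H t x a) \<in> epiH H t x"
proof -
  let ?E = "epiH H t x"
  have "dist a (closest_point ?E a) \<le> 2 * infdist a ?E"
    using infdist_eq_dist_closest_point[OF E(1,3), of a] infdist_nonneg[of a ?E] by linarith
  then have "closest_point ?E a \<in> PhiH H t x a"
    using closest_point_in_set[OF E(1,3), of a] by (simp add: PhiH_def)
  moreover have "compact (PhiH H t x a)"
    unfolding PhiH_def by (intro closed_Int_compact E compact_cball)
  moreover have "convex (PhiH H t x a)"
    unfolding PhiH_def by (intro convex_Int E convex_cball)
  ultimately have "steiner_point (PhiH H t x a) \<in> PhiH H t x a"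
    by (intro steiner_point_in) auto
  then show ?thesis by (simp add: PhiH_def)
qed

lemma steiner_point_PhiH_eq:
  assumes "a \<in> epiH H t x"
  shows "steiner_point (PhiH H t x a) = a"
proof -
  have "PhiH H t x a = {a}" using assms by (auto simp: PhiH_def)
  then show ?thesis by (simp add: steiner_point_singleton)
qed

lemma abs_continuous_on_cong:
  assumes "abs_continuous_on S u" "\<And>t. t \<in> S \<Longrightarrow> u t = v t"
  shows "abs_continuous_on S v"
proof -
  have eq: "(\<Sum>i\<in>I. norm (v (b i) - v (a i))) = (\<Sum>i\<in>I. norm (u (b i) - u (a i)))"
    if "\<forall>i\<in>I. a i \<in> S \<and> b i \<in> S \<and> a i \<le> b i" for I :: "nat set" and a b
    using that assms(2) by (intro sum.cong) auto
  show ?thesis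
    unfolding abs_continuous_on_def
  proof (intro allI impI)
    fix e :: real assume e: "e > 0"
    obtain d where d: "d > 0" "\<forall>(I::nat set) a b. finite I \<longrightarrow> (\<forall>i\<in>I. a i \<in> S \<and> b i \<in> S \<and> a i \<le> b i) \<longrightarrow>
        (\<forall>i\<in>I. \<forall>j\<in>I. i \<noteq> j \<longrightarrow> {a i<..<b i} \<inter> {a j<..<b j} = {}) \<longrightarrow>
        (\<Sum>i\<in>I. b i - a i) < d \<longrightarrow> (\<Sum>i\<in>I. norm (u (b i) - u (a i))) < e"
      by (rule abs_continuous_onE[OF assms(1) e])
    show "\<exists>d>0. \<forall>(I::nat set) a b. finite I \<longrightarrow> (\<forall>i\<in>I. a i \<in> S \<and> b i \<in> S \<and> a i \<le> b i) \<longrightarrow>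
        (\<forall>i\<in>I. \<forall>j\<in>I. i \<noteq> j \<longrightarrow> {a i<..<b i} \<inter> {a j<..<b j} = {}) \<longrightarrow>
        (\<Sum>i\<in>I. b i - a i) < d \<longrightarrow> (\<Sum>i\<in>I. norm (v (b i) - v (a i))) < e"
    proof (intro exI[of _ d] conjI allI impI d(1))
      fix I :: "nat set" and a b
      assume I: "finite I" "\<forall>i\<in>I. a i \<in> S \<and> b i \<in> S \<and> a i \<le> b i"
        "\<forall>i\<in>I. \<forall>j\<in>I. i \<noteq> j \<longrightarrow> {a i<..<b i} \<inter> {a j<..<b j} = {}" "(\<Sum>i\<in>I. b i - a i) < d"
      show "(\<Sum>i\<in>I. norm (v (b i) - v (a i))) < e"
        unfolding eq[OF I(2)] using d(2) I by blast
    qed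
  qed
qed

text \<open>The section itself serves as the control: the Steiner pair returns a control lying in
  the epigraph unchanged, so velocity and running cost are its two components.\<close>

lemma trajectory_of_epiH_section:
  fixes H :: "real \<Rightarrow> 'n::euclidean_space \<Rightarrow> 'n \<Rightarrow> real"
  assumes z: "z absolutely_integrable_on {a..T}"
    and x: "\<And>t. t \<in> {a..T} \<Longrightarrow> x t = x0 + integral {a..t} (\<lambda>s. fst (z s))"
    and zE: "\<And>t. t \<in> {a..T} \<Longrightarrow> z t \<in> epiH H t (x t)" and a: "a \<le> T"
  shows "(x, z) \<in> trajectories (steiner_f H) T a x0"
    and "run_cost (steiner_l H) T a x z = ereal (integral {a..T} (\<lambda>t. snd (z t)))"
proof -
  let ?v = "\<lambda>s. fst (z s)"
  have v: "?v absolutely_integrable_on {a..T}" by (rule absolutely_integrable_fst[OF z])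
  then have vi: "?v integrable_on {a..T}" by (simp add: absolutely_integrable_on_def)
  have fl: "steiner_f H t (x t) (z t) = fst (z t)" "steiner_l H t (x t) (z t) = snd (z t)" if "t \<in> {a..T}" for t
    using steiner_point_PhiH_eq[OF zE[OF that]] by (simp_all add: steiner_f_def steiner_l_def)
  obtain N where N: "negligible N" and
    D: "\<And>t. t \<in> {a..T} - N \<Longrightarrow> ((\<lambda>u. integral {a..u} ?v) has_vector_derivative ?v t) (at t within {a..T})"
    using indefinite_integral_has_vector_derivative_ae[OF vi] by blast
  have "AE t in lebesgue. t \<notin> N"
    using N by (intro AE_not_in) (simp add: negligible_iff_null_sets)
  then have AE: "AE t in lebesgue. t \<in> {a..T} \<longrightarrow>
      (x has_vector_derivative steiner_f H t (x t) (z t)) (at t within {a..T})"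
  proof eventually_elim
    fix t assume tN: "t \<notin> N"
    show "t \<in> {a..T} \<longrightarrow> (x has_vector_derivative steiner_f H t (x t) (z t)) (at t within {a..T})"
    proof
      assume t: "t \<in> {a..T}"
      have "((\<lambda>u. x0 + integral {a..u} ?v) has_vector_derivative ?v t) (at t within {a..T})"
        using D[of t] t tN by (auto intro!: derivative_eq_intros)
      then have "(x has_vector_derivative ?v t) (at t within {a..T})"
        by (rule has_vector_derivative_transform[OF t, rotated]) (rule x)
      then show "(x has_vector_derivative steiner_f H t (x t) (z t)) (at t within {a..T})"
        by (simp add: fl[OF t])
    qed
  qed
  have "abs_continuous_on {a..T} (\<lambda>t. x0 + integral {a..t} ?v)"
    by (rule abs_continuous_on_lipschitz_compose[OF abs_continuous_on_indefinite_integral[OF v], where L = 1]) simp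
  then have "abs_continuous_on {a..T} x"
    by (rule abs_continuous_on_cong) (rule x[symmetric])
  moreover have "x a = x0" using x[of a] a by simp
  ultimately show "(x, z) \<in> trajectories (steiner_f H) T a x0"
    using AE z by (simp add: trajectories_def)
  have s: "(\<lambda>t. snd (z t)) absolutely_integrable_on {a..T}" by (rule absolutely_integrable_snd[OF z])
  have "(\<lambda>t. steiner_l H t (x t) (z t)) integrable_on {a..T}"
    using s integrable_eq[of "\<lambda>t. snd (z t)" "{a..T}" "\<lambda>t. steiner_l H t (x t) (z t)"] fl(2)
    by (simp add: absolutely_integrable_on_def)
  moreover have "(\<lambda>t. steiner_l H t (x t) (z t)) \<in> borel_measurable (lebesgue_on {a..T})"
    by (rule integrable_imp_measurable) fact
  moreover have "integral {a..T} (\<lambda>t. steiner_l H t (x t) (z t)) = integral {a..T} (\<lambda>t. snd (z t))"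
    using fl(2) by (intro Henstock_Kurzweil_Integration.integral_cong) auto
  ultimately show "run_cost (steiner_l H) T a x z = ereal (integral {a..T} (\<lambda>t. snd (z t)))"
    by (simp add: run_cost_def)
qed

lemma trajectory_has_integral:
  assumes "(x, u) \<in> trajectories f T a x0" and t: "t \<in> {a..T}"
  shows "((\<lambda>s. f s (x s) (u s)) has_integral (x t - x a)) {a..t}"
proof -
  have AC: "abs_continuous_on {a..T} x" and
    AE: "AE t in lebesgue. t \<in> {a..T} \<longrightarrow> (x has_vector_derivative f t (x t) (u t)) (at t within {a..T})"
    using assms by (auto simp: trajectories_def)
  obtain N where N: "N \<in> null_sets lebesgue"
    "\<And>t. t \<in> space lebesgue - N \<Longrightarrow> t \<in> {a..T} \<longrightarrow> (x has_vector_derivative f t (x t) (u t)) (at t within {a..T})"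
    using AE_E3[OF AE] by blast
  have sub: "{a..t} \<subseteq> {a..T}" using t by auto
  show ?thesis
  proof (rule abs_continuous_on_has_integral_derivative)
    show "negligible N" using N(1) by (simp add: negligible_iff_null_sets)
    show "abs_continuous_on {a..t} x" by (rule abs_continuous_on_subset[OF AC sub])
    fix s assume s: "s \<in> {a..t} - N"
    then have "(x has_vector_derivative f s (x s) (u s)) (at s within {a..T})"
      using N(2)[of s] sub by auto
    then show "(x has_vector_derivative f s (x s) (u s)) (at s within {a..t})"
      by (rule has_vector_derivative_within_subset[OF _ sub])
  qed (use t in auto)
qed

text \<open>Gronwall for \<open>1 + norm (x t)\<close>, in which the growth condition is
  homogeneous. Extending the exponent to the integral over the whole interval makes the radius
  independent of the starting time.\<close>

lemma linear_growth_bound: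
  fixes x :: "real \<Rightarrow> 'n::euclidean_space"
  assumes c: "c absolutely_integrable_on {0..T}" and cnn: "\<And>t. t \<in> {0..T} \<Longrightarrow> 0 \<le> c t"
    and a: "0 \<le> a" "a \<le> T" and xc: "continuous_on {a..T} x"
    and v: "\<And>t. t \<in> {a..T} \<Longrightarrow> (v has_integral (x t - x a)) {a..t}"
    and le: "\<And>t. t \<in> {a..T} \<Longrightarrow> norm (v t) \<le> c t * (1 + norm (x t))"
    and M: "norm (x a) \<le> M" and t: "t \<in> {a..T}"
  shows "norm (x t) \<le> 2 * (1 + M) * exp (2 * integral {0..T} c)"
proof -
  have ci: "c integrable_on {0..T}" using c by (simp add: absolutely_integrable_on_def)
  have M0: "M \<ge> 0" using M norm_ge_zero order_trans by blast
  have uc: "continuous_on {a..T} (\<lambda>t. 1 + norm (x t))" by (intro continuous_intros xc)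
  have "{a..T} \<subseteq> {0..T}" using a by auto
  then have "c absolutely_integrable_on {a..T}"
    using absolutely_integrable_on_subinterval[OF c] by blast
  then have cu: "(\<lambda>t. c t * (1 + norm (x t))) integrable_on {a..T}"
    using absolutely_integrable_mult_continuous[OF _ uc] by (simp add: absolutely_integrable_on_def)
  have "1 + norm (x t) \<le> 2 * (1 + M) * exp (2 * integral {0..t} c)"
  proof (rule integral_gronwall[OF c cnn a _ uc _ t])
    fix s assume s: "s \<in> {a..T}"
    have "norm (x s - x a) \<le> integral {a..s} (\<lambda>t. c t * (1 + norm (x t)))"
    proof -
      have "norm (integral {a..s} v) \<le> integral {a..s} (\<lambda>t. c t * (1 + norm (x t)))"
        using s v[OF s] le by (intro integral_norm_bound_integral integrable_subinterval_real[OF cu]) auto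
      then show ?thesis using integral_unique[OF v[OF s]] by simp
    qed
    then show "1 + norm (x s) \<le> 1 + M + integral {a..s} (\<lambda>t. c t * (1 + norm (x t)))"
      using norm_triangle_sub[of "x s" "x a"] M by linarith
  qed (use M0 in auto)
  moreover have "integral {0..t} c \<le> integral {0..T} c"
    using t a by (intro integral_subset_le ci integrable_subinterval_real[OF ci]) (auto intro!: cnn)
  then have "2 * (1 + M) * exp (2 * integral {0..t} c) \<le> 2 * (1 + M) * exp (2 * integral {0..T} c)"
    using M0 by (intro mult_left_mono) auto
  ultimately show ?thesis by linarith
qed

lemma absolutely_integrable_Pair:
  fixes f :: "real \<Rightarrow> 'a::euclidean_space" and g :: "real \<Rightarrow> 'b::euclidean_space"
  assumes "f absolutely_integrable_on S" "g absolutely_integrable_on S"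
  shows "(\<lambda>t. (f t, g t)) absolutely_integrable_on S"
proof -
  have "(\<lambda>t. (f t, 0::'b)) absolutely_integrable_on S"
    using absolutely_integrable_linear[OF assms(1), of "\<lambda>v. (v, 0)"]
    by (simp add: o_def bounded_linear_Pair bounded_linear_ident)
  moreover have "(\<lambda>t. (0::'a, g t)) absolutely_integrable_on S"
    using absolutely_integrable_linear[OF assms(2), of "\<lambda>v. (0, v)"]
    by (simp add: o_def bounded_linear_Pair bounded_linear_ident)
  ultimately have "(\<lambda>t. (f t, 0::'b) + (0::'a, g t)) absolutely_integrable_on S"
    by (rule set_integral_add(1))
  then show ?thesis by simp
qed

text \<open>Compactness supplies a common constant; the one-point time set only adapts
  \<open>g\<close> to the time-dependent notion \<open>local_lipschitz\<close>.\<close>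

lemma locally_lipschitz_on_cball:
  fixes g :: "'n::euclidean_space \<Rightarrow> real"
  assumes g: "\<And>z. \<exists>r>0. \<exists>L. \<forall>y\<in>ball z r. \<forall>w\<in>ball z r. \<bar>g y - g w\<bar> \<le> L * norm (y - w)"
  obtains L where "L \<ge> 0" "\<And>x y. x \<in> cball 0 R \<Longrightarrow> y \<in> cball 0 R \<Longrightarrow> \<bar>g x - g y\<bar> \<le> L * norm (x - y)"
proof -
  have "local_lipschitz {0::real} (cball 0 R) (\<lambda>_. g)"
  proof (rule local_lipschitzI)
    fix t :: real and z assume "z \<in> cball (0::'n) R"
    obtain r L where rL: "r > 0" "\<And>y w. y \<in> ball z r \<Longrightarrow> w \<in> ball z r \<Longrightarrow> \<bar>g y - g w\<bar> \<le> L * norm (y - w)"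
      using g[of z] by blast
    have "\<bar>L\<bar>-lipschitz_on (cball z (r/2) \<inter> cball 0 R) g"
    proof (rule lipschitz_onI)
      fix y w assume "y \<in> cball z (r/2) \<inter> cball 0 R" "w \<in> cball z (r/2) \<inter> cball 0 R"
      then have "y \<in> ball z r" "w \<in> ball z r" using rL(1) by auto
      from rL(2)[OF this] have "\<bar>g y - g w\<bar> \<le> L * norm (y - w)" .
      also have "\<dots> \<le> \<bar>L\<bar> * norm (y - w)" by (intro mult_right_mono) auto
      finally show "dist (g y) (g w) \<le> \<bar>L\<bar> * dist y w" by (simp add: dist_real_def dist_norm)
    qed simp
    then show "\<exists>u>0. \<exists>L. \<forall>t\<in>cball t u \<inter> {0}. L-lipschitz_on (cball z u \<inter> cball 0 R) g"
      using rL(1) by (intro exI[of _ "r/2"] conjI exI[of _ "\<bar>L\<bar>"]) auto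
  qed
  then obtain L where L: "\<And>t. t \<in> {0::real} \<Longrightarrow> L-lipschitz_on (cball 0 R) g"
    by (rule local_lipschitz_compact_implies_lipschitz) auto
  show thesis
  proof (rule that)
    show "L \<ge> 0" using lipschitz_on_nonneg[OF L] by simp
    show "\<bar>g x - g y\<bar> \<le> L * norm (x - y)" if "x \<in> cball 0 R" "y \<in> cball 0 R" for x y
      using lipschitz_onD[OF L, of 0 x y] that by (simp add: dist_real_def dist_norm)
  qed
qed

section \<open>Trajectories of the Hamiltonian inside a fixed ball\<close>

text \<open>One radius and its Lipschitz function are fixed, so the family indexed by radii
  disappears. The relation of \<open>R\<close> to M is imposed only in the lemmas that confine
  trajectories.\<close>

locale hamiltonian =
  fixes H :: "real \<Rightarrow> 'n::euclidean_space \<Rightarrow> 'n \<Rightarrow> real" and T R :: real and c k :: "real \<Rightarrow> real"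
  assumes R: "R > 0"
    and H1: "\<And>x p. (\<lambda>t. H t x p) \<in> borel_measurable (lebesgue_on {0..T})"
    and H2: "\<And>t. t \<in> {0..T} \<Longrightarrow> continuous_on UNIV (\<lambda>(x, p). H t x p)"
    and H3: "\<And>t x. t \<in> {0..T} \<Longrightarrow> convex_on UNIV (H t x)"
    and H4: "\<And>t x p q. t \<in> {0..T} \<Longrightarrow> \<bar>H t x p - H t x q\<bar> \<le> c t * (1 + norm x) * norm (p - q)"
    and c_nonneg: "\<And>t. t \<in> {0..T} \<Longrightarrow> 0 \<le> c t"
    and c_int: "c absolutely_integrable_on {0..T}"
    and k_nonneg: "\<And>t. t \<in> {0..T} \<Longrightarrow> 0 \<le> k t"
    and k_int: "k absolutely_integrable_on {0..T}"
    and HL: "\<And>t x y p. t \<in> {0..T} \<Longrightarrow> x \<in> cball 0 R \<Longrightarrow> y \<in> cball 0 R \<Longrightarrow>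
        \<bar>H t x p - H t y p\<bar> \<le> k t * (1 + norm p) * norm (x - y)"
    and H00: "(\<lambda>t. H t 0 0) absolutely_integrable_on {0..T}"
begin

text \<open>Composing with the retraction onto \<open>cball 0 R\<close> makes the Lipschitz bound global; trajectories
  that start in a smaller ball never leave \<open>cball 0 R\<close> and do not see the modification.\<close>

definition retr :: "'n \<Rightarrow> 'n" where "retr = closest_point (cball 0 R)"

definition E :: "real \<Rightarrow> 'n \<Rightarrow> ('n \<times> real) set" where "E t x = epiH H t (retr x)"

text \<open>Besides the two bounds already described, \<open>- h\<close> bounds the last coordinate
  of epigraph points from below. The first two terms bound H(t,x,0) in absolute value on the ball of
  radius R, the third bounds the speed there.\<close>

definition h :: "real \<Rightarrow> real" where "h t = \<bar>H t 0 0\<bar> + (k t * R + c t * (1 + R))"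

lemma retr_in: "retr x \<in> cball 0 R"
  unfolding retr_def using R by (intro closest_point_in_set) auto

lemma retr_eq: "norm x \<le> R \<Longrightarrow> retr x = x"
  unfolding retr_def by (intro closest_point_self) simp

lemma norm_retr_diff_le: "norm (retr x - retr y) \<le> norm (x - y)"
  using closest_point_lipschitz[of "cball 0 R" x y] R by (simp add: retr_def dist_norm)

lemma norm_retr_le: "norm (retr x) \<le> norm x"
  using norm_retr_diff_le[of x 0] R by (simp add: retr_eq)

lemma continuous_on_retr: "continuous_on S retr"
  unfolding retr_def using R by (intro continuous_on_closest_point) auto

lemma E_closed: "closed (E t x)" and E_convex: "convex (E t x)"
  unfolding E_def epiH_eq_conj_epi by (rule closed_conj_epi convex_conj_epi)+

lemma epiH_nonempty: "t \<in> {0..T} \<Longrightarrow> epiH H t x \<noteq> {}"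
  unfolding epiH_eq_conj_epi by (intro conj_epi_nonempty H3)

lemma steiner_pair_in_epiH: "t \<in> {0..T} \<Longrightarrow> (steiner_f H t x a, steiner_l H t x a) \<in> epiH H t x"
  using steiner_point_PhiH_in_epiH[of H t x a] epiH_nonempty[of t x]
  by (simp add: steiner_f_def steiner_l_def epiH_eq_conj_epi closed_conj_epi convex_conj_epi)

text \<open>The retraction is nonexpansive, so the bound on the ball becomes global. The factor 2 is
  that of \<open>infdist_conj_epi_lipschitz\<close> and explains why \<open>2 * k\<close> is
  integrated in \<open>value_fun_le\<close>.\<close>

lemma E_lipschitz:
  assumes t: "t \<in> {0..T}" and z: "z \<in> E t x"
  shows "infdist z (E t y) \<le> 2 * k t * norm (x - y)"
proof -
  have kt: "0 \<le> k t" by (rule k_nonneg[OF t])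
  have "infdist z (E t y) \<le> 2 * (k t * norm (x - y))"
    unfolding E_def epiH_eq_conj_epi
  proof (rule infdist_conj_epi_lipschitz[OF H3[OF t] z[unfolded E_def epiH_eq_conj_epi]])
    fix p
    have "\<bar>H t (retr x) p - H t (retr y) p\<bar> \<le> k t * (1 + norm p) * norm (retr x - retr y)"
      by (rule HL[OF t retr_in retr_in])
    also have "\<dots> \<le> k t * (1 + norm p) * norm (x - y)"
      using kt by (intro mult_left_mono norm_retr_diff_le) auto
    finally show "\<bar>H t (retr x) p - H t (retr y) p\<bar> \<le> k t * norm (x - y) * (1 + norm p)"
      by (simp add: mult_ac)
  qed (use kt in auto)
  then show ?thesis by simp
qed

lemma norm_fst_epiH_le:
  assumes t: "t \<in> {0..T}" and z: "z \<in> epiH H t x"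
  shows "norm (fst z) \<le> c t * (1 + norm x)"
  using z unfolding epiH_eq_conj_epi by (rule norm_fst_conj_epi_le) (rule H4[OF t])

lemma abs_H_zero_le:
  assumes t: "t \<in> {0..T}" and x: "norm x \<le> R"
  shows "\<bar>H t x 0\<bar> \<le> \<bar>H t 0 0\<bar> + k t * R"
proof -
  have "\<bar>H t x 0 - H t 0 0\<bar> \<le> k t * norm x" using HL[OF t, of x 0 0] x R by simp
  also have "\<dots> \<le> k t * R" by (intro mult_left_mono x k_nonneg t)
  finally show ?thesis by linarith
qed

lemma infdist_zero_epiH_le:
  assumes t: "t \<in> {0..T}" and x: "norm x \<le> R"
  shows "infdist 0 (epiH H t x) \<le> h t"
proof -
  have "infdist 0 (epiH H t x) \<le> \<bar>H t x 0\<bar> + c t * (1 + norm x)"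
    unfolding epiH_eq_conj_epi
    by (intro infdist_zero_conj_epi_le H3[OF t] H4[OF t] mult_nonneg_nonneg c_nonneg[OF t]) simp
  also have "\<dots> \<le> (\<bar>H t 0 0\<bar> + k t * R) + c t * (1 + R)"
    using x by (intro add_mono abs_H_zero_le t mult_left_mono c_nonneg[OF t]) auto
  finally show ?thesis by (simp add: h_def)
qed

lemma speed_le_h:
  assumes t: "t \<in> {0..T}" and x: "norm x \<le> R"
  shows "c t * (1 + norm x) \<le> h t"
proof -
  have "c t * (1 + norm x) \<le> c t * (1 + R)" using x by (intro mult_left_mono c_nonneg[OF t]) auto
  moreover have "0 \<le> k t * R" using k_nonneg[OF t] R by simp
  ultimately show ?thesis unfolding h_def by linarith
qed

text \<open>The conjugate inequality at momentum 0 bounds the cost coordinate from below by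
  \<open>- H t x 0\<close>.\<close>

lemma minus_h_le_snd_epiH:
  assumes t: "t \<in> {0..T}" and x: "norm x \<le> R" and z: "z \<in> epiH H t x"
  shows "- h t \<le> snd z"
proof -
  have "- H t x 0 \<le> snd z"
    using z unfolding mem_epiH_iff by (auto dest: spec[of _ 0])
  moreover have "H t x 0 \<le> h t"
  proof -
    have "0 \<le> c t * (1 + R)" using c_nonneg[OF t] R by simp
    then show ?thesis using abs_H_zero_le[OF t x] unfolding h_def by linarith
  qed
  ultimately show ?thesis by linarith
qed

lemma h_int: "h absolutely_integrable_on {0..T}"
proof -
  have "(\<lambda>t. \<bar>H t 0 0\<bar>) absolutely_integrable_on {0..T}"
    using absolutely_integrable_norm[OF H00] by (simp add: o_def)
  moreover have "(\<lambda>t. k t * R) absolutely_integrable_on {0..T}" "(\<lambda>t. c t * (1 + R)) absolutely_integrable_on {0..T}"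
    by (intro absolutely_integrable_mult_continuous k_int c_int continuous_intros)+
  ultimately show ?thesis
    unfolding h_def[abs_def] by (intro set_integral_add(1))
qed

lemma h_nonneg: "t \<in> {0..T} \<Longrightarrow> 0 \<le> h t"
  using c_nonneg[of t] k_nonneg[of t] R by (auto simp: h_def)

lemma projection_measurable:
  assumes a: "0 \<le> a" and x: "continuous_on {a..T} x" and w: "w \<in> borel_measurable (lebesgue_on {a..T})"
  shows "(\<lambda>t. closest_point (E t (x t)) (w t)) \<in> borel_measurable (lebesgue_on {a..T})"
proof (rule closest_point_measurable[OF _ _ w])
  have sub: "{a..T} \<subseteq> {0..T}" using a by auto
  have mem: "t \<in> {0..T}" if "t \<in> space (lebesgue_on {a..T})" for t using that sub by auto
  show "closed (E t (x t)) \<and> convex (E t (x t)) \<and> E t (x t) \<noteq> {}" if "t \<in> space (lebesgue_on {a..T})" for t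
    using epiH_nonempty[OF mem[OF that]] by (simp add: E_closed E_convex) (simp add: E_def)
  fix w' :: "real \<Rightarrow> 'n \<times> real" assume w': "w' \<in> borel_measurable (lebesgue_on {a..T})"
  show "(\<lambda>t. infdist (w' t) (E t (x t))) \<in> borel_measurable (lebesgue_on {a..T})"
    unfolding E_def epiH_eq_conj_epi
  proof (rule infdist_conj_epi_measurable[OF _ _ w'])
    show "convex_on UNIV (H t (retr (x t)))" if "t \<in> space (lebesgue_on {a..T})" for t
      by (rule H3[OF mem[OF that]])
    fix p
    show "(\<lambda>t. H t (retr (x t)) p) \<in> borel_measurable (lebesgue_on {a..T})"
    proof (rule caratheodory_compose_measurable[where F = "\<lambda>t x. H t x p"])
      show "(\<lambda>t. H t x p) \<in> borel_measurable (lebesgue_on {a..T})" for x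
        by (rule measurable_restrict_mono[OF H1 sub])
      show "continuous_on UNIV (\<lambda>x. H t x p)" if "t \<in> space (lebesgue_on {a..T})" for t
        using continuous_on_compose2[OF H2[OF mem[OF that]], of UNIV "\<lambda>x. (x, p)"]
        by (simp add: continuous_on_Pair)
      show "(\<lambda>t. retr (x t)) \<in> borel_measurable (lebesgue_on {a..T})"
        by (intro continuous_imp_measurable_on_sets_lebesgue continuous_on_compose2[OF continuous_on_retr[of UNIV] x]) auto
    qed
  qed
qed

text \<open>The section may belong to the epigraph at a point no farther from the origin than
  \<open>x t\<close>. This covers true trajectories as well as those of the retracted problem, for
  which confinement is not yet known.\<close>

lemma trajectory_bound:
  assumes a: "0 \<le> a" "a \<le> T" and x: "continuous_on {a..T} x"
    and v: "\<And>t. t \<in> {a..T} \<Longrightarrow> ((\<lambda>s. fst (z s)) has_integral (x t - x a)) {a..t}"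
    and z: "\<And>t. t \<in> {a..T} \<Longrightarrow> \<exists>y. norm y \<le> norm (x t) \<and> z t \<in> epiH H t y"
    and M: "norm (x a) \<le> M" and RM: "R = 2 * (1 + M) * exp (2 * integral {0..T} c)" and t: "t \<in> {a..T}"
  shows "norm (x t) \<le> R"
  unfolding RM
proof (rule linear_growth_bound[OF c_int c_nonneg a x v _ M t])
  fix s assume s: "s \<in> {a..T}"
  then have s0: "s \<in> {0..T}" using a by auto
  obtain y where y: "norm y \<le> norm (x s)" "z s \<in> epiH H s y" using z[OF s] by blast
  have "norm (fst (z s)) \<le> c s * (1 + norm y)" by (rule norm_fst_epiH_le[OF s0 y(2)])
  also have "\<dots> \<le> c s * (1 + norm (x s))" using y(1) by (intro mult_left_mono c_nonneg[OF s0]) auto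
  finally show "norm (fst (z s)) \<le> c s * (1 + norm (x s))" .
qed

text \<open>Converse passage from controls to sections. Velocities are dominated by
  \<open>h\<close>; finite cost makes the cost coordinate integrable, and its lower bound
  \<open>- h\<close> makes it absolutely integrable.\<close>

lemma trajectory_steiner_section:
  assumes s: "s \<in> {0..T}" and y0: "norm y0 \<le> M" and RM: "R = 2 * (1 + M) * exp (2 * integral {0..T} c)"
    and tr: "(y, u) \<in> trajectories (steiner_f H) T s y0"
    and fin: "run_cost (steiner_l H) T s y u \<noteq> \<infinity>"
  obtains z where "z absolutely_integrable_on {s..T}"
    "\<And>t. t \<in> {s..T} \<Longrightarrow> z t \<in> epiH H t (y t)" "\<And>t. t \<in> {s..T} \<Longrightarrow> norm (y t) \<le> R"
    "\<And>t. t \<in> {s..T} \<Longrightarrow> y t = y0 + integral {s..t} (\<lambda>r. fst (z r))"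
    "run_cost (steiner_l H) T s y u = ereal (integral {s..T} (\<lambda>t. snd (z t)))"
proof -
  define z where "z = (\<lambda>t. (steiner_f H t (y t) (u t), steiner_l H t (y t) (u t)))"
  have mem: "t \<in> {0..T}" if "t \<in> {s..T}" for t using that s by auto
  have zE: "z t \<in> epiH H t (y t)" if "t \<in> {s..T}" for t
    unfolding z_def by (rule steiner_pair_in_epiH[OF mem[OF that]])
  have ya: "y s = y0" and AC: "abs_continuous_on {s..T} y" using tr by (auto simp: trajectories_def)
  have yc: "continuous_on {s..T} y" by (rule abs_continuous_on_imp_continuous_on[OF AC])
  have hi: "((\<lambda>r. fst (z r)) has_integral (y t - y s)) {s..t}" if "t \<in> {s..T}" for t
    unfolding z_def fst_conv by (rule trajectory_has_integral[OF tr that])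
  have yR: "norm (y t) \<le> R" if "t \<in> {s..T}" for t
  proof (rule trajectory_bound[OF _ _ yc hi _ _ RM that])
    show "\<exists>x. norm x \<le> norm (y r) \<and> z r \<in> epiH H r x" if "r \<in> {s..T}" for r
      using zE[OF that] by blast
  qed (use s ya y0 in auto)
  have hs: "h absolutely_integrable_on {s..T}"
    using absolutely_integrable_on_subinterval[OF h_int, of s T] s by auto
  have "(\<lambda>r. fst (z r)) integrable_on {s..T}" using hi[of T] s by auto
  then have "(\<lambda>r. fst (z r)) \<in> borel_measurable (lebesgue_on {s..T})" by (rule integrable_imp_measurable)
  then have f: "(\<lambda>r. fst (z r)) absolutely_integrable_on {s..T}"
  proof (rule measurable_bounded_by_integrable_imp_absolutely_integrable)
    show "h integrable_on {s..T}" using hs by (simp add: absolutely_integrable_on_def)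
    show "norm (fst (z t)) \<le> h t" if "t \<in> {s..T}" for t
      using norm_fst_epiH_le[OF mem[OF that] zE[OF that]] speed_le_h[OF mem[OF that] yR[OF that]] by linarith
  qed simp
  have cost: "(\<lambda>t. snd (z t)) integrable_on {s..T}"
    "run_cost (steiner_l H) T s y u = ereal (integral {s..T} (\<lambda>t. snd (z t)))"
    using fin by (auto simp: run_cost_def z_def split: if_splits)
  have l: "(\<lambda>r. snd (z r)) absolutely_integrable_on {s..T}"
  proof (rule absolutely_integrable_absolutely_integrable_lbound[OF cost(1)])
    show "(\<lambda>t. - h t) absolutely_integrable_on {s..T}"
      using absolutely_integrable_mult_continuous[OF hs, of "\<lambda>_. - 1"] by simp
    show "- h t \<le> snd (z t)" if "t \<in> {s..T}" for t
      by (rule minus_h_le_snd_epiH[OF mem[OF that] yR[OF that] zE[OF that]])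
  qed
  show thesis
  proof (rule that[OF _ zE yR _ cost(2)])
    show "z absolutely_integrable_on {s..T}" using absolutely_integrable_Pair[OF f l] by simp
    show "y t = y0 + integral {s..t} (\<lambda>r. fst (z r))" if "t \<in> {s..T}" for t
      using integral_unique[OF hi[OF that]] ya by simp
  qed
qed

text \<open>Both orders of \<open>s\<close> and \<open>t\<close> yield the same kind of input for
  \<open>filippov\<close>, with excess at most \<open>\<Delta>\<close>. For \<open>s \<le> t\<close>
  the curve is restricted: the start moves by at most \<open>\<Delta>\<close>, and the discarded
  cost is at least \<open>- \<Delta>\<close>. Otherwise the prolongation has defect at most
  \<open>h\<close> on the added interval.\<close>

lemma extended_trajectory:
  assumes t: "t \<in> {0..T}" and s: "s \<in> {0..T}" and y0: "norm y0 \<le> R"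
    and z: "z absolutely_integrable_on {s..T}"
    and zE: "\<And>r. r \<in> {s..T} \<Longrightarrow> z r \<in> epiH H r (y r)" and yR: "\<And>r. r \<in> {s..T} \<Longrightarrow> norm (y r) \<le> R"
    and y: "\<And>r. r \<in> {s..T} \<Longrightarrow> y r = y0 + integral {s..r} (\<lambda>q. fst (z q))"
  defines "\<Delta> \<equiv> \<bar>integral {0..t} h - integral {0..s} h\<bar>"
  shows "\<exists>y' w \<gamma>. w absolutely_integrable_on {t..T} \<and> \<gamma> integrable_on {t..T} \<and>
    (\<forall>r\<in>{t..T}. y' r = y' t + integral {t..r} (\<lambda>q. fst (w q))) \<and>
    (\<forall>r\<in>{t..T}. infdist (w r) (E r (y' r)) \<le> \<gamma> r) \<and>
    norm (x0 - y' t) + integral {t..T} \<gamma> \<le> norm (x0 - y0) + \<Delta> \<and>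
    integral {t..T} (\<lambda>r. snd (w r)) + integral {t..T} \<gamma> \<le> integral {s..T} (\<lambda>r. snd (z r)) + \<Delta> \<and>
    y' T = y T"
proof -
  have hi: "h integrable_on {0..T}" using h_int by (simp add: absolutely_integrable_on_def)
  have zi: "(\<lambda>q. fst (z q)) integrable_on {s..T}" "(\<lambda>q. snd (z q)) integrable_on {s..T}"
    using absolutely_integrable_fst[OF z] absolutely_integrable_snd[OF z] by (auto simp: absolutely_integrable_on_def)
  have zE': "z r \<in> E r (y r)" if "r \<in> {s..T}" for r
    using zE[OF that] yR[OF that] by (simp add: E_def retr_eq)
  show ?thesis
  proof (cases "s \<le> t")
    case True
    have mem: "r \<in> {0..T}" if "r \<in> {s..t}" for r using that s t by auto
    have mem': "r \<in> {s..T}" if "r \<in> {s..t}" for r using that t by auto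
    have hst: "h integrable_on {s..t}"
      using s t by (intro integrable_subinterval_real[OF hi]) auto
    have zst: "(\<lambda>q. fst (z q)) integrable_on {s..t}" "(\<lambda>q. snd (z q)) integrable_on {s..t}"
      using t by (intro integrable_subinterval_real[OF zi(1)] integrable_subinterval_real[OF zi(2)]; auto)+
    have \<Delta>: "\<Delta> = integral {s..t} h"
      unfolding \<Delta>_def using integral_increment[OF hi, of s t] True s t
        Henstock_Kurzweil_Integration.integral_nonneg[OF hst h_nonneg[OF mem]] by simp
    show ?thesis
    proof (intro exI[of _ y] exI[of _ z] exI[of _ "\<lambda>_. 0"] conjI ballI)
      have "{t..T} \<subseteq> {s..T}" using True by auto
      then show "z absolutely_integrable_on {t..T}"
        using absolutely_integrable_on_subinterval[OF z] by blast
      show "y r = y t + integral {t..r} (\<lambda>q. fst (z q))" if "r \<in> {t..T}" for r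
        using integral_increment[OF zi(1), of t r] y[of r] y[of t] that True t by (simp add: algebra_simps)
      show "infdist (z r) (E r (y r)) \<le> 0" if "r \<in> {t..T}" for r
        using zE'[of r] that True by simp
      have "norm (integral {s..t} (\<lambda>q. fst (z q))) \<le> integral {s..t} h"
      proof (rule integral_norm_bound_integral[OF zst(1) hst])
        fix r assume r: "r \<in> {s..t}"
        show "norm (fst (z r)) \<le> h r"
          using norm_fst_epiH_le[OF mem[OF r] zE[OF mem'[OF r]]] speed_le_h[OF mem[OF r] yR[OF mem'[OF r]]] by linarith
      qed
      then have "norm (y t - y0) \<le> \<Delta>" using y[of t] True t unfolding \<Delta> by simp
      then show "norm (x0 - y t) + integral {t..T} (\<lambda>_. 0) \<le> norm (x0 - y0) + \<Delta>"
        using norm_triangle_ineq4[of "x0 - y0" "y t - y0"] by simp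
      have "integral {s..t} (\<lambda>r. - h r) \<le> integral {s..t} (\<lambda>r. snd (z r))"
      proof (rule integral_le)
        show "(\<lambda>r. - h r) integrable_on {s..t}" by (rule integrable_neg[OF hst])
        fix r assume r: "r \<in> {s..t}"
        show "- h r \<le> snd (z r)"
          by (rule minus_h_le_snd_epiH[OF mem[OF r] yR[OF mem'[OF r]] zE[OF mem'[OF r]]])
      qed (rule zst)
      then show "integral {t..T} (\<lambda>r. snd (z r)) + integral {t..T} (\<lambda>_. 0) \<le> integral {s..T} (\<lambda>r. snd (z r)) + \<Delta>"
        using integral_increment[OF zi(2), of t T] True t unfolding \<Delta> by simp
    qed auto
  next
    case False
    then have ts: "t \<le> s" by simp
    \<comment> \<open>Before time \<open>s\<close> the approximate section is 0: it matches the
      constant curve, adds no cost, and has defect at most \<open>h\<close>.\<close>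
    define w where "w = (\<lambda>r. if r \<in> {s..T} then z r else 0)"
    define \<gamma> where "\<gamma> = (\<lambda>r. if r \<in> {t..s} then h r else 0)"
    define y' where "y' = (\<lambda>r. if r < s then y0 else y r)"
    have hts: "h integrable_on {t..s}"
      using s t by (intro integrable_subinterval_real[OF hi]) auto
    have \<Delta>: "\<Delta> = integral {t..s} h"
    proof -
      have "0 \<le> integral {t..s} h"
        using s t by (intro Henstock_Kurzweil_Integration.integral_nonneg hts h_nonneg) auto
      then show ?thesis unfolding \<Delta>_def using integral_increment[OF hi, of t s] ts s t by simp
    qed
    have \<gamma>I: "(\<gamma> has_integral \<Delta>) {t..T}"
      unfolding \<gamma>_def \<Delta> using s integrable_integral[OF hts] by (subst has_integral_restrict) auto
    have wI: "((\<lambda>q. p (w q)) has_integral integral {s..r} (\<lambda>q. p (z q))) {t..r}"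
      if r: "r \<in> {s..T}" and pi: "(\<lambda>q. p (z q)) integrable_on {s..T}" and p0: "p 0 = 0"
      for r and p :: "'n \<times> real \<Rightarrow> 'b::euclidean_space"
    proof -
      have "(\<lambda>q. p (z q)) integrable_on {s..r}" using r by (intro integrable_subinterval_real[OF pi]) auto
      then have "((\<lambda>q. if q \<in> {s..r} then p (z q) else 0) has_integral integral {s..r} (\<lambda>q. p (z q))) {t..r}"
        using ts by (subst has_integral_restrict) auto
      then show ?thesis by (rule has_integral_eq[rotated]) (use r p0 in \<open>auto simp: w_def\<close>)
    qed
    show ?thesis
    proof (intro exI[of _ y'] exI[of _ w] exI[of _ \<gamma>] conjI ballI)
      have "(\<lambda>r. if r \<in> {s..T} then z r else 0) absolutely_integrable_on UNIV"
        using z by (simp only: absolutely_integrable_restrict_UNIV)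
      then show "w absolutely_integrable_on {t..T}"
        unfolding w_def by (rule absolutely_integrable_on_subinterval) simp
      show "\<gamma> integrable_on {t..T}" using \<gamma>I by blast
      show "y' r = y' t + integral {t..r} (\<lambda>q. fst (w q))" if r: "r \<in> {t..T}" for r
      proof (cases "r < s")
        case True
        have "integral {t..r} (\<lambda>q. fst (w q)) = integral {t..r} (\<lambda>q. 0)"
          using True by (intro Henstock_Kurzweil_Integration.integral_cong) (auto simp: w_def)
        then show ?thesis using True r by (simp add: y'_def)
      next
        case rs: False
        then have r': "r \<in> {s..T}" using r by auto
        have "integral {t..r} (\<lambda>q. fst (w q)) = integral {s..r} (\<lambda>q. fst (z q))"
          by (rule integral_unique[OF wI[OF r' zi(1)]]) simp
        moreover have "y' t = y0" using False by (simp add: y'_def)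
        ultimately show ?thesis using y[OF r'] rs by (simp add: y'_def)
      qed
      show "infdist (w r) (E r (y' r)) \<le> \<gamma> r" if r: "r \<in> {t..T}" for r
      proof (cases "r < s")
        case True
        have "infdist 0 (epiH H r y0) \<le> h r"
          using r t by (intro infdist_zero_epiH_le y0) auto
        then show ?thesis using True r y0 by (simp add: w_def y'_def \<gamma>_def E_def retr_eq)
      next
        case False
        then have "infdist (w r) (E r (y' r)) = 0" using zE'[of r] r by (simp add: w_def y'_def)
        also have "0 \<le> \<gamma> r" using r s t by (auto simp: \<gamma>_def intro!: h_nonneg)
        finally show ?thesis .
      qed
      show "norm (x0 - y' t) + integral {t..T} \<gamma> \<le> norm (x0 - y0) + \<Delta>"
        using integral_unique[OF \<gamma>I] False by (simp add: y'_def)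
      have "integral {t..T} (\<lambda>q. snd (w q)) = integral {s..T} (\<lambda>q. snd (z q))"
        using s by (intro integral_unique[OF wI[OF _ zi(2)]]) auto
      then show "integral {t..T} (\<lambda>r. snd (w r)) + integral {t..T} \<gamma> \<le> integral {s..T} (\<lambda>r. snd (z r)) + \<Delta>"
        using integral_unique[OF \<gamma>I] by simp
      show "y' T = y T" using s by (simp add: y'_def)
    qed
  qed
qed

text \<open>Write B for the distance of the starting points plus the \<open>h\<close>-integral
  between the times. The Filippov curve misses the endpoint by at most
  \<open>2 * exp (2 * \<kappa>) * B\<close>, which costs \<open>L\<close> times as much in
  \<open>g\<close> and at most \<open>\<kappa>\<close> times as much in running cost; the leading 1
  pays for prolongation or restriction.\<close>

lemma value_fun_le:
  assumes M: "M > 0" and RM: "R = 2 * (1 + M) * exp (2 * integral {0..T} c)"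
    and t: "t \<in> {0..T}" and s: "s \<in> {0..T}" and x0: "norm x0 \<le> M" and y0: "norm y0 \<le> M"
    and L: "L \<ge> 0" "\<And>x y. x \<in> cball 0 R \<Longrightarrow> y \<in> cball 0 R \<Longrightarrow> \<bar>g x - g y\<bar> \<le> L * norm (x - y)"
    and tr: "(y, u) \<in> trajectories (steiner_f H) T s y0"
  defines "\<kappa> \<equiv> integral {0..T} (\<lambda>r. 2 * k r)"
  shows "value_fun (steiner_f H) (steiner_l H) g T t x0 \<le>
    ereal (g (y T)) + run_cost (steiner_l H) T s y u +
    ereal ((1 + 2 * exp (2 * \<kappa>) * (L + \<kappa>)) * (norm (x0 - y0) + \<bar>integral {0..t} h - integral {0..s} h\<bar>))"
proof (cases "run_cost (steiner_l H) T s y u = \<infinity>")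
  case True
  then show ?thesis by simp
next
  case False
  define \<Delta> where "\<Delta> = \<bar>integral {0..t} h - integral {0..s} h\<bar>"
  have ci: "c integrable_on {0..T}" using c_int by (simp add: absolutely_integrable_on_def)
  have MR: "M \<le> R"
  proof -
    have "1 \<le> exp (2 * integral {0..T} c)"
      using Henstock_Kurzweil_Integration.integral_nonneg[OF ci c_nonneg] by simp
    then have "2 * (1 + M) * 1 \<le> R" unfolding RM using M by (intro mult_left_mono) auto
    then show ?thesis using M by simp
  qed
  obtain z where z: "z absolutely_integrable_on {s..T}"
    "\<And>r. r \<in> {s..T} \<Longrightarrow> z r \<in> epiH H r (y r)" "\<And>r. r \<in> {s..T} \<Longrightarrow> norm (y r) \<le> R"
    "\<And>r. r \<in> {s..T} \<Longrightarrow> y r = y0 + integral {s..r} (\<lambda>q. fst (z q))"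
    "run_cost (steiner_l H) T s y u = ereal (integral {s..T} (\<lambda>r. snd (z r)))"
    using trajectory_steiner_section[OF s y0 RM tr False] by blast
  obtain y' w \<gamma> where W: "w absolutely_integrable_on {t..T}" "\<gamma> integrable_on {t..T}"
    "\<forall>r\<in>{t..T}. y' r = y' t + integral {t..r} (\<lambda>q. fst (w q))"
    "\<forall>r\<in>{t..T}. infdist (w r) (E r (y' r)) \<le> \<gamma> r"
    "norm (x0 - y' t) + integral {t..T} \<gamma> \<le> norm (x0 - y0) + \<Delta>"
    "integral {t..T} (\<lambda>r. snd (w r)) + integral {t..T} \<gamma> \<le> integral {s..T} (\<lambda>r. snd (z r)) + \<Delta>"
    "y' T = y T"
    using extended_trajectory[OF t s order_trans[OF y0 MR] z(1-4), of x0] unfolding \<Delta>_def[symmetric] by blast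
  note w = W(1,2) W(3,4)[rule_format] W(5-7)
  define A where "A = norm (x0 - y' t) + integral {t..T} \<gamma>"
  define K where "K = (\<lambda>r. integral {0..r} (\<lambda>r. 2 * k r))"
  have tT: "0 \<le> t" "t \<le> T" using t by auto
  have mem: "r \<in> {0..T}" if "r \<in> {t..T}" for r using that t by auto
  have k2: "(\<lambda>r. 2 * k r) absolutely_integrable_on {0..T}"
    using absolutely_integrable_mult_continuous[OF k_int, of "\<lambda>_. 2"] by (simp add: mult.commute)
  have k2i: "(\<lambda>r. 2 * k r) integrable_on {0..T}" using k2 by (simp add: absolutely_integrable_on_def)
  have \<kappa>: "\<kappa> \<ge> 0"
    unfolding \<kappa>_def by (intro Henstock_Kurzweil_Integration.integral_nonneg k2i) (auto intro!: k_nonneg)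
  have K\<kappa>: "K r \<le> \<kappa>" if "r \<in> {t..T}" for r
    unfolding K_def \<kappa>_def using mem[OF that]
    by (intro integral_subset_le k2i integrable_subinterval_real[OF k2i]) (auto intro!: k_nonneg)
  obtain x z' where x: "z' absolutely_integrable_on {t..T}"
    "\<And>r. r \<in> {t..T} \<Longrightarrow> x r = x0 + integral {t..r} (\<lambda>q. fst (z' q))"
    "\<And>r. r \<in> {t..T} \<Longrightarrow> z' r \<in> E r (x r)"
    "\<And>r. r \<in> {t..T} \<Longrightarrow> norm (x r - y' r) \<le> 2 * (A * exp (2 * K r))"
    "\<And>r. r \<in> {t..T} \<Longrightarrow> norm (z' r - w r) \<le> \<gamma> r + 2 * (A * (2 * k r * exp (2 * K r)))"
  proof -
    have "\<exists>x z'. z' absolutely_integrable_on {t..T} \<and>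
      (\<forall>r\<in>{t..T}. z' r \<in> E r (x r) \<and> x r = x0 + integral {t..r} (\<lambda>q. fst (z' q)) \<and>
        norm (x r - y' r) \<le> 2 * (A * exp (2 * K r)) \<and>
        norm (z' r - w r) \<le> \<gamma> r + 2 * (A * (2 * k r * exp (2 * K r))))"
      unfolding A_def K_def
    proof (rule filippov[OF tT k2])
      show "infdist z (E r y) \<le> 2 * k r * norm (x - y)" if "r \<in> {t..T}" "z \<in> E r x" for r x y z
        by (rule E_lipschitz[OF mem[OF that(1)] that(2)])
      show "E r q \<noteq> {}" if "r \<in> {t..T}" for r q
        unfolding E_def by (rule epiH_nonempty[OF mem[OF that]])
      show "0 \<le> 2 * k r" if "r \<in> {0..T}" for r using k_nonneg[OF that] by simp
    qed (rule E_closed projection_measurable[OF tT(1)] w; assumption)+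
    then show ?thesis using that by blast
  qed
  have vi: "(\<lambda>q. fst (z' q)) integrable_on {t..T}"
    using absolutely_integrable_fst[OF x(1)] by (simp add: absolutely_integrable_on_def)
  have xt: "x t = x0" using x(2)[of t] tT by simp
  \<comment> \<open>The curve was built for the retracted sets, but the growth bound holds for it
    too. It therefore stays in the ball, where the retraction is the identity, and it is a
    trajectory of the original problem.\<close>
  have xR: "norm (x r) \<le> R" if r: "r \<in> {t..T}" for r
  proof (rule trajectory_bound[OF tT _ _ _ _ RM r, where z = z'])
    have "continuous_on {t..T} (\<lambda>r. x0 + integral {t..r} (\<lambda>q. fst (z' q)))"
      by (intro continuous_intros indefinite_integral_continuous_1 vi)
    then show "continuous_on {t..T} x" by (rule continuous_on_eq) (rule x(2)[symmetric])
    show "((\<lambda>q. fst (z' q)) has_integral x r - x t) {t..r}" if "r \<in> {t..T}" for r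
    proof -
      have "(\<lambda>q. fst (z' q)) integrable_on {t..r}" using that by (intro integrable_subinterval_real[OF vi]) auto
      then show ?thesis using x(2)[OF that] xt by (simp add: has_integral_integral)
    qed
    show "\<exists>q. norm q \<le> norm (x r) \<and> z' r \<in> epiH H r q" if "r \<in> {t..T}" for r
      using x(3)[OF that] norm_retr_le unfolding E_def by blast
    show "norm (x t) \<le> M" using x0 xt by simp
  qed
  have z'E: "z' r \<in> epiH H r (x r)" if "r \<in> {t..T}" for r
    using x(3)[OF that] xR[OF that] by (simp add: E_def retr_eq)
  have sec: "(x, z') \<in> trajectories (steiner_f H) T t x0"
    "run_cost (steiner_l H) T t x z' = ereal (integral {t..T} (\<lambda>r. snd (z' r)))"
    by (rule trajectory_of_epiH_section[OF x(1) x(2) z'E tT(2)]; assumption)+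
  have "value_fun (steiner_f H) (steiner_l H) g T t x0 \<le> ereal (g (x T)) + run_cost (steiner_l H) T t x z'"
    unfolding value_fun_def by (rule INF_lower2[OF sec(1)]) simp
  also have "\<dots> = ereal (g (x T) + integral {t..T} (\<lambda>r. snd (z' r)))" using sec(2) by simp
  also have "\<dots> \<le> ereal (g (y T) + integral {s..T} (\<lambda>r. snd (z r)) + (1 + 2 * exp (2 * \<kappa>) * (L + \<kappa>)) * (norm (x0 - y0) + \<Delta>))"
  proof -
    define B where "B = norm (x0 - y0) + \<Delta>"
    have \<gamma>nn: "0 \<le> \<gamma> r" if "r \<in> {t..T}" for r
      using w(4)[OF that] infdist_nonneg order_trans by blast
    have A: "0 \<le> A" "A \<le> B"
      using w(5) Henstock_Kurzweil_Integration.integral_nonneg[OF w(2) \<gamma>nn] by (auto simp: A_def B_def)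
    have \<Delta>B: "\<Delta> \<le> B" by (simp add: B_def)
    have expA: "2 * (A * exp (2 * K r)) \<le> 2 * exp (2 * \<kappa>) * A" if "r \<in> {t..T}" for r
      using mult_left_mono[of "exp (2 * K r)" "exp (2 * \<kappa>)" A] K\<kappa>[OF that] A(1) by (simp add: mult_ac)
    have TT: "T \<in> {t..T}" "T \<in> {s..T}" using t s by auto
    have "g (x T) - g (y T) \<le> L * norm (x T - y T)"
      using L(2)[of "x T" "y T"] xR[OF TT(1)] z(3)[OF TT(2)] by simp
    also have "\<dots> \<le> L * (2 * exp (2 * \<kappa>) * A)"
      using x(4)[OF TT(1)] expA[OF TT(1)] w(7) by (intro mult_left_mono L(1)) auto
    finally have 1: "g (x T) - g (y T) \<le> L * (2 * exp (2 * \<kappa>) * A)" .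
    have k2t: "(\<lambda>r. 2 * k r) integrable_on {t..T}"
      using tT by (intro integrable_subinterval_real[OF k2i]) auto
    have sw: "(\<lambda>r. snd (w r)) integrable_on {t..T}" and sz: "(\<lambda>r. snd (z' r)) integrable_on {t..T}"
      using absolutely_integrable_snd[OF w(1)] absolutely_integrable_snd[OF x(1)]
      by (auto simp: absolutely_integrable_on_def)
    have "integral {t..T} (\<lambda>r. snd (z' r)) \<le>
        integral {t..T} (\<lambda>r. snd (w r) + \<gamma> r + 2 * exp (2 * \<kappa>) * A * (2 * k r))"
    proof (rule integral_le[OF sz])
      show "(\<lambda>r. snd (w r) + \<gamma> r + 2 * exp (2 * \<kappa>) * A * (2 * k r)) integrable_on {t..T}"
        by (intro integrable_add sw w(2) integrable_on_mult_right k2t)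
      fix r assume r: "r \<in> {t..T}"
      have "norm (snd (z' r - w r)) \<le> norm (z' r - w r)" by (metis norm_snd_le prod.collapse)
      then have "snd (z' r) - snd (w r) \<le> norm (z' r - w r)" by simp
      also have "\<dots> \<le> \<gamma> r + 2 * (A * (2 * k r * exp (2 * K r)))" by (rule x(5)[OF r])
      also have "2 * (A * (2 * k r * exp (2 * K r))) = 2 * (A * exp (2 * K r)) * (2 * k r)" by simp
      also have "\<dots> \<le> 2 * exp (2 * \<kappa>) * A * (2 * k r)"
        using k_nonneg[OF mem[OF r]] by (intro mult_right_mono expA[OF r]) auto
      finally show "snd (z' r) \<le> snd (w r) + \<gamma> r + 2 * exp (2 * \<kappa>) * A * (2 * k r)" by simp
    qed
    also have "\<dots> = integral {t..T} (\<lambda>r. snd (w r)) + integral {t..T} \<gamma> + 2 * exp (2 * \<kappa>) * A * integral {t..T} (\<lambda>r. 2 * k r)"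
      using sw w(2) integrable_on_mult_right[OF k2t, of "2 * exp (2 * \<kappa>) * A"]
      by (simp add: Henstock_Kurzweil_Integration.integral_add integrable_add)
    also have "integral {t..T} (\<lambda>r. 2 * k r) \<le> \<kappa>"
      unfolding \<kappa>_def using tT by (intro integral_subset_le k2t k2i) (auto intro!: k_nonneg)
    finally have 2: "integral {t..T} (\<lambda>r. snd (z' r)) \<le> integral {t..T} (\<lambda>r. snd (w r)) + integral {t..T} \<gamma> + 2 * exp (2 * \<kappa>) * A * \<kappa>"
      using A(1) by (simp add: mult_left_mono)
    have "2 * exp (2 * \<kappa>) * (L + \<kappa>) * A \<le> 2 * exp (2 * \<kappa>) * (L + \<kappa>) * B"
      using A L(1) \<kappa> by (intro mult_left_mono) auto
    then have "g (x T) + integral {t..T} (\<lambda>r. snd (z' r)) \<le>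
       g (y T) + integral {s..T} (\<lambda>r. snd (z r)) + (B + 2 * exp (2 * \<kappa>) * (L + \<kappa>) * B)"
      using 1 2 w(6) \<Delta>B by (simp add: algebra_simps)
    then show ?thesis unfolding B_def by (simp add: algebra_simps)
  qed
  finally show ?thesis using z(5) by (simp add: \<Delta>_def)
qed

end

section \<open>Regularity of the value function\<close>

text \<open>Exchanging the two points gives the other half of the estimate. The one-sided form is
  meaningful for extended real values without a subtraction of infinities.\<close>

theorem theorem4p9:
  fixes H :: "real \<Rightarrow> 'n::euclidean_space \<Rightarrow> 'n \<Rightarrow> real"
    and T :: real
    and c :: "real \<Rightarrow> real"
    and g :: "'n \<Rightarrow> real"
  assumes T: "T > 0"
    and H1: "\<And>x p. (\<lambda>t. H t x p) \<in> borel_measurable (restrict_space lebesgue {0..T})"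
    and H2: "\<And>t. t \<in> {0..T} \<Longrightarrow> continuous_on UNIV (\<lambda>(x, p). H t x p)"
    and H3: "\<And>t x. t \<in> {0..T} \<Longrightarrow> convex_on UNIV (H t x)"
    and H4_meas: "c \<in> borel_measurable (restrict_space lebesgue {0..T})"
    and H4_nonneg: "\<And>t. t \<in> {0..T} \<Longrightarrow> c t \<ge> 0"
    and H4: "\<And>t x p q. t \<in> {0..T} \<Longrightarrow> \<bar>H t x p - H t x q\<bar> \<le> c t * (1 + norm x) * norm (p - q)"
    and c_int: "c absolutely_integrable_on {0..T}"
    and HLC: "\<And>R. R > 0 \<Longrightarrow> \<exists>k :: real \<Rightarrow> real.
                 k \<in> borel_measurable (restrict_space lebesgue {0..T}) \<and>
                 k absolutely_integrable_on {0..T} \<and>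
                 (\<forall>t\<in>{0..T}. k t \<ge> 0) \<and>
                 (\<forall>t\<in>{0..T}. \<forall>x\<in>cball 0 R. \<forall>y\<in>cball 0 R. \<forall>p.
                    \<bar>H t x p - H t y p\<bar> \<le> k t * (1 + norm p) * norm (x - y))"
    and H00_int: "(\<lambda>t. H t 0 0) absolutely_integrable_on {0..T}"
    and g_loclip: "\<And>z. \<exists>r>0. \<exists>L. \<forall>y\<in>ball z r. \<forall>w\<in>ball z r. \<bar>g y - g w\<bar> \<le> L * norm (y - w)"
  shows "\<forall>M>0. \<exists>(\<alpha> :: real \<Rightarrow> real) C.
           abs_continuous_on {0..T} \<alpha> \<and> C > 0 \<and>
           (\<forall>t\<in>{0..T}. \<forall>s\<in>{0..T}. \<forall>x\<in>cball 0 M. \<forall>y\<in>cball 0 M.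
              value_fun (steiner_f H) (steiner_l H) g T t x
                \<le> value_fun (steiner_f H) (steiner_l H) g T s y
                  + ereal (\<bar>\<alpha> t - \<alpha> s\<bar> + C * norm (x - y)))"
proof (intro allI impI)
  fix M :: real assume M: "M > 0"
  define R where "R = 2 * (1 + M) * exp (2 * integral {0..T} c)"
  have R: "R > 0" using M by (simp add: R_def)
  obtain k where k: "k absolutely_integrable_on {0..T}" "\<And>t. t \<in> {0..T} \<Longrightarrow> 0 \<le> k t"
    "\<And>t x y p. t \<in> {0..T} \<Longrightarrow> x \<in> cball 0 R \<Longrightarrow> y \<in> cball 0 R \<Longrightarrow>
       \<bar>H t x p - H t y p\<bar> \<le> k t * (1 + norm p) * norm (x - y)"
    using HLC[OF R] by blast
  interpret hamiltonian H T R c k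
    by unfold_locales (rule R H1 H2 H3 H4 H4_nonneg c_int k H00_int; assumption)+
  obtain L where L: "L \<ge> 0" "\<And>x y. x \<in> cball 0 R \<Longrightarrow> y \<in> cball 0 R \<Longrightarrow> \<bar>g x - g y\<bar> \<le> L * norm (x - y)"
    using locally_lipschitz_on_cball[OF g_loclip, of R] by blast
  define \<kappa> where "\<kappa> = integral {0..T} (\<lambda>r. 2 * k r)"
  define C where "C = 1 + 2 * exp (2 * \<kappa>) * (L + \<kappa>)"
  have "\<kappa> \<ge> 0"
  proof -
    have "(\<lambda>r. 2 * k r) integrable_on {0..T}"
      using k(1) by (intro integrable_on_mult_right) (simp add: absolutely_integrable_on_def)
    then show ?thesis
      unfolding \<kappa>_def by (rule Henstock_Kurzweil_Integration.integral_nonneg) (auto intro!: k(2))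
  qed
  then have C: "C > 0" using L(1) by (simp add: C_def add_pos_nonneg)
  \<comment> \<open>Multiplying by \<open>C\<close> puts the whole constant of
    \<open>value_fun_le\<close> into the modulus in time.\<close>
  define \<alpha> where "\<alpha> = (\<lambda>t. C * integral {0..t} h)"
  have "abs_continuous_on {0..T} \<alpha>"
    unfolding \<alpha>_def
    by (rule abs_continuous_on_lipschitz_compose[OF abs_continuous_on_indefinite_integral[OF h_int], where L = C])
       (use C in \<open>simp add: abs_mult flip: right_diff_distrib\<close>)
  moreover have "value_fun (steiner_f H) (steiner_l H) g T t x
      \<le> value_fun (steiner_f H) (steiner_l H) g T s y + ereal (\<bar>\<alpha> t - \<alpha> s\<bar> + C * norm (x - y))"
    if ts: "t \<in> {0..T}" "s \<in> {0..T}" and xy: "x \<in> cball 0 M" "y \<in> cball 0 M" for t s x y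
  proof -
    let ?V = "value_fun (steiner_f H) (steiner_l H) g T"
    define D where "D = \<bar>\<alpha> t - \<alpha> s\<bar> + C * norm (x - y)"
    have D: "D = C * (norm (x - y) + \<bar>integral {0..t} h - integral {0..s} h\<bar>)"
    proof -
      have "\<alpha> t - \<alpha> s = C * (integral {0..t} h - integral {0..s} h)" by (simp add: \<alpha>_def right_diff_distrib)
      then have "\<bar>\<alpha> t - \<alpha> s\<bar> = C * \<bar>integral {0..t} h - integral {0..s} h\<bar>" using C by (simp add: abs_mult)
      then show ?thesis by (simp add: D_def distrib_left)
    qed
    \<comment> \<open>The finite quantity \<open>D\<close> is moved to the left before the infimum
      is taken, so each trajectory from \<open>(s, y)\<close> can be compared separately and no
      minimizer is required.\<close>
    have "?V t x - ereal D \<le> ?V s y"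
      unfolding value_fun_def[of _ _ _ _ s]
    proof (rule INF_greatest)
      fix q assume q: "q \<in> trajectories (steiner_f H) T s y"
      then have "(fst q, snd q) \<in> trajectories (steiner_f H) T s y" by simp
      from value_fun_le[OF M R_def ts _ _ L this, of x] xy
      show "?V t x - ereal D \<le> ereal (g (fst q T)) + run_cost (steiner_l H) T s (fst q) (snd q)"
        by (simp add: ereal_minus_le D C_def \<kappa>_def)
    qed
    then show ?thesis by (simp add: ereal_minus_le D_def)
  qed
  ultimately show "\<exists>(\<alpha> :: real \<Rightarrow> real) C. abs_continuous_on {0..T} \<alpha> \<and> C > 0 \<and>
           (\<forall>t\<in>{0..T}. \<forall>s\<in>{0..T}. \<forall>x\<in>cball 0 M. \<forall>y\<in>cball 0 M.
              value_fun (steiner_f H) (steiner_l H) g T t x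
                \<le> value_fun (steiner_f H) (steiner_l H) g T s y
                  + ereal (\<bar>\<alpha> t - \<alpha> s\<bar> + C * norm (x - y)))"
    using C by blast
qed

end
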